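(* Let $s,t$ be coprime integers greater than $1$, let $\sigma$ be an $s$-core, $\tau$ a $t$-core, and $n\ge0$ an integer. Then the set of partitions of $n$ with $s$-core $\sigma$ and $t$-core $\tau$ contains exactly one self-conjugate partition if and only if $\sigma=\sigma'$, $\tau=\tau'$ and one of the following holds: (1) $\mathrm{cor}_t(\sigma)=\mathrm{cor}_s(\tau)$ and $n=|\sigma|+|\tau|-|\mathrm{cor}_t(\sigma)|$; (2) $t$ is odd, $\mathrm{cor}_t(\sigma)\rightharpoondown_{s,t}\mathrm{cor}_s(\tau)$, and $n=|\tau|+t(\mathrm{wei}_t(\sigma)+1)$; (3) $s$ is odd, $\mathrm{cor}_s(\tau)\rightharpoondown_{t,s}\mathrm{cor}_t(\sigma)$, and $n=|\sigma|+s(\mathrm{wei}_s(\tau)+1)$; (4) $s$ and $t$ are both odd, $\mathrm{cor}_t(\sigma)\leftrightharpoons_{s,t}\mathrm{cor}_s(\tau)$, and $n=|\mathrm{cor}_t(\sigma)\star\mathrm{cor}_s(\tau)|+s(\mathrm{wei}_s(\tau)+1)+t(\mathrm{wei}_t(\sigma)+1)$; (5) $s$ and $t$ are both odd, $\mathrm{cor}_t(\sigma)=\mathrm{cor}_s(\tau)=\kappa_{s,t}$, and $n=|\sigma|+|\tau|-|\kappa_{s,t}|+st$.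
   Context: Partitions, size $|\lambda|$; beta-set $\mathcal B(\lambda)=\{\lambda_r-r:r\ge1\}$. The conjugate $\lambda'$ is given by $\lambda'_r=|\{c:\lambda_c\ge r\}|$; $\lambda$ is self-conjugate if $\lambda'=\lambda$. A rim $s$-hook is a connected set of $s$ nodes of the rim of the Young diagram (nodes $(r,c)$ with $(r+1,c+1)$ not a node) whose removal leaves a partition's diagram; $\lambda$ is an $s$-core if it has no rim $s$-hook. The $s$-core $\mathrm{cor}_s(\lambda)$ is obtained by repeatedly removing rim $s$-hooks, and the $s$-weight $\mathrm{wei}_s(\lambda)$ is the number of hooks removed, so $|\lambda|=|\mathrm{cor}_s(\lambda)|+s\,\mathrm{wei}_s(\lambda)$. An $(s,t)$-core is both an $s$-core and a $t$-core; $\kappa_{s,t}$ denotes the unique $(s,t)$-core of largest size. For $b\in\mathbb Z$ write $\bar b=-1-b$. For partitions $\alpha,\beta$ and positive integers $p,q$, write $\alpha\rightharpoondown_{p,q}\beta$ if there is an integer $b\in\mathcal B(\beta)\setminus\mathcal B(\alpha)$ with $\bar b-b\equiv q\pmod{2p}$ and $\mathcal B(\alpha)=(\mathcal B(\beta)\setminus\{b\})\cup\{\bar b\}$. For partitions $\alpha,\beta$ write $\alpha\leftrightharpoons_{s,t}\beta$ if there are distinct integers $b,c\in\mathcal B(\beta)\setminus\mathcal B(\alpha)$ with $\bar b-b\equiv t\pmod{2s}$, $\bar c-c\equiv -s\pmod{2t}$ and $\mathcal B(\alpha)=(\mathcal B(\beta)\setminus\{b,c\})\cup\{\bar b,\bar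 c\}$; in that case $\alpha\star\beta$ denotes the partition with beta-set $(\mathcal B(\beta)\setminus\{c\})\cup\{\bar c\}$. *)

theory Defs
  imports "HOL-Number_Theory.Cong"
begin

text \<open>
  A partition is its sequence of parts, padded with zeros. Rows, columns and parts are indexed
  from 0, so \<open>\<nu> r\<close> is the part \<open>\<nu>\<^bsub>r+1\<^esub>\<close> of the usual convention.
\<close>

definition is_partition :: "(nat \<Rightarrow> nat) \<Rightarrow> bool" where
  "is_partition \<nu> \<longleftrightarrow> antimono \<nu> \<and> finite {r. \<nu> r \<noteq> 0}"

definition psize :: "(nat \<Rightarrow> nat) \<Rightarrow> nat" where
  "psize \<nu> = (\<Sum>r | \<nu> r \<noteq> 0. \<nu> r)"

definition conjugate_partition :: "(nat \<Rightarrow> nat) \<Rightarrow> nat \<Rightarrow> nat" where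
  "conjugate_partition \<nu> r = card {c. \<nu> c \<ge> r + 1}"

definition beta_set :: "(nat \<Rightarrow> nat) \<Rightarrow> int set" where
  "beta_set \<nu> = {int (\<nu> r) - (int r + 1) | r. True}"

definition young_diagram :: "(nat \<Rightarrow> nat) \<Rightarrow> (nat \<times> nat) set" where
  "young_diagram \<nu> = {(r, c). c < \<nu> r}"

definition rim :: "(nat \<Rightarrow> nat) \<Rightarrow> (nat \<times> nat) set" where
  "rim \<nu> = {(r, c). (r, c) \<in> young_diagram \<nu> \<and> (r + 1, c + 1) \<notin> young_diagram \<nu>}"

definition adjacent_nodes :: "((nat \<times> nat) \<times> (nat \<times> nat)) set" where
  "adjacent_nodes = {((r, c), (r', c')).
     r = r' \<and> (c' = c + 1 \<or> c = c' + 1) \<or> c = c' \<and> (r' = r + 1 \<or> r = r' + 1)}"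

definition connected_nodes :: "(nat \<times> nat) set \<Rightarrow> bool" where
  "connected_nodes H \<longleftrightarrow> (\<forall>x\<in>H. \<forall>y\<in>H. (x, y) \<in> (adjacent_nodes \<inter> H \<times> H)\<^sup>*)"

definition is_rim_hook :: "nat \<Rightarrow> (nat \<Rightarrow> nat) \<Rightarrow> (nat \<times> nat) set \<Rightarrow> bool" where
  "is_rim_hook s \<nu> H \<longleftrightarrow>
     H \<subseteq> rim \<nu> \<and> card H = s \<and> connected_nodes H \<and>
     (\<exists>\<mu>. is_partition \<mu> \<and> young_diagram \<mu> = young_diagram \<nu> - H)"

definition remove_rim_hook :: "nat \<Rightarrow> (nat \<Rightarrow> nat) \<Rightarrow> (nat \<Rightarrow> nat) \<Rightarrow> bool" where
  "remove_rim_hook s \<nu> \<mu> \<longleftrightarrow>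
     is_partition \<mu> \<and> (\<exists>H. is_rim_hook s \<nu> H \<and> young_diagram \<mu> = young_diagram \<nu> - H)"

definition is_core :: "nat \<Rightarrow> (nat \<Rightarrow> nat) \<Rightarrow> bool" where
  "is_core s \<nu> \<longleftrightarrow> is_partition \<nu> \<and> \<not> (\<exists>H. is_rim_hook s \<nu> H)"

text \<open>
  The descriptions in \<open>cor\<close>, \<open>wei\<close> and \<open>kappa\<close> rely on well-known facts: the outcome and the number
  of steps of the removal process do not depend on the choices made (\<open>s > 0\<close>), and for coprime
  \<open>s, t\<close> there is a unique \<open>(s,t)\<close>-core of largest size.
\<close>

definition cor :: "nat \<Rightarrow> (nat \<Rightarrow> nat) \<Rightarrow> (nat \<Rightarrow> nat)" where
  "cor s \<nu> = (THE \<mu>. (remove_rim_hook s)\<^sup>*\<^sup>* \<nu> \<mu> \<and> is_core s \<mu>)"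

definition wei :: "nat \<Rightarrow> (nat \<Rightarrow> nat) \<Rightarrow> nat" where
  "wei s \<nu> = (THE w. \<exists>\<mu>. (remove_rim_hook s ^^ w) \<nu> \<mu> \<and> is_core s \<mu>)"

definition kappa :: "nat \<Rightarrow> nat \<Rightarrow> (nat \<Rightarrow> nat)" where
  "kappa s t = (THE \<kappa>. is_core s \<kappa> \<and> is_core t \<kappa> \<and>
     (\<forall>\<mu>. is_core s \<mu> \<and> is_core t \<mu> \<longrightarrow> psize \<mu> \<le> psize \<kappa>))"

definition bar :: "int \<Rightarrow> int" where
  "bar b = -1 - b"

text \<open>\<open>harpoon p q \<alpha> \<beta>\<close> is \<open>\<alpha> \<rightharpoondown>\<^bsub>p,q\<^esub> \<beta>\<close>.\<close>

definition harpoon :: "nat \<Rightarrow> nat \<Rightarrow> (nat \<Rightarrow> nat) \<Rightarrow> (nat \<Rightarrow> nat) \<Rightarrow> bool" where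
  "harpoon p q \<alpha> \<beta> \<longleftrightarrow>
     (\<exists>b \<in> beta_set \<beta> - beta_set \<alpha>.
        [bar b - b = int q] (mod (2 * int p)) \<and>
        beta_set \<alpha> = (beta_set \<beta> - {b}) \<union> {bar b})"

definition harpoons_via ::
  "nat \<Rightarrow> nat \<Rightarrow> (nat \<Rightarrow> nat) \<Rightarrow> (nat \<Rightarrow> nat) \<Rightarrow> int \<Rightarrow> int \<Rightarrow> bool" where
  "harpoons_via s t \<alpha> \<beta> b c \<longleftrightarrow>
     b \<noteq> c \<and> b \<in> beta_set \<beta> - beta_set \<alpha> \<and> c \<in> beta_set \<beta> - beta_set \<alpha> \<and>
     [bar b - b = int t] (mod (2 * int s)) \<and>
     [bar c - c = - int s] (mod (2 * int t)) \<and>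
     beta_set \<alpha> = (beta_set \<beta> - {b, c}) \<union> {bar b, bar c}"

text \<open>\<open>harpoons s t \<alpha> \<beta>\<close> is \<open>\<alpha> \<leftrightharpoons>\<^bsub>s,t\<^esub> \<beta>\<close>.\<close>

definition harpoons :: "nat \<Rightarrow> nat \<Rightarrow> (nat \<Rightarrow> nat) \<Rightarrow> (nat \<Rightarrow> nat) \<Rightarrow> bool" where
  "harpoons s t \<alpha> \<beta> \<longleftrightarrow> (\<exists>b c. harpoons_via s t \<alpha> \<beta> b c)"

text \<open>
  When \<open>\<alpha>\<close> and \<open>\<beta>\<close> are \<open>(s,t)\<close>-cores, \<open>s\<close> and \<open>t\<close> odd and coprime, at most one pair \<open>(b, c)\<close>
  qualifies, so the description below is then unambiguous.
\<close>

definition star :: "nat \<Rightarrow> nat \<Rightarrow> (nat \<Rightarrow> nat) \<Rightarrow> (nat \<Rightarrow> nat) \<Rightarrow> (nat \<Rightarrow> nat)" where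
  "star s t \<alpha> \<beta> = (THE \<gamma>. is_partition \<gamma> \<and>
     (\<exists>b c. harpoons_via s t \<alpha> \<beta> b c \<and> beta_set \<gamma> = (beta_set \<beta> - {c}) \<union> {bar c}))"

end

theory Submission
  imports Defs
begin

text \<open>
  Conjugation becomes \<open>b \<mapsto> bar b\<close> on beta-sets, and two beta-sets have the same \<open>s\<close>-core iff they have the
  same charge on every residue class modulo \<open>s\<close>. Translating whole residue classes modulo \<open>t\<close> by
  multiples of \<open>s\<close>, symmetrically under \<open>bar\<close>, fixes \<open>s\<close>-cores, permutes the \<open>t\<close>-runners and shifts sizes
  by an amount that depends only on the \<open>t\<close>-core; so \<open>\<tau>\<close> may be replaced by \<open>cor s \<tau>\<close>, and likewise
  \<open>\<sigma>\<close> by \<open>cor t \<sigma>\<close>, after which both are \<open>(s,t)\<close>-cores.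

  If beads sit at two opposite corners of a rectangle \<open>a, a + ks, a + lt, a + ks + lt\<close> and gaps at the other
  two, then moving the beads to the other diagonal, simultaneously in the rectangle and in its image
  under \<open>bar\<close>, gives another self-conjugate partition with the same size and cores. The move is only
  impossible when \<open>bar\<close> maps some corner to an adjacent one. Hence a unique solution is an \<open>(s,t)\<close>-core up to
  exchanging \<open>b\<close> and \<open>bar b\<close> for the central hooks of length \<open>s\<close>, \<open>t\<close> or \<open>st\<close>, which yields the five cases.
  Conversely each case forces an energy-minimal configuration: a diagonal hook exists by parity of the
  weight, and undoing it leaves too little energy unless it is the central one.
\<close>

text \<open>With these rules, \<open>algebra\<close> derives congruences from congruences and equations.\<close>

declare cong_iff_dvd_diff [algebra] bar_def [algebra]

lemma bar_bar [simp]: "bar (bar b) = b"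
  by (simp add: bar_def)

lemma bar_neq [simp]: "bar b \<noteq> b" "b \<noteq> bar b"
  unfolding bar_def by presburger+

lemma bar_inject [simp]: "bar a = bar b \<longleftrightarrow> a = b"
  by (auto simp: bar_def)

lemma bar_eq_iff: "bar a = b \<longleftrightarrow> a = bar b"
  by (auto simp: bar_def)

lemma bar_less_0_iff [simp]: "bar b < 0 \<longleftrightarrow> 0 \<le> b"
  by (auto simp: bar_def)

lemma bar_cong_bar [simp]: "[bar a = bar b] (mod m) \<longleftrightarrow> [a = b] (mod m)"
proof
  show "[a = b] (mod m)" if "[bar a = bar b] (mod m)" using that by algebra
  show "[bar a = bar b] (mod m)" if "[a = b] (mod m)" using that by algebra
qed


section \<open>Maya diagrams\<close>

definition maya :: "int set \<Rightarrow> bool" where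
  "maya B \<longleftrightarrow> finite (B - {..<0}) \<and> finite ({..<0} - B)"

definition charge :: "(int \<Rightarrow> int) \<Rightarrow> int set \<Rightarrow> int" where
  "charge w B = sum w (B - {..<0}) - sum w ({..<0} - B)"

definition energy :: "int set \<Rightarrow> int" where
  "energy = charge (\<lambda>b. b)"

lemma maya_iff_bounded: "maya B \<longleftrightarrow> (\<exists>N\<ge>0. {..<-N} \<subseteq> B \<and> B \<subseteq> {..N})"
proof
  assume "maya B"
  then have "finite (abs ` ((B - {..<0}) \<union> ({..<0} - B)))"
    by (simp add: maya_def)
  then obtain N where N: "\<And>b. b \<in> (B - {..<0}) \<union> ({..<0} - B) \<Longrightarrow> \<bar>b\<bar> \<le> N"
    by (meson bdd_above.E bdd_above_finite imageI)
  have "{..<- max N 0} \<subseteq> B" "B \<subseteq> {..max N 0}"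
    using N by force+
  then show "\<exists>N\<ge>0. {..<-N} \<subseteq> B \<and> B \<subseteq> {..N}"
    by (meson max.cobounded2)
next
  assume "\<exists>N\<ge>0. {..<-N} \<subseteq> B \<and> B \<subseteq> {..N}"
  then obtain N where "{..<-N} \<subseteq> B" "B \<subseteq> {..N}" by blast
  then have "B - {..<0} \<subseteq> {0..N}" "{..<0} - B \<subseteq> {-N..0}" by force+
  then show "maya B"
    unfolding maya_def by (metis finite_atLeastAtMost_int finite_subset)
qed

lemma maya_bounds:
  assumes "maya B"
  obtains N where "N \<ge> 0" "\<And>b. b < -N \<Longrightarrow> b \<in> B" "\<And>b. b > N \<Longrightarrow> b \<notin> B"
  using assms unfolding maya_iff_bounded by (metis atMost_iff lessThan_iff not_le subsetD)

lemma finite_maya_diff: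
  assumes "maya B" "maya C"
  shows "finite (B - C)"
proof (rule finite_subset)
  show "B - C \<subseteq> (B - {..<0}) \<union> ({..<0} - C)" by auto
  show "finite ((B - {..<0}) \<union> ({..<0} - C))"
    using assms by (simp add: maya_def)
qed

lemma maya_if_finite_diff:
  assumes "maya B" "finite (B - C)" "finite (C - B)"
  shows "maya C"
proof -
  have "C - {..<0} \<subseteq> (B - {..<0}) \<union> (C - B)" "{..<0} - C \<subseteq> ({..<0} - B) \<union> (B - C)" by auto
  then show ?thesis
    using assms unfolding maya_def by (meson finite_Un finite_subset)
qed

lemma sum_Diff_eq_sum_of_bool:
  fixes w :: "'a \<Rightarrow> 'b::ring_1"
  assumes "finite F" "A - B \<subseteq> F" "B - A \<subseteq> F"
  shows "sum w (A - B) - sum w (B - A) = (\<Sum>b\<in>F. (of_bool (b \<in> A) - of_bool (b \<in> B)) * w b)"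
proof -
  have restrict: "sum w X = (\<Sum>b\<in>F. of_bool (b \<in> X) * w b)" if "X \<subseteq> F" for X
    using that assms(1) by (simp add: inf.absorb2)
  show ?thesis
    unfolding restrict[OF assms(2)] restrict[OF assms(3)] sum_subtractf[symmetric]
    by (rule sum.cong) auto
qed

lemma charge_eq_sum:
  assumes "finite F" "B - {..<0} \<subseteq> F" "{..<0} - B \<subseteq> F"
  shows "charge w B = (\<Sum>b\<in>F. (of_bool (b \<in> B) - of_bool (b < 0)) * w b)"
  using sum_Diff_eq_sum_of_bool[OF assms] by (simp add: charge_def)

lemma charge_diff:
  assumes "maya B" "maya C"
  shows "charge w B - charge w C = sum w (B - C) - sum w (C - B)"
proof -
  define F where "F = (B - {..<0}) \<union> ({..<0} - B) \<union> (C - {..<0}) \<union> ({..<0} - C)"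
  have F: "finite F" using assms by (simp add: F_def maya_def)
  have "charge w B - charge w C = (\<Sum>b\<in>F. (of_bool (b \<in> B) - of_bool (b < 0)) * w b)
      - (\<Sum>b\<in>F. (of_bool (b \<in> C) - of_bool (b < 0)) * w b)"
    using F by (intro arg_cong2[where f = minus] charge_eq_sum) (auto simp: F_def)
  also have "\<dots> = (\<Sum>b\<in>F. (of_bool (b \<in> B) - of_bool (b \<in> C)) * w b)"
    unfolding sum_subtractf[symmetric] by (rule sum.cong) (auto simp: algebra_simps)
  also have "\<dots> = sum w (B - C) - sum w (C - B)"
    by (rule sum_Diff_eq_sum_of_bool[OF F, symmetric]) (auto simp: F_def)
  finally show ?thesis .
qed

lemma charge_add: "charge (\<lambda>b. v b + w b) B = charge v B + charge w B"
  by (simp add: charge_def sum.distrib)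

lemma charge_mult: "charge (\<lambda>b. k * w b) B = k * charge w B"
  by (simp add: charge_def sum_distrib_left[symmetric] right_diff_distrib)

lemma energy_nonneg: "energy B \<ge> 0"
proof -
  have "(\<Sum>b\<in>B - {..<0}. b) \<ge> 0" "(\<Sum>b\<in>{..<0} - B. b) \<le> 0"
    by (auto intro: sum_nonneg sum_nonpos)
  then show ?thesis by (simp add: energy_def charge_def)
qed

lemma maya_image:
  assumes B: "maya B" and "bij \<phi>" and bound: "\<And>b. \<bar>\<phi> b - b\<bar> \<le> M"
  shows "maya (\<phi> ` B)"
proof -
  obtain N where N: "N \<ge> 0" "\<And>b. b < -N \<Longrightarrow> b \<in> B" "\<And>b. b > N \<Longrightarrow> b \<notin> B"
    using maya_bounds[OF B] by metis
  have "{..<-(N + M)} \<subseteq> \<phi> ` B"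
  proof
    fix b assume b: "b \<in> {..<-(N + M)}"
    obtain c where c: "b = \<phi> c" using \<open>bij \<phi>\<close> by (metis bij_pointE)
    then have "c < -N" using bound[of c] b by auto
    then show "b \<in> \<phi> ` B" using N(2) c by blast
  qed
  moreover have "\<phi> ` B \<subseteq> {..N + M}"
  proof
    fix b assume "b \<in> \<phi> ` B"
    then obtain c where c: "b = \<phi> c" "c \<in> B" by blast
    then have "c \<le> N" using N(3) not_le by blast
    then show "b \<in> {..N + M}" using bound[of c] c by simp
  qed
  moreover have "M \<ge> 0" using bound[of 0] by linarith
  ultimately show ?thesis
    unfolding maya_iff_bounded using N(1) by (intro exI[of _ "N + M"]) simp
qed

lemma charge_image_diff:
  assumes "maya B" "maya C" "bij \<phi>" "\<And>b. \<bar>\<phi> b - b\<bar> \<le> M"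
  shows "charge w (\<phi> ` B) - charge w (\<phi> ` C) = charge (w \<circ> \<phi>) B - charge (w \<circ> \<phi>) C"
proof -
  have "inj \<phi>" using assms(3) by (rule bij_is_inj)
  then have "sum w (\<phi> ` X - \<phi> ` Y) = sum (w \<circ> \<phi>) (X - Y)" for X Y
    by (simp add: image_set_diff[symmetric] sum.reindex inj_on_subset)
  then show ?thesis
    using charge_diff[OF maya_image[OF assms(1,3,4)] maya_image[OF assms(2,3,4)], of w]
      charge_diff[OF assms(1,2), of "w \<circ> \<phi>"] by simp
qed

definition move :: "int \<Rightarrow> int \<Rightarrow> int set \<Rightarrow> int set" where
  "move a c B = insert c (B - {a})"

abbreviation flip :: "int \<Rightarrow> int set \<Rightarrow> int set" where
  "flip b \<equiv> move b (bar b)"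

lemma mem_move: "b \<in> move a c B \<longleftrightarrow> b = c \<or> b \<in> B \<and> b \<noteq> a"
  by (auto simp: move_def)

lemma move_back: "a \<in> B \<Longrightarrow> c \<notin> B \<Longrightarrow> move c a (move a c B) = B"
  by (auto simp: mem_move)

lemma maya_move:
  assumes "maya B"
  shows "maya (move a c B)"
  by (rule maya_if_finite_diff[OF assms])
    (auto simp: move_def intro: finite_subset[of _ "{a}"] finite_subset[of _ "{c}"])

lemma charge_move:
  assumes "maya B" "a \<in> B" "c \<notin> B"
  shows "charge w (move a c B) = charge w B - w a + w c"
proof -
  have "move a c B - B = {c}" "B - move a c B = {a}" using assms by (auto simp: mem_move)
  then show ?thesis
    using charge_diff[OF maya_move[OF assms(1), of a c] assms(1), of w] by simp
qed

lemma energy_move: "maya B \<Longrightarrow> a \<in> B \<Longrightarrow> c \<notin> B \<Longrightarrow> energy (move a c B) = energy B - a + c"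
  unfolding energy_def by (rule charge_move)


section \<open>Cores of Maya diagrams\<close>

text \<open>
  Quantifying over all \<open>m\<close>-periodic weights, rather than over residue classes, makes invariance under
  \<open>m\<close>-periodic substitutions immediate. For beta-sets of partitions it says that the \<open>m\<close>-cores agree.
\<close>

definition same_charge :: "int \<Rightarrow> int set \<Rightarrow> int set \<Rightarrow> bool" where
  "same_charge m B C \<longleftrightarrow> (\<forall>g. (\<forall>b. g (b + m) = g b) \<longrightarrow> charge g B = charge g C)"

definition down_closed :: "int \<Rightarrow> int set \<Rightarrow> bool" where
  "down_closed m B \<longleftrightarrow> (\<forall>b\<in>B. b - m \<in> B)"

definition maya_core :: "int \<Rightarrow> int set \<Rightarrow> bool" where
  "maya_core m C \<longleftrightarrow> m > 0 \<and> maya C \<and> down_closed m C"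

definition core_of :: "int \<Rightarrow> int set \<Rightarrow> int set \<Rightarrow> bool" where
  "core_of m B C \<longleftrightarrow> maya_core m C \<and> same_charge m B C"

lemma periodic_mult:
  fixes g :: "int \<Rightarrow> 'a"
  assumes "\<And>b. g (b + m) = g b"
  shows "g (b + m * k) = g b"
proof (induction k rule: int_induct[where k = 0])
  case base show ?case by simp
next
  case (step1 i)
  have "g (b + m * (i + 1)) = g (b + m * i + m)" by (simp add: algebra_simps)
  with step1 assms show ?case by simp
next
  case (step2 i)
  have "g (b + m * i) = g (b + m * (i - 1) + m)" by (simp add: algebra_simps)
  with step2 assms show ?case by metis
qed

lemma periodic_cong:
  fixes g :: "int \<Rightarrow> 'a"
  assumes "\<And>b. g (b + m) = g b" "[b = c] (mod m)"
  shows "g b = g c"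
proof -
  obtain k where "b = c + m * k" using assms(2) by (metis cong_iff_lin cong_sym)
  then show ?thesis using periodic_mult[of g m c k] assms(1) by simp
qed

lemma same_chargeD: "same_charge m B C \<Longrightarrow> (\<And>b. g (b + m) = g b) \<Longrightarrow> charge g B = charge g C"
  by (simp add: same_charge_def)

lemma same_charge_refl [simp]: "same_charge m B B"
  by (simp add: same_charge_def)

lemma same_charge_sym: "same_charge m B C \<Longrightarrow> same_charge m C B"
  by (simp add: same_charge_def)

lemma same_charge_trans [trans]: "same_charge m A B \<Longrightarrow> same_charge m B C \<Longrightarrow> same_charge m A C"
  by (simp add: same_charge_def)

lemma same_charge_move:
  assumes "maya B" "a \<in> B" "c \<notin> B" "[a = c] (mod m)"
  shows "same_charge m (move a c B) B"
  unfolding same_charge_def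
proof (intro allI impI)
  fix g :: "int \<Rightarrow> int" assume "\<forall>b. g (b + m) = g b"
  then have "g a = g c" using periodic_cong[of g m] assms(4) by blast
  then show "charge g (move a c B) = charge g B" by (simp add: charge_move[OF assms(1-3)])
qed

lemma same_charge_move_cong:
  assumes "maya B" "a \<in> B" "c \<notin> B" "maya C" "a' \<in> C" "c' \<notin> C"
    and "[a = a'] (mod m)" "[c = c'] (mod m)" "same_charge m B C"
  shows "same_charge m (move a c B) (move a' c' C)"
  unfolding same_charge_def
proof (intro allI impI)
  fix g :: "int \<Rightarrow> int" assume g: "\<forall>b. g (b + m) = g b"
  then have "g a = g a'" "g c = g c'"
    using periodic_cong[of g m] assms(7,8) by blast+
  then show "charge g (move a c B) = charge g (move a' c' C)"
    using g assms(9) by (simp add: charge_move assms same_charge_def)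
qed

lemma of_bool_cong_periodic:
  "(of_bool ([b + m = r] (mod m)) :: int) = of_bool ([b = r] (mod m))" for b m r :: int
  by (simp add: cong_def)

lemma sum_of_bool_cong:
  fixes X :: "int set"
  assumes "finite X"
  shows "(\<Sum>b\<in>X. of_bool ([b = r] (mod m))) = int (card {b \<in> X. [b = r] (mod m)})"
  using assms by (simp add: Collect_conj_eq)

lemma same_charge_class_card:
  assumes "maya B" "maya C" "same_charge m B C"
  shows "card {b \<in> B - C. [b = r] (mod m)} = card {b \<in> C - B. [b = r] (mod m)}"
proof -
  let ?g = "\<lambda>b. of_bool ([b = r] (mod m)) :: int"
  have "charge ?g B = charge ?g C"
    using assms(3) by (rule same_chargeD) (rule of_bool_cong_periodic)
  then have "sum ?g (B - C) = sum ?g (C - B)"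
    using charge_diff[OF assms(1,2), of ?g] by simp
  then show ?thesis
    unfolding sum_of_bool_cong[OF finite_maya_diff[OF assms(1,2)]]
      sum_of_bool_cong[OF finite_maya_diff[OF assms(2,1)]] by simp
qed

lemma down_closed_mult:
  assumes "down_closed m B" "b \<in> B" "k \<ge> 0"
  shows "b - m * k \<in> B"
proof -
  have "b - m * int n \<in> B" for n
  proof (induction n)
    case (Suc n)
    then have "b - m * int n - m \<in> B" using assms(1) by (auto simp: down_closed_def)
    then show ?case by (simp add: algebra_simps)
  qed (simp add: assms(2))
  from this[of "nat k"] assms(3) show ?thesis by simp
qed

lemma maya_coreD:
  assumes "maya_core m C"
  shows "m > 0" "maya C" "down_closed m C"
  using assms by (simp_all add: maya_core_def)

lemma maya_core_mult: "maya_core m C \<Longrightarrow> k > 0 \<Longrightarrow> maya_core (m * k) C"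
  by (auto simp: maya_core_def down_closed_def intro: down_closed_mult)

lemma maya_core_le:
  assumes "maya_core m C" "b \<in> C" "c \<le> b" "[b = c] (mod m)"
  shows "c \<in> C"
proof -
  have "m > 0" using assms(1) by (simp add: maya_core_def)
  obtain k where k: "b = c + m * k" using assms(4) by (metis cong_iff_lin cong_sym)
  with assms(3) \<open>m > 0\<close> have "k \<ge> 0" by (simp add: zero_le_mult_iff)
  then have "b - m * k \<in> C" using assms(1,2) by (auto simp: maya_core_def intro: down_closed_mult)
  then show ?thesis using k by simp
qed

lemma maya_core_less:
  assumes "maya_core m C" "b \<in> C" "c \<notin> C" "[b = c] (mod m)"
  shows "b < c"
  using maya_core_le[OF assms(1,2) _ assms(4)] assms(3) not_less by blast

lemma maya_core_unique:
  assumes "maya_core m C" "maya_core m D" "same_charge m C D"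
  shows "C = D"
proof -
  have "X \<subseteq> Y" if X: "maya_core m X" and Y: "maya_core m Y" and XY: "same_charge m X Y" for X Y
  proof (rule ccontr)
    assume "\<not> X \<subseteq> Y"
    then obtain b where b: "b \<in> X" "b \<notin> Y" by blast
    have "finite (X - Y)" using X Y by (simp add: maya_core_def finite_maya_diff)
    then have "finite {b' \<in> X - Y. [b' = b] (mod m)}" by (rule finite_subset[rotated]) blast
    with b have "card {b' \<in> X - Y. [b' = b] (mod m)} \<noteq> 0" by (auto simp del: Diff_iff)
    then have "card {b' \<in> Y - X. [b' = b] (mod m)} \<noteq> 0"
      using same_charge_class_card[OF _ _ XY] X Y by (simp add: maya_core_def)
    then obtain c where c: "c \<in> Y" "c \<notin> X" "[c = b] (mod m)"
      by (metis (mono_tags, lifting) DiffE card.empty empty_Collect_eq)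
    have "c < b" using Y c(1) b(2) c(3) by (rule maya_core_less)
    moreover have "b < c" using X b(1) c(2) cong_sym[OF c(3)] by (rule maya_core_less)
    ultimately show False by simp
  qed
  from this[OF assms] this[OF assms(2,1) same_charge_sym[OF assms(3)]] show ?thesis by blast
qed

lemma core_of_unique:
  assumes "core_of m B C" "core_of m B D"
  shows "C = D"
  using assms maya_core_unique same_charge_sym same_charge_trans unfolding core_of_def by meson

lemma core_of_move:
  assumes "core_of m B C" "maya B" "a \<in> B" "c \<notin> B" "[a = c] (mod m)"
  shows "core_of m (move a c B) C"
  using assms(1) same_charge_trans[OF same_charge_move[OF assms(2-5)]] by (simp add: core_of_def)

lemma core_of_exists:
  assumes "maya B" "m > 0"
  shows "\<exists>C k. core_of m B C \<and> energy B = energy C + m * int k \<and> (k = 0 \<longrightarrow> C = B)"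
  using assms(1)
proof (induction "nat (energy B)" arbitrary: B rule: less_induct)
  case less
  show ?case
  proof (cases "down_closed m B")
    case True
    then show ?thesis
      using less.prems assms(2) by (intro exI[of _ B] exI[of _ 0]) (simp add: core_of_def maya_core_def)
  next
    case False
    then obtain z where z: "z \<in> B" "z - m \<notin> B" by (auto simp: down_closed_def)
    define B' where "B' = move z (z - m) B"
    have B': "maya B'" "energy B' = energy B - m"
      using less.prems z by (simp_all add: B'_def maya_move energy_move)
    have charge: "same_charge m B' B"
      unfolding B'_def using less.prems z by (rule same_charge_move) algebra
    have "nat (energy B') < nat (energy B)"
      using energy_nonneg[of B'] B'(2) assms(2) by linarith
    from less.hyps[OF this B'(1)] obtain C k
      where C: "core_of m B' C" "energy B' = energy C + m * int k" by blast
    have "energy B = energy C + m * int (Suc k)" using B'(2) C(2) by (simp add: algebra_simps)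
    moreover have "core_of m B C"
      using C(1) charge same_charge_sym same_charge_trans unfolding core_of_def by blast
    ultimately show ?thesis by blast
  qed
qed

lemma core_of_energy:
  assumes "maya B" "core_of m B C"
  obtains k where "energy B = energy C + m * int k" "k = 0 \<Longrightarrow> B = C"
proof -
  have "m > 0" using assms(2) by (simp add: core_of_def maya_core_def)
  then show thesis
    using that core_of_exists[OF assms(1)] core_of_unique[OF assms(2)] by metis
qed

lemma core_of_energy_le: "maya B \<Longrightarrow> core_of m B C \<Longrightarrow> energy C \<le> energy B"
  by (erule (1) core_of_energy) (simp add: core_of_def maya_core_def)

lemma core_of_eqI:
  assumes "maya B" "core_of m B C" "energy B \<le> energy C"
  shows "B = C"
proof -
  obtain k where k: "energy B = energy C + m * int k" "k = 0 \<Longrightarrow> B = C"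
    using core_of_energy[OF assms(1,2)] by metis
  have "m > 0" using assms(2) by (simp add: core_of_def maya_core_def)
  then have "k = 0" using k(1) assms(3) by (simp add: mult_le_0_iff)
  then show ?thesis by (rule k(2))
qed

lemma maya_runner_end:
  assumes "maya B" "m > 0"
  obtains e where "[e = r] (mod m)" "e \<in> B" "e + m \<notin> B"
proof -
  obtain N where N: "N \<ge> 0" "\<And>b. b < -N \<Longrightarrow> b \<in> B" "\<And>b. b > N \<Longrightarrow> b \<notin> B"
    using maya_bounds[OF assms(1)] by metis
  define M where "M = \<bar>r\<bar> + N + 1"
  have "M > 0" using N(1) by (simp add: M_def)
  then have "M \<le> m * M" using assms(2) by simp
  then have "r - m * M < -N" "r + m * M > N" by (simp_all add: M_def)
  then have ends: "r - m * M \<in> B" "r + m * M \<notin> B" using N(2,3) by blast+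
  define P where "P = (\<lambda>k::nat. r - m * M + m * int k \<in> B)"
  have "P 0" using ends(1) by (simp add: P_def)
  moreover have "r - m * M + m * int (nat (2 * M)) = r + m * M"
    using N(1) by (simp add: M_def algebra_simps)
  then have "\<not> P (nat (2 * M))" using ends(2) unfolding P_def by (simp only: not_False_eq_True)
  ultimately obtain k where k: "P k" "\<not> P (Suc k)" using nat_induct[of P] by blast
  show thesis
  proof (rule that)
    show "[r - m * M + m * int k = r] (mod m)" by algebra
    show "r - m * M + m * int k \<in> B" "r - m * M + m * int k + m \<notin> B"
      using k by (simp_all add: P_def algebra_simps)
  qed
qed

definition runner_top :: "int \<Rightarrow> int set \<Rightarrow> int \<Rightarrow> int" where
  "runner_top m C r = (SOME e. [e = r] (mod m) \<and> e \<in> C \<and> e + m \<notin> C)"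

lemma runner_top:
  assumes "maya_core m C"
  shows "[runner_top m C r = r] (mod m)" "runner_top m C r \<in> C" "runner_top m C r + m \<notin> C"
proof -
  have "\<exists>e. [e = r] (mod m) \<and> e \<in> C \<and> e + m \<notin> C"
    using maya_runner_end maya_coreD(1,2)[OF assms] by metis
  from someI_ex[OF this]
  show "[runner_top m C r = r] (mod m)" "runner_top m C r \<in> C" "runner_top m C r + m \<notin> C"
    by (auto simp: runner_top_def)
qed

lemma mem_iff_le_runner_end:
  assumes C: "maya_core m C" and e: "e \<in> C" "e + m \<notin> C" and "[b = e] (mod m)"
  shows "b \<in> C \<longleftrightarrow> b \<le> e"
proof
  assume "b \<in> C"
  moreover have "[b = e + m] (mod m)" using assms(4) by algebra
  ultimately have "b < e + m" using maya_core_less[OF C _ e(2)] by blast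
  moreover obtain k where "b = e + m * k" using assms(4) by (metis cong_iff_lin cong_sym)
  ultimately show "b \<le> e" using maya_coreD(1)[OF C] by (simp add: mult_le_0_iff)
next
  assume "b \<le> e"
  then show "b \<in> C" using maya_core_le[OF C e(1)] cong_sym[OF assms(4)] by blast
qed

lemma mem_iff_le_runner_top:
  assumes "maya_core m C" "[b = r] (mod m)"
  shows "b \<in> C \<longleftrightarrow> b \<le> runner_top m C r"
  using mem_iff_le_runner_end[OF assms(1) runner_top(2,3)[OF assms(1)]]
    cong_trans[OF assms(2) cong_sym[OF runner_top(1)[OF assms(1)]]] by blast

lemma runner_top_eqI:
  assumes "maya_core m C" "[e = r] (mod m)" "e \<in> C" "e + m \<notin> C"
  shows "runner_top m C r = e"
proof (rule antisym)
  show "e \<le> runner_top m C r" using mem_iff_le_runner_top[OF assms(1,2)] assms(3) by blast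
  show "runner_top m C r \<le> e"
    using mem_iff_le_runner_end[OF assms(1,3,4)] runner_top(1,2)[OF assms(1)] assms(2) cong_sym cong_trans
    by blast
qed

lemma runner_top_cong:
  assumes "maya_core m C" "[r = r'] (mod m)"
  shows "runner_top m C r = runner_top m C r'"
  using runner_top[OF assms(1)] cong_trans[OF _ cong_sym[OF assms(2)]]
  by (intro runner_top_eqI[OF assms(1)]) blast+

text \<open>
  If the \<open>m\<close>-core is closed under steps by \<open>L\<close>, then the charges of the \<open>m\<close>-runners decrease along
  such steps, so every step up from a gap to a bead is compensated on the same runner.
\<close>

lemma card_steps_up_le_card_steps_down:
  assumes B: "maya B" and C: "maya C" "down_closed L C" and BC: "same_charge m B C"
  shows "finite {b. [b = r] (mod m) \<and> b \<notin> B \<and> b + L \<in> B}"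
    and "card {b. [b = r] (mod m) \<and> b \<notin> B \<and> b + L \<in> B} \<le> card {b. [b = r] (mod m) \<and> b \<in> B \<and> b + L \<notin> B}"
proof -
  let ?g = "\<lambda>b. of_bool ([b = r] (mod m)) :: int"
  let ?s = "\<lambda>b::int. b - L"
  have bij: "bij ?s" by (rule bij_diff_right)
  have bound: "\<bar>?s b - b\<bar> \<le> \<bar>L\<bar>" for b by simp
  have mem: "b \<in> ?s ` X \<longleftrightarrow> b + L \<in> X" for b X
    by (auto simp: image_iff) (metis add_diff_cancel_right')
  have shifted: "maya (?s ` B)" "maya (?s ` C)"
    using maya_image[OF _ bij bound] B C(1) by auto
  have fin: "finite (B - ?s ` B)" "finite (?s ` B - B)"
    using finite_maya_diff B shifted by auto
  have up: "{b \<in> ?s ` B - B. [b = r] (mod m)} = {b. [b = r] (mod m) \<and> b \<notin> B \<and> b + L \<in> B}"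
    and down: "{b \<in> B - ?s ` B. [b = r] (mod m)} = {b. [b = r] (mod m) \<and> b \<in> B \<and> b + L \<notin> B}"
    by (auto simp: mem)
  show "finite {b. [b = r] (mod m) \<and> b \<notin> B \<and> b + L \<in> B}"
    unfolding up[symmetric] by (rule finite_subset[OF _ fin(2)]) blast
  have "?s ` C - C = {}" using C(2) by (auto simp: down_closed_def)
  then have "sum ?g (?s ` C - C) = 0" by (simp only: sum.empty)
  then have "charge ?g (?s ` C) \<le> charge ?g C"
    using charge_diff[OF C(1) shifted(2), of ?g] sum_nonneg[of "C - ?s ` C" ?g] by simp
  moreover have "charge ?g B = charge ?g C"
    using BC by (rule same_chargeD) (rule of_bool_cong_periodic)
  moreover have "charge (?g \<circ> ?s) B = charge (?g \<circ> ?s) C"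
    by (rule same_chargeD[OF BC]) (simp add: cong_def mod_simps flip: diff_add_eq)
  then have "charge ?g (?s ` B) = charge ?g (?s ` C)"
    using charge_image_diff[OF B C(1) bij bound, of ?g] by simp
  ultimately have "sum ?g (?s ` B - B) \<le> sum ?g (B - ?s ` B)"
    using charge_diff[OF B shifted(1), of ?g] by simp
  then show "card {b. [b = r] (mod m) \<and> b \<notin> B \<and> b + L \<in> B} \<le> card {b. [b = r] (mod m) \<and> b \<in> B \<and> b + L \<notin> B}"
    unfolding sum_of_bool_cong[OF fin(1)] sum_of_bool_cong[OF fin(2)] up down by simp
qed

lemma step_down_exists:
  assumes "maya B" "core_of m B C" "down_closed L C"
    and up: "X \<subseteq> {b. [b = r] (mod m) \<and> b \<notin> B \<and> b + L \<in> B}" and E: "finite E" "card E < card X"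
  obtains c where "[c = r] (mod m)" "c \<in> B" "c + L \<notin> B" "c \<notin> E"
proof -
  let ?Y = "{b. [b = r] (mod m) \<and> b \<in> B \<and> b + L \<notin> B}"
  note steps = card_steps_up_le_card_steps_down[where L = L and r = r, OF assms(1) _ assms(3)]
  have "card X \<le> card ?Y"
    using card_mono[OF _ up] steps assms(2) by (fastforce simp: core_of_def maya_core_def)
  then have "\<not> ?Y \<subseteq> E" using E card_mono[of E ?Y] by force
  then show thesis using that by blast
qed


section \<open>Self-dual diagrams\<close>

definition dual_set :: "int set \<Rightarrow> int set" where
  "dual_set B = {b. bar b \<notin> B}"

definition self_dual :: "int set \<Rightarrow> bool" where
  "self_dual B \<longleftrightarrow> dual_set B = B"

lemma self_dual_iff: "self_dual B \<longleftrightarrow> (\<forall>b. bar b \<in> B \<longleftrightarrow> b \<notin> B)"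
  unfolding self_dual_def dual_set_def by auto

lemma self_dualD: "self_dual B \<Longrightarrow> bar b \<in> B \<longleftrightarrow> b \<notin> B"
  by (simp add: self_dual_iff)

lemma dual_set_diff_negatives:
  "dual_set B - {..<0} = bar ` ({..<0} - B)" "{..<0} - dual_set B = bar ` (B - {..<0})"
proof -
  have "b \<in> bar ` X \<longleftrightarrow> bar b \<in> X" for b X by (metis bar_bar image_iff)
  then show "dual_set B - {..<0} = bar ` ({..<0} - B)" "{..<0} - dual_set B = bar ` (B - {..<0})"
    by (auto simp: dual_set_def not_less)
qed

lemma maya_dual_set: "maya B \<Longrightarrow> maya (dual_set B)"
  by (simp add: maya_def dual_set_diff_negatives)

lemma charge_dual_set: "charge w (dual_set B) = - charge (w \<circ> bar) B"
  by (simp add: charge_def dual_set_diff_negatives sum.reindex inj_on_def)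

lemma self_dual_charge: "self_dual B \<Longrightarrow> charge (\<lambda>_. 1) B = 0"
  using charge_dual_set[of "\<lambda>_. 1" B] by (simp add: self_dual_def o_def)

lemma same_charge_dual_set:
  assumes "same_charge m B C"
  shows "same_charge m (dual_set B) (dual_set C)"
  unfolding same_charge_def
proof (intro allI impI)
  fix g :: "int \<Rightarrow> int" assume g: "\<forall>b. g (b + m) = g b"
  have "[bar (b + m) = bar b] (mod m)" for b by algebra
  then have "(g \<circ> bar) (b + m) = (g \<circ> bar) b" for b
    unfolding o_def using periodic_cong[of g m] g by blast
  then show "charge g (dual_set B) = charge g (dual_set C)"
    using same_chargeD[OF assms] by (simp add: charge_dual_set)
qed

lemma core_of_self_dual:
  assumes "self_dual B" "core_of m B C"
  shows "self_dual C"
proof -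
  have C: "maya_core m C" "same_charge m B C" using assms(2) by (simp_all add: core_of_def)
  have "bar (b - m) - m = bar b" for b by (simp add: bar_def)
  then have "maya_core m (dual_set C)"
    using C(1) maya_dual_set unfolding maya_core_def down_closed_def dual_set_def
    by (metis mem_Collect_eq)
  moreover have "same_charge m (dual_set C) C"
    using same_charge_trans[OF same_charge_sym[OF same_charge_dual_set[OF C(2)]]] assms(1) C(2)
    by (simp add: self_dual_def)
  ultimately show ?thesis
    unfolding self_dual_def using C(1) by (intro maya_core_unique)
qed

lemma self_dual_flip: "self_dual B \<Longrightarrow> b \<in> B \<Longrightarrow> self_dual (flip b B)"
  unfolding self_dual_iff mem_move by (metis bar_bar bar_neq(1))

lemma self_dual_move_pair:
  assumes "self_dual B" "a \<in> B" "c \<notin> B" "bar a \<noteq> c"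
  shows "self_dual (move (bar c) (bar a) (move a c B))"
  using assms unfolding self_dual_iff mem_move by (metis bar_bar)

definition inner :: "int \<Rightarrow> int" where
  "inner m = - ((m + 1) div 2)"

lemma bar_inner: "odd m \<Longrightarrow> bar (inner m) = inner m + m"
  unfolding inner_def bar_def by presburger

lemma bar_eq_add_iff: "bar b = b + m \<longleftrightarrow> odd m \<and> b = inner m"
  unfolding inner_def bar_def by presburger

lemma bar_eq_diff_iff: "bar b = b - m \<longleftrightarrow> odd m \<and> b = bar (inner m)"
  unfolding inner_def bar_def by presburger

lemma diagonal_bead_multiple:
  assumes "[a = bar a] (mod m)" "bar a < a" "m > 0"
  obtains i where "a = bar (inner m) + m * i" "i \<ge> 0" "odd m"
proof -
  obtain j where j: "a - bar a = m * j" using assms(1) by (auto simp: cong_iff_dvd_diff)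
  then have "m * j = 2 * a + 1" by (simp add: bar_def)
  then have "odd (m * j)" by simp
  then have odd: "odd m" "odd j" by simp_all
  obtain i where i: "j = 2 * i + 1" using odd(2) by (rule oddE)
  have "j > 0" using assms(2,3) j by (metis diff_gt_0_iff_gt zero_less_mult_pos)
  moreover have "2 * (a - (bar (inner m) + m * i)) = 0"
    using j bar_inner[OF odd(1)] by (simp add: i bar_def algebra_simps)
  ultimately show thesis using that[of i] i odd(1) by simp
qed

lemma inner_mem_core:
  assumes "maya_core m C" "self_dual C" "odd m"
  shows "inner m \<in> C" "bar (inner m) \<notin> C"
proof -
  have "inner m < bar (inner m)"
    using bar_inner[OF assms(3)] maya_coreD(1)[OF assms(1)] by simp
  moreover have "[bar (inner m) = inner m] (mod m)"
    using bar_inner[OF assms(3)] by (simp add: cong_iff_dvd_diff)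
  ultimately have "inner m \<in> C" if "bar (inner m) \<in> C"
    using maya_core_le[OF assms(1) that] by simp
  then show "inner m \<in> C" "bar (inner m) \<notin> C"
    using self_dualD[OF assms(2), of "inner m"] by blast+
qed

lemma remove_hook_pair:
  assumes "maya B" "self_dual B" "z \<in> B" "z - m \<notin> B" "bar z \<noteq> z - m"
  defines "B' \<equiv> move (bar (z - m)) (bar z) (move z (z - m) B)"
  shows "maya B'" "self_dual B'" "same_charge m B' B" "energy B' = energy B - 2 * m"
proof -
  let ?C = "move z (z - m) B"
  have dual: "bar (z - m) \<in> ?C" "bar z \<notin> ?C"
    using assms(3-5) self_dualD[OF assms(2)] unfolding mem_move by (metis bar_bar bar_neq(1))+
  have C: "maya ?C" "energy ?C = energy B - m"
    using assms(1,3,4) by (simp_all add: maya_move energy_move)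
  show "maya B'" unfolding B'_def using C(1) by (rule maya_move)
  show "self_dual B'" unfolding B'_def using assms(2-5) by (rule self_dual_move_pair)
  show "energy B' = energy B - 2 * m"
    unfolding B'_def energy_move[OF C(1) dual] C(2) by (simp add: bar_def)
  have "same_charge m B' ?C"
    unfolding B'_def using C(1) dual by (rule same_charge_move) algebra
  also have "same_charge m ?C B"
    using assms(1,3,4) by (rule same_charge_move) algebra
  finally show "same_charge m B' B" .
qed

lemma hook_off_diagonal:
  assumes "self_dual B" and no_diagonal: "\<And>a. a \<in> B \<Longrightarrow> [a = bar a] (mod m) \<Longrightarrow> a < bar a"
    and z: "z \<in> B" "z - m \<notin> B" and "m > 0"
  shows "[z \<noteq> bar z] (mod m)"
proof
  assume diag: "[z = bar z] (mod m)"
  have "[bar (z - m) = bar (bar (z - m))] (mod m)" using diag by algebra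
  then have "bar (z - m) < bar (bar (z - m))" using no_diagonal z(2) self_dualD[OF assms(1)] by blast
  moreover have "z < bar z" using no_diagonal[OF z(1) diag] .
  ultimately show False using assms(5) by (simp add: bar_def)
qed

lemma even_weight_if_no_diagonal_hook:
  assumes "maya B" "self_dual B" "core_of m B C" "\<And>a. a \<in> B \<Longrightarrow> [a = bar a] (mod m) \<Longrightarrow> a < bar a"
  shows "2 * m dvd energy B - energy C"
  using assms
proof (induction "nat (energy B)" arbitrary: B rule: less_induct)
  case less
  have m: "m > 0" using less.prems(3) by (auto simp: core_of_def maya_core_def)
  show ?case
  proof (cases "down_closed m B")
    case True
    then have "core_of m B B" using less.prems(1) m by (simp add: core_of_def maya_core_def)
    then show ?thesis using core_of_unique less.prems(3) by fastforce
  next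
    case False
    then obtain z where z: "z \<in> B" "z - m \<notin> B" by (auto simp: down_closed_def)
    have off: "[z \<noteq> bar z] (mod m)" using hook_off_diagonal[OF less.prems(2) _ z m] less.prems(4) by blast
    then have not_central: "bar z \<noteq> z - m" by (metis cong_iff_lin cong_sym diff_add_cancel mult_1_right)
    define B' where "B' = move (bar (z - m)) (bar z) (move z (z - m) B)"
    note B' = remove_hook_pair[OF less.prems(1,2) z not_central, folded B'_def]
    have diag: "a < bar a" if a: "a \<in> B'" "[a = bar a] (mod m)" for a
    proof -
      have "a \<noteq> bar z" using off a(2) cong_sym by fastforce
      moreover have "a \<noteq> z - m"
      proof
        assume "a = z - m"
        then have "[z = bar z] (mod m)" using a(2) by algebra
        then show False using off by blast
      qed
      ultimately show ?thesis using a less.prems(4) by (auto simp: B'_def mem_move)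
    qed
    have "nat (energy B') < nat (energy B)" using energy_nonneg[of B'] B'(4) m by linarith
    moreover have "core_of m B' C"
      using less.prems(3) same_charge_trans[OF B'(3)] by (simp add: core_of_def)
    ultimately have "2 * m dvd energy B' - energy C"
      using less.hyps B'(1,2) diag by blast
    then have "2 * m dvd (energy B' - energy C) + 2 * m" by (simp only: dvd_add_triv_right_iff)
    then show ?thesis using B'(4) by simp
  qed
qed

lemma odd_weight_diagonal_hook:
  assumes B: "maya B" "self_dual B" "core_of m B C" and "energy B - energy C = m * w" "odd w"
  obtains i where "bar (inner m) + m * i \<in> B" "i \<ge> 0" "odd m"
proof -
  have m: "m > 0" using B(3) by (auto simp: core_of_def maya_core_def)
  have "\<not> 2 * m dvd energy B - energy C"
    using assms(4,5) m by (simp add: mult.commute[of 2 m])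
  then obtain a where a: "a \<in> B" "[a = bar a] (mod m)" "bar a < a"
    using even_weight_if_no_diagonal_hook[OF B] by (metis bar_neq(1) linorder_neqE_linordered_idom)
  then show thesis using diagonal_bead_multiple[OF a(2,3) m] that by metis
qed

lemma self_dual_weight_one:
  assumes B: "maya B" "self_dual B" "core_of m B C" and "energy B = energy C + m"
  shows "odd m" "B = flip (inner m) C"
proof -
  have C: "self_dual C" "m > 0"
    using core_of_self_dual[OF B(2,3)] B(3) by (auto simp: core_of_def maya_core_def)
  have "\<not> down_closed m B"
  proof
    assume "down_closed m B"
    then have "core_of m B B" using B(1) C(2) by (simp add: core_of_def maya_core_def)
    then show False using core_of_unique[OF B(3)] assms(4) C(2) by simp
  qed
  then obtain z where z: "z \<in> B" "z - m \<notin> B" by (auto simp: down_closed_def)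
  have "move z (z - m) B = C"
  proof (rule core_of_eqI)
    show "maya (move z (z - m) B)" using B(1) by (rule maya_move)
    show "core_of m (move z (z - m) B) C"
      using B(3,1) z by (rule core_of_move) algebra
    show "energy (move z (z - m) B) \<le> energy C"
      using energy_move[OF B(1) z] assms(4) by simp
  qed
  then have C_eq: "C = move z (z - m) B" by simp
  have "bar z = z - m"
  proof (rule ccontr)
    assume "bar z \<noteq> z - m"
    have "z \<notin> C" using C(2) by (simp add: C_eq mem_move)
    then have "bar z \<in> C" using self_dualD[OF C(1)] by blast
    then have "bar z \<in> B" using \<open>bar z \<noteq> z - m\<close> by (simp add: C_eq mem_move)
    then show False using z(1) self_dualD[OF B(2)] by blast
  qed
  then have "odd m" and z_eq: "z = bar (inner m)" by (simp_all add: bar_eq_diff_iff)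
  then have "z - m = inner m" using \<open>bar z = z - m\<close> by simp
  then show "odd m" "B = flip (inner m) C"
    using \<open>odd m\<close> move_back[OF z] z_eq by (simp_all add: C_eq)
qed

lemma core_of_flip_core:
  assumes C: "maya_core m C" "self_dual C" and b: "b \<in> C" "b + m \<notin> C" "[b \<noteq> bar b] (mod m)"
  shows "maya_core m (flip b C)"
proof -
  have "x - m \<in> flip b C" if x: "x \<in> flip b C" for x
  proof (cases "x = bar b")
    case True
    have "bar b - m = bar (b + m)" by (simp add: bar_def)
    then have "bar b - m \<in> C" using b(2) self_dualD[OF C(2)] by simp
    moreover have "bar b - m \<noteq> b"
    proof
      assume "bar b - m = b"
      then have "[b = bar b] (mod m)" by (metis cong_iff_lin diff_add_cancel mult_1_right)
      then show False using b(3) by blast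
    qed
    ultimately show ?thesis by (simp add: mem_move True)
  next
    case False
    then have "x \<in> C" using x by (simp add: mem_move)
    moreover from this have "x - m \<noteq> b" using b(2) by auto
    ultimately show ?thesis using C(1) by (simp add: mem_move maya_core_def down_closed_def)
  qed
  then show ?thesis using C(1) by (simp add: maya_core_def down_closed_def maya_move)
qed

lemma core_of_flip:
  assumes B: "maya B" "core_of m B C" and C: "self_dual C"
    and a: "a \<in> B" "bar a \<notin> B" "[a \<noteq> bar a] (mod m)"
  shows "core_of m (flip a B) (flip (runner_top m C a) C)"
proof -
  let ?e = "runner_top m C a"
  have core: "maya_core m C" "same_charge m B C" using B(2) by (simp_all add: core_of_def)
  note e = runner_top[OF core(1), of a]
  have "bar ?e \<notin> C" using e(2) self_dualD[OF C] by blast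
  moreover have "[a = ?e] (mod m)" "[bar a = bar ?e] (mod m)" using cong_sym[OF e(1)] by simp_all
  ultimately have "same_charge m (flip a B) (flip ?e C)"
    using same_charge_move_cong[OF B(1) a(1,2) maya_coreD(2)[OF core(1)] e(2)] core(2) by blast
  moreover have "[?e \<noteq> bar ?e] (mod m)"
  proof
    assume "[?e = bar ?e] (mod m)"
    then have "[a = bar a] (mod m)" using e(1) by algebra
    then show False using a(3) by blast
  qed
  then have "maya_core m (flip ?e C)"
    using core_of_flip_core[OF core(1) C e(2,3)] by blast
  ultimately show ?thesis by (simp add: core_of_def)
qed


section \<open>Switching rectangles\<close>

definition solution :: "int \<Rightarrow> int \<Rightarrow> int set \<Rightarrow> int set \<Rightarrow> int \<Rightarrow> int set \<Rightarrow> bool" where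
  "solution s t \<sigma> \<tau> n B \<longleftrightarrow>
     maya B \<and> self_dual B \<and> same_charge s B \<sigma> \<and> same_charge t B \<tau> \<and> energy B = n"

definition rectangle :: "int \<Rightarrow> int \<Rightarrow> int \<Rightarrow> int \<Rightarrow> int \<Rightarrow> int \<Rightarrow> bool" where
  "rectangle s t a d p q \<longleftrightarrow> a + d = p + q \<and> [a = p] (mod s) \<and> [a = q] (mod t)"

definition unswitchable :: "int \<Rightarrow> int \<Rightarrow> int set \<Rightarrow> bool" where
  "unswitchable s t B \<longleftrightarrow> (\<forall>a\<in>B. \<forall>d\<in>B. \<forall>p\<in>-B. \<forall>q\<in>-B.
     rectangle s t a d p q \<longrightarrow> a \<noteq> d \<longrightarrow> p \<noteq> q \<longrightarrow> bar a = p \<or> bar a = q \<or> bar d = p \<or> bar d = q)"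

lemma solution_commute: "solution s t \<sigma> \<tau> n B \<longleftrightarrow> solution t s \<tau> \<sigma> n B"
  by (auto simp: solution_def)

lemma rectangle_commute: "rectangle s t a d p q \<longleftrightarrow> rectangle t s a d q p"
  by (auto simp: rectangle_def)

lemma unswitchable_commute: "unswitchable s t B \<longleftrightarrow> unswitchable t s B"
  unfolding unswitchable_def rectangle_commute[of s t] by blast

lemma rectangle_bar:
  assumes "rectangle s t a d p q"
  shows "rectangle s t (bar p) (bar q) (bar a) (bar d)"
proof -
  have rect: "a + d = p + q" "[a = p] (mod s)" "[a = q] (mod t)"
    using assms by (simp_all add: rectangle_def)
  have "[bar p = bar d] (mod t)" using rect(1,3) by algebra
  then show ?thesis using rect(1) cong_sym[OF rect(2)] by (simp add: rectangle_def) (simp add: bar_def)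
qed

lemma unswitchableD:
  assumes "unswitchable s t B" "a \<in> B" "d \<in> B" "p \<notin> B" "q \<notin> B" "rectangle s t a d p q" "[a \<noteq> q] (mod s)"
  shows "bar a = p \<or> bar a = q \<or> bar d = p \<or> bar d = q"
proof -
  have rect: "a + d = p + q" "[a = p] (mod s)" using assms(6) by (simp_all add: rectangle_def)
  have "a \<noteq> d"
  proof
    assume "a = d"
    then have "a + a = p + q" using rect(1) by simp
    then have "[a = q] (mod s)" using rect(2) by algebra
    then show False using assms(7) by blast
  qed
  moreover have "p \<noteq> q" using rect(2) assms(7) by blast
  ultimately show ?thesis using assms(1-6) unfolding unswitchable_def by blast
qed

definition switch :: "int \<Rightarrow> int \<Rightarrow> int \<Rightarrow> int \<Rightarrow> int set \<Rightarrow> int set" where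
  "switch a d p q B = move a p (move d q B)"

lemma switch_rectangle:
  assumes "maya B" "a \<in> B" "d \<in> B" "p \<notin> B" "q \<notin> B" "rectangle s t a d p q" "a \<noteq> d" "p \<noteq> q"
  shows "maya (switch a d p q B)" "energy (switch a d p q B) = energy B"
    "same_charge s (switch a d p q B) B" "same_charge t (switch a d p q B) B"
proof -
  have rect: "a + d = p + q" "[a = p] (mod s)" "[a = q] (mod t)"
    using assms(6) by (simp_all add: rectangle_def)
  have one: "maya (move d q B)" "maya (move d p B)" using assms(1) by (simp_all add: maya_move)
  have mem: "a \<in> move d q B" "p \<notin> move d q B" "a \<in> move d p B" "q \<notin> move d p B"
    using assms by (auto simp: mem_move)
  show "maya (switch a d p q B)" unfolding switch_def using one(1) by (rule maya_move)
  show "energy (switch a d p q B) = energy B"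
    unfolding switch_def energy_move[OF one(1) mem(1,2)] energy_move[OF assms(1,3,5)]
    using rect(1) by simp
  have "same_charge s (switch a d p q B) (move d q B)"
    unfolding switch_def by (rule same_charge_move[OF one(1) mem(1,2) rect(2)])
  also have "[d = q] (mod s)" using rect(1,2) by algebra
  then have "same_charge s (move d q B) B" using assms(1,3,5) by (intro same_charge_move)
  finally show "same_charge s (switch a d p q B) B" .
  have "switch a d p q B = move a q (move d p B)" using assms by (auto simp: switch_def mem_move)
  then have "same_charge t (switch a d p q B) (move d p B)"
    using same_charge_move[OF one(2) mem(3,4) rect(3)] by simp
  also have "[d = p] (mod t)" using rect(1,3) by algebra
  then have "same_charge t (move d p B) B" using assms(1,3,4) by (intro same_charge_move)
  finally show "same_charge t (switch a d p q B) B" .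
qed

lemma unique_solution_unswitchable:
  assumes sol: "solution s t \<sigma> \<tau> n B" and uniq: "\<And>C. solution s t \<sigma> \<tau> n C \<Longrightarrow> C = B"
  shows "unswitchable s t B"
  unfolding unswitchable_def
proof (intro ballI impI)
  fix a d p q
  assume corners: "a \<in> B" "d \<in> B" "p \<in> - B" "q \<in> - B"
    and rect: "rectangle s t a d p q" and distinct: "a \<noteq> d" "p \<noteq> q"
  have B: "maya B" "self_dual B" using sol by (auto simp: solution_def)
  show "bar a = p \<or> bar a = q \<or> bar d = p \<or> bar d = q"
  proof (rule ccontr)
    assume separate: "\<not> ?thesis"
    have separate': "bar p \<noteq> a" "bar p \<noteq> d" "bar q \<noteq> a" "bar q \<noteq> d"
      using separate by (metis bar_bar)+
    define B' where "B' = switch a d p q B"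
    define C where "C = switch (bar p) (bar q) (bar a) (bar d) B'"
    note B' = switch_rectangle[OF B(1) _ _ _ _ rect, folded B'_def]
    have mirror: "bar p \<in> B'" "bar q \<in> B'" "bar a \<notin> B'" "bar d \<notin> B'"
      using corners separate separate' self_dualD[OF B(2)] by (auto simp: B'_def switch_def mem_move)
    note C = switch_rectangle[OF _ mirror rectangle_bar[OF rect], folded C_def]
    have "bar b \<in> C \<longleftrightarrow> b \<notin> C" for b
      unfolding C_def B'_def switch_def mem_move bar_inject bar_eq_iff[of b]
      using corners distinct separate separate' by (auto simp: self_dualD[OF B(2)])
    then have "solution s t \<sigma> \<tau> n C"
      using sol B' C corners distinct same_charge_trans
      unfolding solution_def self_dual_iff by (metis ComplD bar_inject)
    then have "C = B" by (rule uniq)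
    moreover have "a \<notin> C"
      using corners self_dualD[OF B(2)] by (auto simp: C_def B'_def switch_def mem_move)
    ultimately show False using corners(1) by simp
  qed
qed

locale coprime_pair =
  fixes s t :: int
  assumes s_gt_1: "s > 1" and t_gt_1: "t > 1" and coprime_st: "coprime s t"
begin

lemma commute: "coprime_pair t s"
  using s_gt_1 t_gt_1 coprime_st by unfold_locales (simp_all add: ac_simps)

lemma s_pos: "s > 0" and t_pos: "t > 0" and st_pos: "s * t > 0"
  using s_gt_1 t_gt_1 by simp_all

lemma not_s_dvd_t: "\<not> s dvd t" and not_t_dvd_s: "\<not> t dvd s"
  using coprime_common_divisor[OF coprime_st] s_gt_1 t_gt_1 zdvd1_eq by fastforce+

lemma not_s_dvd_double_t: "odd s \<Longrightarrow> \<not> s dvd 2 * t"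
  using not_s_dvd_t by (metis coprime_dvd_mult_right_iff coprime_right_2_iff_odd)

lemma cong_st: "[x = y] (mod s) \<Longrightarrow> [x = y] (mod t) \<Longrightarrow> [x = y] (mod s * t)"
  using coprime_st by (intro coprime_cong_mult)

text \<open>
  An \<open>st\<close>-hook can be moved to any \<open>st\<close>-runner \<open>c\<close> that shares its residue modulo \<open>t\<close>;
  the conditions on \<open>c\<close> keep this move away from its mirror image.
\<close>

lemma st_gap_central_if_free_runner:
  assumes B: "maya B" "unswitchable s t B" and b: "b \<in> B" "b - s * t * m \<notin> B" "m > 0"
    and c: "[c = b] (mod t)" "[c \<noteq> b] (mod s)" "[c \<noteq> bar b] (mod s)" "[c \<noteq> bar c] (mod s * t)"
  shows "bar b = b - s * t * m"
proof -
  have "s * t * m > 0" using st_pos b(3) by simp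
  then obtain e where e: "[e = c] (mod s * t * m)" "e \<in> B" "e + s * t * m \<notin> B"
    using maya_runner_end[OF B(1)] by metis
  have es: "[e = c] (mod s)" and et: "[e = c] (mod t)" and est: "[e = c] (mod s * t)"
    using e(1) by algebra+
  let ?p = "b - s * t * m" and ?q = "e + s * t * m"
  have "[b = ?p] (mod s)" by algebra
  moreover have "[b = ?q] (mod t)" using et c(1) by algebra
  ultimately have "rectangle s t b e ?p ?q" by (simp add: rectangle_def)
  moreover have "[b \<noteq> ?q] (mod s)"
  proof
    assume "[b = ?q] (mod s)"
    then have "[c = b] (mod s)" using es by algebra
    then show False using c(2) by blast
  qed
  ultimately consider "bar b = ?p" | "bar b = ?q" | "bar e = ?p" | "bar e = ?q"
    using unswitchableD[OF B(2) b(1) e(2) b(2) e(3)] by blast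
  then show ?thesis
  proof cases
    case 2
    then have "[c = bar b] (mod s)" using es by algebra
    then show ?thesis using c(3) by blast
  next
    case 3
    then have "[c = bar b] (mod s)" using es by algebra
    then show ?thesis using c(3) by blast
  next
    case 4
    then have "[c = bar c] (mod s * t)" using est by algebra
    then show ?thesis using c(4) by blast
  qed
qed

lemma free_runner_of_diagonal:
  assumes "[b = bar b] (mod s)"
  obtains c where "[c = b] (mod t)" "[c \<noteq> b] (mod s)" "[c \<noteq> bar b] (mod s)" "[c \<noteq> bar c] (mod s * t)"
proof -
  have "s dvd 2 * b + 1" using assms by (simp add: cong_iff_dvd_diff bar_def)
  then have "odd s" by (metis dvd_trans even_add even_mult_iff odd_one dvd_triv_left)
  have "[b + t \<noteq> b] (mod s)" using not_s_dvd_t by (simp add: cong_iff_dvd_diff)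
  moreover have "[b + t \<noteq> bar b] (mod s)"
    using calculation cong_trans[OF _ cong_sym[OF assms]] by blast
  moreover have "[b + t \<noteq> bar (b + t)] (mod s * t)"
  proof
    assume "[b + t = bar (b + t)] (mod s * t)"
    then have "s dvd 2 * t" using assms by algebra
    then show False using not_s_dvd_double_t[OF \<open>odd s\<close>] by blast
  qed
  ultimately show thesis using that[of "b + t"] by (simp add: cong_def)
qed

lemma free_runner_exists:
  assumes "s \<ge> 3" and "[b \<noteq> bar b] (mod t) \<or> [b = bar b] (mod s)"
  obtains c where "[c = b] (mod t)" "[c \<noteq> b] (mod s)" "[c \<noteq> bar b] (mod s)" "[c \<noteq> bar c] (mod s * t)"
proof (cases "[b = bar b] (mod s)")
  case True
  then show thesis using free_runner_of_diagonal that by blast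
next
  case False
  then have off: "[b \<noteq> bar b] (mod t)" using assms(2) by blast
  have free: "[b + t * k \<noteq> bar (b + t * k)] (mod s * t)" for k
  proof
    assume "[b + t * k = bar (b + t * k)] (mod s * t)"
    then have "[b = bar b] (mod t)" by algebra
    then show False using off by blast
  qed
  have shift1: "[b + t \<noteq> b] (mod s)" using not_s_dvd_t by (simp add: cong_iff_dvd_diff)
  have "\<not> s dvd 2" using assms(1) zdvd_imp_le[of s 2] by auto
  then have "\<not> s dvd t * 2" using coprime_st by (simp add: coprime_dvd_mult_right_iff)
  then have shift2: "[b + t * 2 \<noteq> b] (mod s)" by (simp add: cong_iff_dvd_diff)
  show thesis
  proof (cases "[b + t = bar b] (mod s)")
    case False
    then show thesis using that[of "b + t"] free[of 1] shift1 by (simp add: cong_def)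
  next
    case True
    have "[b + t * 2 \<noteq> bar b] (mod s)"
    proof
      assume "[b + t * 2 = bar b] (mod s)"
      then have "s dvd t" using True by algebra
      then show False using not_s_dvd_t by blast
    qed
    then show thesis using that[of "b + t * 2"] free[of 2] shift2 by (simp add: cong_def)
  qed
qed

lemma st_gap_central:
  assumes B: "maya B" "unswitchable s t B" and b: "b \<in> B" "b - s * t * m \<notin> B" "m > 0"
  shows "bar b = b - s * t * m"
proof -
  interpret commuted: coprime_pair t s by (rule commute)
  have "\<not> (s = 2 \<and> t = 2)" "s = 2 \<or> s \<ge> 3" "t = 2 \<or> t \<ge> 3"
    using coprime_st s_gt_1 t_gt_1 by auto
  moreover have "[b \<noteq> bar b] (mod 2)" unfolding cong_def bar_def by presburger
  ultimately consider "s \<ge> 3" "[b \<noteq> bar b] (mod t) \<or> [b = bar b] (mod s)"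
    | "t \<ge> 3" "[b \<noteq> bar b] (mod s) \<or> [b = bar b] (mod t)"
    by blast
  then show ?thesis
  proof cases
    case 1
    then show ?thesis
      using free_runner_exists[OF 1] st_gap_central_if_free_runner[OF B b] by metis
  next
    case 2
    then show ?thesis
      using commuted.free_runner_exists[OF 2] commuted.st_gap_central_if_free_runner[OF B(1), of b m] B(2) b
      by (metis mult.commute unswitchable_commute)
  qed
qed

end


section \<open>The central hooks of an unswitchable solution\<close>

definition central_hook :: "int \<Rightarrow> int set \<Rightarrow> bool" where
  "central_hook m B \<longleftrightarrow> odd m \<and> bar (inner m) \<in> B"

definition remove_central_hook :: "int \<Rightarrow> int set \<Rightarrow> int set" where
  "remove_central_hook m B = (if central_hook m B then flip (bar (inner m)) B else B)"

lemma central_hook_iff: "central_hook m B \<longleftrightarrow> (\<exists>b\<in>B. bar b = b - m)"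
  by (auto simp: central_hook_def bar_eq_diff_iff)

lemma mem_remove_central_hook:
  assumes "self_dual B" "m > 0"
  shows "b \<in> remove_central_hook m B \<longleftrightarrow> bar b = b + m \<or> b \<in> B \<and> bar b \<noteq> b - m"
  using self_dualD[OF assms(1), of "inner m"] assms(2)
  by (auto simp: remove_central_hook_def central_hook_def mem_move bar_eq_add_iff bar_eq_diff_iff)

lemma remove_central_hook:
  assumes "maya B" "self_dual B"
  shows "maya (remove_central_hook m B)" "self_dual (remove_central_hook m B)"
  using assms maya_move[OF assms(1)] self_dual_flip[OF assms(2), of "bar (inner m)"]
  by (simp_all add: remove_central_hook_def central_hook_def)

locale unswitchable_solution = coprime_pair s t for s t :: int +
  fixes B \<alpha> \<beta> :: "int set"
  assumes maya_B: "maya B" and self_dual_B: "self_dual B" and unswitchable_B: "unswitchable s t B"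
    and core_s: "core_of s B \<alpha>" and core_t: "core_of t B \<beta>"
    and \<alpha>_closed: "down_closed t \<alpha>" and \<beta>_closed: "down_closed s \<beta>"
begin

lemma commute_solution: "unswitchable_solution t s B \<beta> \<alpha>"
  using commute maya_B self_dual_B unswitchable_B core_s core_t \<alpha>_closed \<beta>_closed
  by (simp add: unswitchable_solution_def unswitchable_solution_axioms_def unswitchable_commute[of t])

lemma bar_mem_iff: "bar b \<in> B \<longleftrightarrow> b \<notin> B"
  using self_dualD[OF self_dual_B] .

lemma \<alpha>_closed_mult: "k \<ge> 0 \<Longrightarrow> down_closed (t * k) \<alpha>"
  using down_closed_mult[OF \<alpha>_closed] by (auto simp: down_closed_def)

lemma step_down_on_s_runner:
  assumes "b \<notin> B" "b + t * k \<in> B" "k \<ge> 0"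
  obtains c where "[c = b] (mod s)" "c \<in> B" "c + t * k \<notin> B"
  by (rule step_down_exists[OF maya_B core_s \<alpha>_closed_mult[OF assms(3)], of "{b}" b "{}"])
    (use assms in auto)

lemma another_step_down_on_s_runner:
  assumes "b \<notin> B" "b + t * k \<in> B" "b' \<notin> B" "b' + t * k \<in> B" "b \<noteq> b'" "[b' = b] (mod s)" "k \<ge> 0"
  obtains c where "[c = b] (mod s)" "c \<in> B" "c + t * k \<notin> B" "c \<noteq> e"
  by (rule step_down_exists[OF maya_B core_s \<alpha>_closed_mult[OF assms(7)], of "{b, b'}" b "{e}"])
    (use assms in auto)

end

locale unswitchable_solution_no_st = unswitchable_solution +
  assumes no_central_st_hook: "\<not> central_hook (s * t) B"
begin

lemma commute_solution_no_st: "unswitchable_solution_no_st t s B \<beta> \<alpha>"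
  using commute_solution no_central_st_hook
  by (simp add: unswitchable_solution_no_st_def unswitchable_solution_no_st_axioms_def mult.commute)

lemma maya_core_st: "maya_core (s * t) B"
proof -
  have "b - s * t \<in> B" if "b \<in> B" for b
    using st_gap_central[OF maya_B unswitchable_B that, of 1] no_central_st_hook that
    by (auto simp: central_hook_iff)
  then show ?thesis using maya_B st_pos by (simp add: maya_core_def down_closed_def)
qed

lemma no_st_gap:
  assumes "b \<in> B" "c \<notin> B" "c \<le> b" "[b = c] (mod t)"
  shows "[b \<noteq> c] (mod s)"
  using maya_core_le[OF maya_core_st assms(1,3)] cong_st assms(2,4) by blast

lemma bead_near_centre_on_runner:
  assumes "[a = bar a] (mod t)" "bar a < a"
  obtains y l where "odd t" "y \<in> B" "y = bar a + t * l" "l \<ge> 0" "bar y = y + t \<or> bar y = y - t"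
proof -
  obtain i where i: "a = bar (inner t) + t * i" "i \<ge> 0" and "odd t"
    using diagonal_bead_multiple[OF assms t_pos] .
  define c where "c = inner t"
  have c: "bar c = c + t" using bar_inner[OF \<open>odd t\<close>] by (simp add: c_def)
  have "a = c + t + t * i" using i(1) c by (simp add: c_def)
  then have bar_a: "bar a = c - t * i" using c by (simp add: bar_def)
  show thesis
  proof (cases "c \<in> B")
    case True
    moreover have "c = bar a + t * i" using bar_a by simp
    ultimately show thesis using i(2) disjI1[OF c] by (rule that[OF \<open>odd t\<close>])
  next
    case False
    then have "c + t \<in> B" using bar_mem_iff c by metis
    moreover have "c + t = bar a + t * (i + 1)" using bar_a by (simp add: distrib_left)
    moreover have "bar (c + t) = c + t - t" using c by (simp add: bar_def)
    ultimately show thesis using that[of "c + t" "i + 1"] \<open>odd t\<close> i(2) by simp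
  qed
qed

lemma diagonal_bead_central:
  assumes a: "a \<in> B" "[a = bar a] (mod t)" "bar a < a"
  shows "bar a = a - t"
proof (rule ccontr)
  assume not_central: "bar a \<noteq> a - t"
  obtain y l where "odd t" and y: "y \<in> B" "y = bar a + t * l" "l \<ge> 0" and y_centre: "bar y = y + t \<or> bar y = y - t"
    using bead_near_centre_on_runner[OF a(2,3)] .
  have gap: "bar a \<notin> B" using a(1) bar_mem_iff by blast
  have "[y = bar a] (mod t)" by (simp add: y(2) cong_iff_dvd_diff)
  then have off: "[y \<noteq> bar a] (mod s)"
    using no_st_gap[OF y(1) gap] y(2,3) t_pos by simp
  obtain b where b: "[b = bar a] (mod s)" "b \<in> B" "b + t * l \<notin> B"
    using step_down_on_s_runner[OF gap _ y(3)] y(1,2) by metis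
  have sum: "y + b = b + t * l + bar a" using y(2) by simp
  have sy: "[y = b + t * l] (mod s)" using sum b(1) by algebra
  have "rectangle s t y b (b + t * l) (bar a)"
    using sum sy \<open>[y = bar a] (mod t)\<close> by (simp add: rectangle_def)
  then consider "bar y = b + t * l" | "bar y = bar a" | "bar b = b + t * l" | "bar b = bar a"
    using unswitchableD[OF unswitchable_B y(1) b(2,3) gap _ off] by blast
  then show False
  proof cases
    case 1
    then have "[bar y = y] (mod s)" using sy cong_sym by metis
    then have "s dvd t" using y_centre by (auto simp: cong_iff_dvd_diff)
    then show False using not_s_dvd_t by blast
  next
    case 2
    then show False using y_centre not_central a(3) t_pos by auto
  next
    case 3
    then have "[2 * b = 2 * bar a] (mod t)" using a(2) by algebra
    then have "[b = bar a] (mod t)" using \<open>odd t\<close> by (simp add: cong_mult_lcancel)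
    then have "[b = bar a] (mod s * t)" using b(1) by (intro cong_st)
    then have "b < bar a" by (rule maya_core_less[OF maya_core_st b(2) gap])
    moreover have "[y = b + t * l] (mod s * t)"
      using sum \<open>[b = bar a] (mod s * t)\<close> by algebra
    then have "y < b + t * l" by (rule maya_core_less[OF maya_core_st y(1) b(3)])
    ultimately show False using y(2) by simp
  next
    case 4
    then show False using no_st_gap[OF a(1) gap _ a(2)] a(3) b(1) by simp
  qed
qed

lemma inner_bead_if_central_hook_extends:
  assumes c: "bar c = c + t" and outer: "c + t \<in> B" "c \<notin> B" and g: "c + t + s \<in> B"
  shows "c + s \<in> B"
proof (rule ccontr)
  assume inner_gap: "c + s \<notin> B"
  obtain b where b: "[b = c] (mod s)" "b \<in> B" "b + t \<notin> B"
    using step_down_on_s_runner[of c 1] outer by auto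
  have "[b = c + s] (mod s)" using b(1) by algebra
  then have "rectangle s t b (c + t + s) (c + s) (b + t)"
    by (simp add: rectangle_def cong_iff_dvd_diff)
  moreover have "[b \<noteq> b + t] (mod s)" using not_s_dvd_t by (simp add: cong_iff_dvd_diff)
  ultimately consider "bar b = c + s" | "bar b = b + t"
    | "bar (c + t + s) = c + s" | "bar (c + t + s) = b + t"
    using unswitchableD[OF unswitchable_B b(2) g inner_gap b(3)] by blast
  then show False
  proof cases
    case 1
    then have "s dvd t" using b(1) c by algebra
    then show False using not_s_dvd_t by blast
  next
    case 2
    then have "b = c" using c by (simp add: bar_def)
    then show False using b(2) outer(2) by simp
  next
    case 3
    then show False using c s_pos by (simp add: bar_def)
  next
    case 4
    then have "s dvd t" using b(1) c by algebra
    then show False using not_s_dvd_t by blast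
  qed
qed

lemma inner_gap_if_central_hook_extends:
  assumes "odd t" and c: "bar c = c + t" and outer: "c \<notin> B" and g: "c + t + s \<in> B"
  shows "c + s \<notin> B"
proof
  assume inner_bead: "c + s \<in> B"
  interpret commuted: unswitchable_solution t s B \<beta> \<alpha> by (rule commute_solution)
  obtain b where b: "[b = c] (mod t)" "b \<in> B" "b + s \<notin> B"
    using commuted.step_down_on_s_runner[of c 1] outer inner_bead by auto
  have "rectangle t s b (c + s) c (b + s)"
    using b(1) by (simp add: rectangle_def cong_iff_dvd_diff)
  moreover have "[b \<noteq> b + s] (mod t)" using not_t_dvd_s by (simp add: cong_iff_dvd_diff)
  ultimately consider "bar b = c" | "bar b = b + s" | "bar (c + s) = c" | "bar (c + s) = b + s"
    using unswitchableD[OF commuted.unswitchable_B b(2) inner_bead outer b(3)] by blast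
  then show False
  proof cases
    case 1
    then have "b = c + t" using c by (metis bar_bar)
    then show False using b(3) g by simp
  next
    case 2
    then have "t dvd s" using b(1) c by algebra
    then show False using not_t_dvd_s by blast
  next
    case 3
    then have "s = t" using c by (simp add: bar_def)
    then show False using not_s_dvd_t by simp
  next
    case 4
    then have "t dvd 2 * s" using b(1) c by algebra
    then show False
      using coprime_pair.not_s_dvd_double_t[OF commute \<open>odd t\<close>] by blast
  qed
qed

lemma central_hook_not_extendable:
  assumes "central_hook t B"
  shows "bar (inner t) + s \<notin> B"
proof
  have "odd t" and c: "bar (inner t) = inner t + t" and outer: "inner t + t \<in> B" "inner t \<notin> B"
    using assms bar_mem_iff[of "inner t"] by (auto simp: central_hook_def bar_inner)
  assume "bar (inner t) + s \<in> B"
  then have g: "inner t + t + s \<in> B" by (simp add: c)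
  show False
    using inner_bead_if_central_hook_extends[OF c outer g]
      inner_gap_if_central_hook_extends[OF \<open>odd t\<close> c outer(2) g] by blast
qed

lemma diagonal_bead_below:
  assumes "z \<in> B" "[bar z = z] (mod t)" "bar z \<noteq> z - t"
  obtains k where "bar z = z + t * k" "k > 0"
proof -
  have "\<not> bar z < z" using diagonal_bead_central[OF assms(1) cong_sym[OF assms(2)]] assms(3) by blast
  then have "z < bar z" using bar_neq(1)[of z] by linarith
  obtain k where k: "bar z = z + t * k" using assms(2) by (metis cong_iff_lin cong_sym)
  moreover have "k > 0" using k \<open>z < bar z\<close> t_pos by (simp add: zero_less_mult_iff)
  ultimately show thesis by (rule that)
qed

lemma no_diagonal_s_step:
  assumes z: "z \<in> B" "z - s \<notin> B" "bar z - s \<in> B" "[bar z = z] (mod t)"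
  shows "bar z = z - t"
proof (rule ccontr)
  assume "bar z \<noteq> z - t"
  then obtain k where k: "bar z = z + t * k" and "k > 0" by (rule diagonal_bead_below[OF z(1,4)])
  then have "z < bar z" using t_pos by simp
  have "[bar z - s = z - s] (mod t)" using z(4) by algebra
  then have "[bar z - s \<noteq> z - s] (mod s)"
    using no_st_gap[OF z(3,2)] \<open>z < bar z\<close> by simp
  then have off: "[bar z \<noteq> z] (mod s)" by (simp add: cong_iff_dvd_diff)
  have "bar (z + s) = bar z - s" "bar (z - s) = bar z + s" by (simp_all add: bar_def)
  then have mirror: "z + s \<notin> B" "bar z + s \<in> B" using z(2,3) bar_mem_iff by metis+
  obtain y where y: "[y = z - s] (mod s)" "y \<in> B" "y + t * k \<notin> B" "y \<noteq> z"
  proof (rule another_step_down_on_s_runner[of "z - s" k "z + s" z])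
    show "[z + s = z - s] (mod s)" by algebra
  qed (use z mirror k \<open>k > 0\<close> s_pos in \<open>simp_all add: algebra_simps\<close>)
  have "rectangle s t y (bar z - s) (z - s) (y + t * k)"
    using y(1) k by (simp add: rectangle_def cong_iff_dvd_diff)
  moreover have "[y \<noteq> y + t * k] (mod s)" using off by (simp add: k cong_iff_dvd_diff)
  ultimately consider "bar y = z - s" | "bar y = y + t * k"
    | "bar (bar z - s) = z - s" | "bar (bar z - s) = y + t * k"
    using unswitchableD[OF unswitchable_B y(2) z(3,2) y(3)] by blast
  then show False
  proof cases
    case 1
    then have "[bar z = z] (mod s)" using y(1) by algebra
    then show False using off by blast
  next
    case 2
    then have "y = z" using k by (simp add: bar_def)
    then show False using y(4) by blast
  next
    case 3
    then show False using s_pos by (simp add: bar_def)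
  next
    case 4
    then have "z + s - y = t * k" by (simp add: bar_def)
    moreover have "[z + s = y] (mod s)" using y(1) by algebra
    ultimately show False using off by (simp add: k cong_iff_dvd_diff)
  qed
qed

lemma opposite_s_hook_central:
  assumes z: "z \<in> B" "z - s \<notin> B" and far: "\<not> (bar z = z - s \<or> bar z = z - t \<or> bar (z - s) = z - s + t)"
    and b: "[b = z - s] (mod t)" "b \<in> B" "b + s \<notin> B"
  shows "bar b = b + s"
proof -
  interpret commuted: unswitchable_solution t s B \<beta> \<alpha> by (rule commute_solution)
  have "[z = b + s] (mod t)" using b(1) by algebra
  then have "rectangle t s z b (b + s) (z - s)"
    by (simp add: rectangle_def) (simp add: cong_iff_dvd_diff)
  moreover have "[z \<noteq> z - s] (mod t)" using not_t_dvd_s by (simp add: cong_iff_dvd_diff)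
  ultimately consider "bar z = b + s" | "bar b = z - s" | "bar b = b + s"
    using unswitchableD[OF commuted.unswitchable_B z(1) b(2,3) z(2)] far by blast
  then show ?thesis
  proof cases
    case 1
    then have "[bar z = z] (mod t)" using b(1) by algebra
    then show ?thesis using no_diagonal_s_step[OF z] b(2) 1 far by simp
  next
    case 2
    then have b_eq: "b = bar (z - s)" by (metis bar_bar)
    have "b - s = bar z" "bar b - s = bar (b + s)" by (simp_all add: b_eq bar_def)
    moreover have "[bar b = b] (mod t)" unfolding 2 using b(1) by (rule cong_sym)
    ultimately have "bar b = b - t"
      using no_diagonal_s_step[of b] b(2,3) z(1) bar_mem_iff by simp
    then show ?thesis using far 2 by (simp add: b_eq)
  next
    case 3
    then show ?thesis .
  qed
qed

lemma s_hook_near_centre: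
  assumes z: "z \<in> B" "z - s \<notin> B"
  shows "bar z = z - s \<or> bar z = z - t \<or> bar (z - s) = z - s + t"
proof (rule ccontr)
  assume far: "\<not> ?thesis"
  interpret commuted: unswitchable_solution t s B \<beta> \<alpha> by (rule commute_solution)
  note central = opposite_s_hook_central[OF z far]
  obtain b where b: "[b = z - s] (mod t)" "b \<in> B" "b + s \<notin> B"
    using commuted.step_down_on_s_runner[of "z - s" 1] z by auto
  have "bar b = b + s" by (rule central[OF b])
  then have "[bar z = z - s] (mod t)" using b(1) by algebra
  have "bar z + s = bar (z - s)" by (simp add: bar_def)
  then have "bar z \<notin> B" "bar z + s \<in> B" using z bar_mem_iff by metis+
  then obtain b' where b': "[b' = z - s] (mod t)" "b' \<in> B" "b' + s \<notin> B" "b' \<noteq> b"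
    using commuted.another_step_down_on_s_runner[of "z - s" 1 "bar z" b] z far \<open>[bar z = z - s] (mod t)\<close>
    by auto
  have "bar b' = b' + s" by (rule central[OF b'(1-3)])
  then have "b' = b" using \<open>bar b = b + s\<close> by (simp add: bar_def)
  then show False using b'(4) by blast
qed

end

definition sym_core :: "int \<Rightarrow> int \<Rightarrow> int set \<Rightarrow> bool" where
  "sym_core s t C \<longleftrightarrow> self_dual C \<and> maya_core s C \<and> maya_core t C"

lemma sym_core_commute: "sym_core s t C \<longleftrightarrow> sym_core t s C"
  by (auto simp: sym_core_def)

lemma sym_coreD:
  assumes "sym_core s t C"
  shows "self_dual C" "maya_core s C" "maya_core t C" "maya C"
  using assms by (simp_all add: sym_core_def maya_core_def)

context unswitchable_solution_no_st
begin

definition reduced :: "int set" where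
  "reduced = remove_central_hook s (remove_central_hook t B)"

lemma mem_reduced:
  "z \<in> reduced \<longleftrightarrow> bar z = z + s \<or> bar z = z + t \<or> z \<in> B \<and> bar z \<noteq> z - s \<and> bar z \<noteq> z - t"
  unfolding reduced_def
    mem_remove_central_hook[OF remove_central_hook(2)[OF maya_B self_dual_B] s_pos]
    mem_remove_central_hook[OF self_dual_B t_pos]
  using s_pos t_pos by auto

lemma diagonal_bead_central_s:
  assumes "a \<in> B" "[a = bar a] (mod s)" "bar a < a"
  shows "bar a = a - s"
  using unswitchable_solution_no_st.diagonal_bead_central[OF commute_solution_no_st assms] .

lemma reduced_below_inner_s:
  assumes "bar z = z + s"
  shows "z - s \<in> reduced"
proof -
  have bar_z: "bar (z - s) = z - s + 3 * s" using assms by (simp add: bar_def)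
  have "z - s \<in> B"
  proof (rule ccontr)
    assume "z - s \<notin> B"
    then have "bar (z - s) \<in> B" by (simp add: bar_mem_iff)
    moreover have "[bar (z - s) = bar (bar (z - s))] (mod s)"
      unfolding bar_bar by (simp add: bar_z cong_iff_dvd_diff)
    moreover have "bar (bar (z - s)) < bar (z - s)"
      unfolding bar_bar using bar_z s_pos by simp
    ultimately have "bar (bar (z - s)) = bar (z - s) - s" by (rule diagonal_bead_central_s)
    then show False unfolding bar_bar using bar_z s_pos by linarith
  qed
  then show ?thesis using bar_z s_pos t_pos by (simp add: mem_reduced)
qed

lemma reduced_below_inner_t:
  assumes "bar z = z + t"
  shows "z - s \<in> reduced"
proof (cases "z - s \<in> B")
  case True
  have "bar (z - s) = z - s + (2 * s + t)" using assms by (simp add: bar_def)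
  then show ?thesis using True s_pos t_pos by (simp add: mem_reduced)
next
  case False
  have bar_z: "bar (z - s) = bar z + s" by (simp add: bar_def)
  have "z \<notin> B"
    using s_hook_near_centre[OF _ False] assms bar_z s_pos t_pos by auto
  then have "central_hook t B"
    using assms bar_mem_iff[of z] by (auto simp: central_hook_def bar_eq_add_iff)
  then have "bar z + s \<notin> B"
    using central_hook_not_extendable assms by (simp add: bar_eq_add_iff)
  then show ?thesis using False bar_mem_iff[of "z - s"] bar_z by simp
qed

lemma reduced_below_bead:
  assumes z: "z \<in> B" "bar z \<noteq> z - s" "bar z \<noteq> z - t"
  shows "z - s \<in> reduced"
proof (cases "z - s \<in> B")
  case False
  then show ?thesis using s_hook_near_centre[OF z(1) False] z by (simp add: mem_reduced)
next
  case True
  have "bar (z - s) \<noteq> z - s - s"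
  proof
    assume "bar (z - s) = z - s - s"
    then have "bar z = z - 3 * s" by (simp add: bar_def)
    then show False
      using diagonal_bead_central_s[OF z(1)] z(2) s_pos by (simp add: cong_iff_dvd_diff)
  qed
  moreover have "bar (z - s) \<noteq> z - s - t"
  proof
    assume "bar (z - s) = z - s - t"
    then have "odd t" "z - s = bar (inner t)" by (simp_all add: bar_eq_diff_iff)
    then show False
      using central_hook_not_extendable True z(1) by (simp add: central_hook_def algebra_simps)
  qed
  ultimately show ?thesis using True by (simp add: mem_reduced)
qed

lemma reduced_closed_s: "down_closed s reduced"
  unfolding down_closed_def mem_reduced[of z for z]
  using reduced_below_inner_s reduced_below_inner_t reduced_below_bead mem_reduced by blast

lemma sym_core_reduced: "sym_core s t reduced"
proof -
  interpret commuted: unswitchable_solution_no_st t s B \<beta> \<alpha> by (rule commute_solution_no_st)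
  have "commuted.reduced = reduced"
    by (auto simp: mem_reduced commuted.mem_reduced)
  then have "down_closed t reduced" using commuted.reduced_closed_s by simp
  moreover have "maya reduced" "self_dual reduced"
    unfolding reduced_def by (intro remove_central_hook maya_B self_dual_B)+
  ultimately show ?thesis
    using reduced_closed_s s_pos t_pos by (simp add: sym_core_def maya_core_def)
qed

end


section \<open>Flipping the central hooks of a symmetric core\<close>

definition set_harpoon :: "int \<Rightarrow> int \<Rightarrow> int set \<Rightarrow> int set \<Rightarrow> bool" where
  "set_harpoon p q A C \<longleftrightarrow> (\<exists>b \<in> C - A. [bar b - b = q] (mod 2 * p) \<and> A = flip b C)"

definition set_harpoons :: "int \<Rightarrow> int \<Rightarrow> int set \<Rightarrow> int set \<Rightarrow> int \<Rightarrow> int \<Rightarrow> bool" where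
  "set_harpoons s t A C b c \<longleftrightarrow> b \<noteq> c \<and> b \<in> C - A \<and> c \<in> C - A \<and>
     [bar b - b = t] (mod 2 * s) \<and> [bar c - c = - s] (mod 2 * t) \<and> A = flip b (flip c C)"

lemma bar_diff_cong_iff:
  assumes "odd q"
  shows "[bar b - b = q] (mod 2 * p) \<longleftrightarrow> [b = inner q] (mod p)"
proof -
  have "bar b - b - q = 2 * (inner q - b)" using bar_inner[OF assms] by (simp add: bar_def)
  then have "[bar b - b = q] (mod 2 * p) \<longleftrightarrow> p dvd inner q - b"
    unfolding cong_iff_dvd_diff by (simp only: dvd_mult_cancel_left) simp
  then show ?thesis by (simp only: cong_iff_dvd_diff dvd_diff_commute)
qed

lemma bar_diff_cong_minus_iff:
  assumes "odd q"
  shows "[bar c - c = - q] (mod 2 * p) \<longleftrightarrow> [bar c = inner q] (mod p)"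
proof -
  have "[bar c - c = - q] (mod 2 * p) \<longleftrightarrow> [bar (bar c) - bar c = q] (mod 2 * p)"
    using cong_minus_minus_iff[of "bar c - c" "- q"] by simp
  then show ?thesis unfolding bar_diff_cong_iff[OF assms] .
qed

lemma flip_commute:
  assumes "a \<noteq> b" "a \<noteq> bar b"
  shows "flip a (flip b C) = flip b (flip a C)"
proof -
  have "bar a \<noteq> b" using assms(2) by auto
  then show ?thesis using assms by (auto simp: mem_move)
qed

context coprime_pair
begin

lemma inner_distinct:
  assumes "odd s" "odd t"
  shows "inner s \<noteq> inner t" "inner s \<noteq> bar (inner t)" "bar (inner s) \<noteq> inner t"
proof -
  have gap: "s = bar (inner s) - inner s" "t = bar (inner t) - inner t"
    using bar_inner assms by auto
  have "s \<noteq> t" using not_s_dvd_t by auto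
  then show "inner s \<noteq> inner t" using gap by metis
  show outer: "inner s \<noteq> bar (inner t)"
  proof
    assume mirror: "inner s = bar (inner t)"
    then have "bar (inner s) = inner t" by simp
    then show False using mirror gap s_pos t_pos by linarith
  qed
  show "bar (inner s) \<noteq> inner t"
    using outer bar_bar[of "inner s"] by metis
qed

lemma flip_inner:
  assumes C: "sym_core s t C" and "odd t"
  shows "maya (flip (inner t) C)" "self_dual (flip (inner t) C)"
    "energy (flip (inner t) C) = energy C + t" "core_of t (flip (inner t) C) C"
    "core_of s (flip (inner t) C) (flip (runner_top s C (inner t)) C)"
proof -
  note dual = sym_coreD(1)[OF C] and s_core = sym_coreD(2)[OF C] and t_core = sym_coreD(3)[OF C]
    and maya = sym_coreD(4)[OF C]
  note inner = inner_mem_core[OF t_core dual \<open>odd t\<close>]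
  show "maya (flip (inner t) C)" using maya by (rule maya_move)
  show "self_dual (flip (inner t) C)" using dual inner(1) by (rule self_dual_flip)
  show "energy (flip (inner t) C) = energy C + t"
    unfolding energy_move[OF maya inner] by (simp add: bar_inner[OF \<open>odd t\<close>])
  have "[inner t = bar (inner t)] (mod t)" by (simp add: bar_inner[OF \<open>odd t\<close>] cong_iff_dvd_diff)
  moreover have "core_of t C C" using t_core by (simp add: core_of_def)
  ultimately show "core_of t (flip (inner t) C) C"
    using maya inner by (intro core_of_move)
  have "[inner t \<noteq> bar (inner t)] (mod s)"
    using not_s_dvd_t by (simp add: bar_inner[OF \<open>odd t\<close>] cong_iff_dvd_diff)
  moreover have "core_of s C C" using s_core by (simp add: core_of_def)
  ultimately show "core_of s (flip (inner t) C) (flip (runner_top s C (inner t)) C)"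
    using maya dual inner by (intro core_of_flip)
qed

lemma flip_inner_both:
  assumes C: "sym_core s t C" and odd: "odd s" "odd t"
  defines "D \<equiv> flip (inner s) (flip (inner t) C)"
  shows "maya D" "self_dual D" "energy D = energy C + s + t"
    "core_of s D (flip (runner_top s C (inner t)) C)"
    "core_of t D (flip (runner_top t C (inner s)) C)"
proof -
  interpret commuted: coprime_pair t s by (rule commute)
  have C': "sym_core t s C" using C by (simp add: sym_core_commute)
  note one = flip_inner[OF C odd(2)] and other = commuted.flip_inner[OF C' odd(1)]
  have inner_s: "inner s \<in> C" "bar (inner s) \<notin> C"
    by (rule inner_mem_core[OF sym_coreD(2,1)[OF C] odd(1)])+
  have inner_t: "inner t \<in> C" "bar (inner t) \<notin> C"
    by (rule inner_mem_core[OF sym_coreD(3,1)[OF C] odd(2)])+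
  note distinct = inner_distinct[OF odd]
  have s_mem: "inner s \<in> flip (inner t) C" "bar (inner s) \<notin> flip (inner t) C"
    using inner_s distinct by (auto simp: mem_move)
  have t_mem: "inner t \<in> flip (inner s) C" "bar (inner t) \<notin> flip (inner s) C"
    using inner_t distinct by (auto simp: mem_move)
  show "maya D" unfolding D_def using one(1) by (rule maya_move)
  show "self_dual D" unfolding D_def using one(2) s_mem(1) by (rule self_dual_flip)
  show "energy D = energy C + s + t"
    unfolding D_def energy_move[OF one(1) s_mem] by (simp add: one(3) bar_inner[OF odd(1)])
  show "core_of s D (flip (runner_top s C (inner t)) C)"
    unfolding D_def using one(5,1) s_mem
    by (rule core_of_move) (simp add: bar_inner[OF odd(1)] cong_iff_dvd_diff)
  show "core_of t D (flip (runner_top t C (inner s)) C)"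
    unfolding D_def flip_commute[OF distinct(1,2)] using other(5,1) t_mem
    by (rule core_of_move) (simp add: bar_inner[OF odd(2)] cong_iff_dvd_diff)
qed

lemma set_harpoon_iff:
  assumes \<alpha>: "maya_core s \<alpha>" and \<beta>: "sym_core s t \<beta>" and "odd t"
  shows "set_harpoon s t \<alpha> \<beta> \<longleftrightarrow> core_of s (flip (inner t) \<beta>) \<alpha>"
proof
  note \<beta>_dual = sym_coreD(1)[OF \<beta>] and maya = sym_coreD(4)[OF \<beta>]
  note inner = inner_mem_core[OF sym_coreD(3)[OF \<beta>] \<beta>_dual \<open>odd t\<close>]
  assume "set_harpoon s t \<alpha> \<beta>"
  then obtain b where b: "b \<in> \<beta>" "[b = inner t] (mod s)" "\<alpha> = flip b \<beta>"
    by (auto simp: set_harpoon_def bar_diff_cong_iff[OF \<open>odd t\<close>])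
  have "bar b \<notin> \<beta>" using b(1) self_dualD[OF \<beta>_dual] by blast
  then have "same_charge s (flip (inner t) \<beta>) \<alpha>"
    unfolding b(3) using maya inner b(1,2) by (intro same_charge_move_cong) (simp_all add: cong_sym)
  then show "core_of s (flip (inner t) \<beta>) \<alpha>" using \<alpha> by (simp add: core_of_def)
next
  let ?b = "runner_top s \<beta> (inner t)"
  assume "core_of s (flip (inner t) \<beta>) \<alpha>"
  then have "\<alpha> = flip ?b \<beta>" using core_of_unique flip_inner(5)[OF \<beta> \<open>odd t\<close>] by blast
  moreover note runner_top(1,2)[OF sym_coreD(2)[OF \<beta>], of "inner t"]
  moreover have "?b \<notin> flip ?b \<beta>" by (simp add: mem_move)
  ultimately show "set_harpoon s t \<alpha> \<beta>"
    unfolding set_harpoon_def bar_diff_cong_iff[OF \<open>odd t\<close>] by blast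
qed

lemma inner_not_cong:
  assumes "odd s" "odd t"
  shows "[inner t \<noteq> inner s] (mod s)"
proof
  assume "[inner t = inner s] (mod s)"
  then have "s dvd t" using bar_inner[OF assms(1)] bar_inner[OF assms(2)] by algebra
  then show False using not_s_dvd_t by blast
qed

lemma runner_tops_distinct:
  assumes C: "sym_core s t C" and odd: "odd s" "odd t"
    and "unswitchable s t (flip (inner s) (flip (inner t) C))"
  shows "runner_top s C (inner t) \<noteq> runner_top t C (inner s)"
proof
  note s_core = sym_coreD(2)[OF C] and t_core = sym_coreD(3)[OF C] and dual = sym_coreD(1)[OF C]
  note inner_s = inner_mem_core[OF s_core dual odd(1)] and inner_t = inner_mem_core[OF t_core dual odd(2)]
  define b where "b = runner_top s C (inner t)"
  assume "runner_top s C (inner t) = runner_top t C (inner s)"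
  then have b_s: "[b = inner t] (mod s)" and b_t: "[b = inner s] (mod t)" and "b \<in> C"
    using runner_top(1,2)[OF s_core, of "inner t"] runner_top(1)[OF t_core, of "inner s"]
    by (simp_all add: b_def)
  have "inner t \<le> b" "inner s \<le> b"
    using mem_iff_le_runner_top[OF s_core cong_refl, of "inner t"] inner_t(1)
      mem_iff_le_runner_top[OF t_core cong_refl, of "inner s"] inner_s(1)
      \<open>runner_top s C (inner t) = runner_top t C (inner s)\<close> by (simp_all add: b_def)
  have off_s: "[inner t \<noteq> inner s] (mod s)" and off_t: "[inner s \<noteq> inner t] (mod t)"
    using inner_not_cong coprime_pair.inner_not_cong[OF commute] odd by blast+
  have "b \<noteq> inner t" "b \<noteq> inner s" using b_s b_t off_s off_t cong_sym by blast+
  define d where "d = inner t + inner s - b"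
  have d_less: "d < inner s" "d < inner t"
    using \<open>inner t \<le> b\<close> \<open>inner s \<le> b\<close> \<open>b \<noteq> inner t\<close> \<open>b \<noteq> inner s\<close> by (simp_all add: d_def)
  have "[inner s = d] (mod s)" unfolding d_def using b_s by algebra
  then have "d \<in> C" using maya_core_le[OF s_core inner_s(1)] d_less(1) by simp
  let ?B = "flip (inner s) (flip (inner t) C)"
  have "b \<in> ?B" "d \<in> ?B" "inner t \<notin> ?B" "inner s \<notin> ?B"
    using \<open>b \<in> C\<close> \<open>d \<in> C\<close> \<open>b \<noteq> inner t\<close> \<open>b \<noteq> inner s\<close> d_less inner_distinct[OF odd]
    by (auto simp: mem_move)
  moreover have "rectangle s t b d (inner t) (inner s)"
    using b_s b_t by (simp add: rectangle_def d_def)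
  moreover have "[b \<noteq> inner s] (mod s)" using b_s off_s cong_sym cong_trans by blast
  ultimately have "bar b = inner t \<or> bar b = inner s \<or> bar d = inner t \<or> bar d = inner s"
    using unswitchableD[OF assms(4)] by blast
  then have "bar b \<in> C \<or> bar d \<in> C" using inner_s(1) inner_t(1) by metis
  then show False using \<open>b \<in> C\<close> \<open>d \<in> C\<close> self_dualD[OF dual] by blast
qed

lemma set_harpoons_of_runner_tops:
  assumes C: "sym_core s t C" and odd: "odd s" "odd t"
  defines "b \<equiv> runner_top s C (inner t)" and "c \<equiv> runner_top t C (inner s)"
  assumes "b \<noteq> c"
  shows "set_harpoons s t (flip b C) (flip c C) b (bar c)"
proof -
  note dual = self_dualD[OF sym_coreD(1)[OF C]]
  have b: "[b = inner t] (mod s)" "b \<in> C" and c: "[c = inner s] (mod t)" "c \<in> C"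
    unfolding b_def c_def using runner_top[OF sym_coreD(2)[OF C]] runner_top[OF sym_coreD(3)[OF C]] by blast+
  have "bar b \<notin> C" "bar c \<notin> C" "b \<noteq> bar c" using b(2) c(2) dual by metis+
  moreover have "flip (bar c) (flip c C) = C"
    using move_back[OF c(2) \<open>bar c \<notin> C\<close>] by simp
  ultimately show ?thesis
    unfolding set_harpoons_def bar_diff_cong_iff[OF odd(2)] bar_diff_cong_minus_iff[OF odd(1)]
    using b c \<open>b \<noteq> c\<close> by (auto simp: mem_move)
qed

end

context unswitchable_solution_no_st
begin

lemma both_cores_if_no_central_hook:
  assumes "\<not> central_hook s B" "\<not> central_hook t B"
  shows "\<alpha> = B" "\<beta> = B"
proof -
  have "sym_core s t B"
    using sym_core_reduced assms by (simp add: reduced_def remove_central_hook_def)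
  then have "core_of s B B" "core_of t B B" by (simp_all add: sym_core_def core_of_def)
  then show "\<alpha> = B" "\<beta> = B" using core_of_unique core_s core_t by blast+
qed

lemma harpoon_if_central_t_hook:
  assumes "\<not> central_hook s B" "central_hook t B"
  shows "odd t" "set_harpoon s t \<alpha> \<beta>" "energy B = energy \<beta> + t"
proof -
  show "odd t" using assms(2) by (simp add: central_hook_def)
  have outer: "bar (inner t) \<in> B" "inner t \<notin> B"
    using assms(2) bar_mem_iff by (auto simp: central_hook_def)
  have "\<not> central_hook s (remove_central_hook t B)"
    using assms(1) inner_distinct \<open>odd t\<close> by (auto simp: central_hook_def remove_central_hook_def mem_move)
  then have reduced: "reduced = flip (bar (inner t)) B"
    using assms(2) by (simp add: reduced_def remove_central_hook_def)
  then have B: "B = flip (inner t) reduced"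
    using move_back[OF outer] by simp
  have "core_of t B reduced" using flip_inner(4)[OF sym_core_reduced \<open>odd t\<close>] B by simp
  then have \<beta>: "\<beta> = reduced" using core_of_unique core_t by blast
  then show "energy B = energy \<beta> + t" using flip_inner(3)[OF sym_core_reduced \<open>odd t\<close>] B by simp
  show "set_harpoon s t \<alpha> \<beta>"
    using core_s B set_harpoon_iff[of \<alpha> \<beta>] sym_core_reduced \<open>odd t\<close> by (simp add: \<beta> core_of_def)
qed

lemma harpoons_if_central_hooks:
  assumes "central_hook s B" "central_hook t B"
  obtains b c where "odd s" "odd t" "set_harpoons s t \<alpha> \<beta> b c"
    "energy B = energy (flip c \<beta>) + s + t"
proof -
  have odd: "odd s" "odd t" using assms by (simp_all add: central_hook_def)
  have outer: "bar (inner s) \<in> B" "inner s \<notin> B" "bar (inner t) \<in> B" "inner t \<notin> B"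
    using assms bar_mem_iff by (auto simp: central_hook_def)
  note distinct = inner_distinct[OF odd]
  let ?B' = "flip (bar (inner t)) B"
  have s_mem: "bar (inner s) \<in> ?B'" "inner s \<notin> ?B'" using outer distinct by (auto simp: mem_move)
  then have "reduced = flip (bar (inner s)) ?B'"
    using assms odd by (simp add: reduced_def remove_central_hook_def central_hook_def)
  then have "flip (inner s) reduced = ?B'" using move_back[OF s_mem] by simp
  then have "B = flip (inner t) (flip (inner s) reduced)" using move_back[OF outer(3,4)] by simp
  then have B: "B = flip (inner s) (flip (inner t) reduced)" using flip_commute[OF distinct(1,2)] by simp
  let ?b = "runner_top s reduced (inner t)" and ?c = "runner_top t reduced (inner s)"
  note D = flip_inner_both[OF sym_core_reduced odd, folded B]
  have \<alpha>: "\<alpha> = flip ?b reduced" and \<beta>: "\<beta> = flip ?c reduced"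
    using core_of_unique D(4,5) core_s core_t by blast+
  have c: "?c \<in> reduced" "bar ?c \<notin> reduced"
    using runner_top(2)[OF sym_coreD(3)[OF sym_core_reduced]] self_dualD[OF sym_coreD(1)[OF sym_core_reduced]]
    by blast+
  have "?b \<noteq> ?c"
    using runner_tops_distinct[OF sym_core_reduced odd] unswitchable_B by (simp flip: B)
  then have "set_harpoons s t \<alpha> \<beta> ?b (bar ?c)"
    unfolding \<alpha> \<beta> using set_harpoons_of_runner_tops[OF sym_core_reduced odd] by blast
  moreover have "flip (bar ?c) \<beta> = reduced" unfolding \<beta> using move_back[OF c] by simp
  ultimately show thesis using that odd D(3) by metis
qed

end


section \<open>Numerical semigroups and cones\<close>

definition numerical_semigroup :: "int \<Rightarrow> int \<Rightarrow> int set" where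
  "numerical_semigroup s t = {i * s + j * t | i j. i \<ge> 0 \<and> j \<ge> 0}"

definition cone :: "int \<Rightarrow> int \<Rightarrow> int \<Rightarrow> int set" where
  "cone s t h = {b. h - b \<in> numerical_semigroup s t}"

definition kappa_apex :: "int \<Rightarrow> int \<Rightarrow> int" where
  "kappa_apex s t = (s * t - s - t - 1) div 2"

definition kappa_set :: "int \<Rightarrow> int \<Rightarrow> int set" where
  "kappa_set s t = cone s t (kappa_apex s t)"

lemma numerical_semigroupI: "i \<ge> 0 \<Longrightarrow> j \<ge> 0 \<Longrightarrow> x = i * s + j * t \<Longrightarrow> x \<in> numerical_semigroup s t"
  by (auto simp: numerical_semigroup_def)

lemma numerical_semigroupE:
  assumes "x \<in> numerical_semigroup s t"
  obtains i j where "i \<ge> 0" "j \<ge> 0" "x = i * s + j * t"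
  using assms by (auto simp: numerical_semigroup_def)

lemma numerical_semigroup_commute: "numerical_semigroup t s = numerical_semigroup s t"
  unfolding numerical_semigroup_def by (metis add.commute)

lemma zero_in_numerical_semigroup: "0 \<in> numerical_semigroup s t"
  by (rule numerical_semigroupI[of 0 0]) simp_all

lemma numerical_semigroup_add_generator:
  assumes "x \<in> numerical_semigroup s t"
  shows "x + s \<in> numerical_semigroup s t" "x + t \<in> numerical_semigroup s t"
proof -
  obtain i j where x: "i \<ge> 0" "j \<ge> 0" "x = i * s + j * t" using assms by (rule numerical_semigroupE)
  show "x + s \<in> numerical_semigroup s t"
    by (rule numerical_semigroupI[of "i + 1" j]) (use x in \<open>simp_all add: distrib_right\<close>)
  show "x + t \<in> numerical_semigroup s t"
    by (rule numerical_semigroupI[of i "j + 1"]) (use x in \<open>simp_all add: distrib_right\<close>)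
qed

lemma core_diff_numerical_semigroup:
  assumes C: "maya_core s C" "maya_core t C" and "b \<in> C" "x \<in> numerical_semigroup s t"
  shows "b - x \<in> C"
proof -
  obtain i j where x: "i \<ge> 0" "j \<ge> 0" "x = i * s + j * t" using assms(4) by (rule numerical_semigroupE)
  have "b - s * i \<in> C" using maya_coreD(3)[OF C(1)] assms(3) x(1) by (rule down_closed_mult)
  with maya_coreD(3)[OF C(2)] have "b - s * i - t * j \<in> C" using x(2) by (rule down_closed_mult)
  moreover have "b - s * i - t * j = b - x" using x(3) by (simp add: algebra_simps)
  ultimately show ?thesis by simp
qed

lemma maya_greatest:
  assumes "maya C"
  obtains h where "h \<in> C" "\<And>b. b \<in> C \<Longrightarrow> b \<le> h"
proof -
  obtain N where N: "N \<ge> 0" "\<And>b. b < -N \<Longrightarrow> b \<in> C" "\<And>b. b > N \<Longrightarrow> b \<notin> C"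
    using maya_bounds[OF assms] by metis
  let ?X = "C \<inter> {- N - 1..N}"
  have X: "finite ?X" "- N - 1 \<in> ?X" using N by auto
  have "b \<le> Max ?X" if "b \<in> C" for b
  proof (cases "b < - N - 1")
    case True
    then show ?thesis using Max_ge[OF X] by simp
  next
    case False
    then have "b \<in> ?X" using that N(3)[of b] by force
    then show ?thesis using X(1) by simp
  qed
  moreover have "Max ?X \<in> C" using Max_in[OF X(1)] X(2) by blast
  ultimately show thesis using that by blast
qed

context coprime_pair
begin

lemma semigroup_representation:
  obtains i j where "x = i * s + j * t" "0 \<le> j" "j < s"
proof -
  obtain u where u: "[t * u = 1] (mod s)"
    using coprime_st cong_solve_coprime_int[of t s] by (auto simp: ac_simps)
  define j where "j = x * u mod s"
  have "[j = x * u] (mod s)" by (simp add: j_def cong_def)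
  then have "[x = j * t] (mod s)" using u by algebra
  then obtain i where "x = i * s + j * t" by (metis cong_iff_lin cong_sym add.commute mult.commute)
  moreover have "0 \<le> j" "j < s" using s_pos by (simp_all add: j_def)
  ultimately show thesis by (rule that)
qed

lemma mem_semigroup_iff:
  assumes "0 \<le> j" "j < s"
  shows "i * s + j * t \<in> numerical_semigroup s t \<longleftrightarrow> i \<ge> 0"
proof
  assume "i * s + j * t \<in> numerical_semigroup s t"
  then obtain i' j' where ij': "i' \<ge> 0" "j' \<ge> 0" "i * s + j * t = i' * s + j' * t"
    by (rule numerical_semigroupE)
  have diff: "t * (j' - j) = s * (i - i')" using ij'(3) by (simp add: algebra_simps)
  then have "s dvd t * (j' - j)" by simp
  then have "s dvd j' - j" using coprime_st by (simp add: coprime_dvd_mult_right_iff)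
  then have "j = j' mod s" using assms by (metis mod_eq_dvd_iff mod_pos_pos_trivial)
  then have "j \<le> j'" using ij'(2) by (simp add: zmod_le_nonneg_dividend)
  then have "s * (i - i') \<ge> 0" unfolding diff[symmetric] using t_pos by simp
  then show "i \<ge> 0" using s_pos ij'(1) by (simp add: zero_le_mult_iff)
next
  assume "i \<ge> 0"
  then show "i * s + j * t \<in> numerical_semigroup s t"
    using assms(1) by (intro numerical_semigroupI) auto
qed

lemma semigroup_symmetric:
  "s * t - s - t - x \<in> numerical_semigroup s t \<longleftrightarrow> x \<notin> numerical_semigroup s t"
proof -
  obtain i j where ij: "x = i * s + j * t" "0 \<le> j" "j < s" by (rule semigroup_representation)
  have "s * t - s - t - x = (- 1 - i) * s + (s - 1 - j) * t" using ij(1) by (simp add: algebra_simps)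
  moreover have "(- 1 - i) * s + (s - 1 - j) * t \<in> numerical_semigroup s t \<longleftrightarrow> - 1 - i \<ge> 0"
    by (rule mem_semigroup_iff) (use ij in auto)
  moreover have "x \<in> numerical_semigroup s t \<longleftrightarrow> i \<ge> 0"
    unfolding ij(1) by (rule mem_semigroup_iff[OF ij(2,3)])
  ultimately show ?thesis by auto
qed

lemma semigroup_nonneg: "x \<in> numerical_semigroup s t \<Longrightarrow> x \<ge> 0"
  using s_pos t_pos by (auto simp: numerical_semigroup_def)

lemma semigroup_large: "x > s * t - s - t \<Longrightarrow> x \<in> numerical_semigroup s t"
  using semigroup_symmetric[of x] semigroup_nonneg[of "s * t - s - t - x"] by linarith

lemma double_kappa_apex: "2 * kappa_apex s t + 1 = s * t - s - t"
proof -
  have "odd s \<or> odd t" using coprime_st by (meson coprime_common_divisor odd_one)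
  then have "odd (s * t - s - t)" by auto
  then show ?thesis unfolding kappa_apex_def by presburger
qed

lemma maya_core_cone: "maya_core s (cone s t h)" "maya_core t (cone s t h)"
proof -
  define N where "N = \<bar>h\<bar> + \<bar>s * t - s - t\<bar>"
  have "{..<-N} \<subseteq> cone s t h"
    using semigroup_large by (auto simp: cone_def N_def)
  moreover have "cone s t h \<subseteq> {..N}"
    using semigroup_nonneg by (force simp: cone_def N_def)
  ultimately have "maya (cone s t h)"
    unfolding maya_iff_bounded by (intro exI[of _ N]) (simp add: N_def)
  moreover have "h - (b - c) = h - b + c" for b c by simp
  then have "down_closed s (cone s t h)" "down_closed t (cone s t h)"
    unfolding down_closed_def cone_def by (metis mem_Collect_eq numerical_semigroup_add_generator)+
  ultimately show "maya_core s (cone s t h)" "maya_core t (cone s t h)"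
    using s_pos t_pos by (simp_all add: maya_core_def)
qed

lemma sym_core_kappa_set: "sym_core s t (kappa_set s t)"
proof -
  have "kappa_apex s t - bar b = s * t - s - t - (kappa_apex s t - b)" for b
    using double_kappa_apex by (simp add: bar_def)
  then have "self_dual (kappa_set s t)"
    unfolding self_dual_iff kappa_set_def cone_def mem_Collect_eq using semigroup_symmetric by metis
  then show ?thesis using maya_core_cone by (simp add: sym_core_def kappa_set_def)
qed

lemma self_dual_cone:
  assumes "self_dual (cone s t h)"
  shows "cone s t h = kappa_set s t"
proof -
  let ?F = "s * t - s - t"
  note dual = self_dualD[OF assms, unfolded cone_def mem_Collect_eq]
  have "h - bar h \<notin> numerical_semigroup s t"
    using dual[of h] by (simp add: zero_in_numerical_semigroup)
  then have "h - bar h \<le> ?F" using semigroup_large not_less by blast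
  have "?F \<notin> numerical_semigroup s t"
    using semigroup_symmetric[of 0] by (simp add: zero_in_numerical_semigroup)
  moreover have "h - (h - ?F) = ?F" by simp
  ultimately have "h - bar (h - ?F) \<in> numerical_semigroup s t" using dual[of "h - ?F"] by metis
  then have "h - bar (h - ?F) \<ge> 0" by (rule semigroup_nonneg)
  then have "2 * h + 1 = ?F" using \<open>h - bar h \<le> ?F\<close> by (simp add: bar_def)
  then have "h = kappa_apex s t" using double_kappa_apex by simp
  then show ?thesis by (simp add: kappa_set_def)
qed

lemma cone_if_runner_ends_congruent:
  assumes C: "maya_core s C" "maya_core t C"
    and ends: "\<And>x y. x \<in> C \<Longrightarrow> x + t \<notin> C \<Longrightarrow> y \<in> C \<Longrightarrow> y + t \<notin> C \<Longrightarrow> [x = y] (mod s)"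
  obtains h where "C = cone s t h"
proof -
  obtain h where h: "h \<in> C" "\<And>b. b \<in> C \<Longrightarrow> b \<le> h" using maya_greatest[OF maya_coreD(2)[OF C(1)]] by metis
  have "h - b \<in> numerical_semigroup s t" if "b \<in> C" for b
  proof -
    define e where "e = runner_top t C b"
    note e = runner_top[OF C(2), of b, folded e_def]
    have "h + t \<notin> C" using h(2)[of "h + t"] t_pos by auto
    then obtain i where i: "h = e + s * i"
      using ends[OF h(1) _ e(2,3)] by (metis cong_iff_lin cong_sym)
    obtain j where j: "e = b + t * j" using e(1) by (metis cong_iff_lin cong_sym)
    have "b \<le> e" using mem_iff_le_runner_top[OF C(2) cong_refl] that by (simp add: e_def)
    then have "i \<ge> 0" "j \<ge> 0" using h(2)[OF e(2)] i j s_pos t_pos by (simp_all add: zero_le_mult_iff)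
    then show ?thesis using i j by (intro numerical_semigroupI[of i j]) (auto simp: algebra_simps)
  qed
  moreover have "b \<in> C" if "h - b \<in> numerical_semigroup s t" for b
    using core_diff_numerical_semigroup[OF C h(1) that] by simp
  ultimately have "C = cone s t h" by (auto simp: cone_def)
  then show thesis by (rule that)
qed

lemma cone_runner_end:
  assumes "e \<in> cone s t h" "e + s \<notin> cone s t h"
  obtains j where "e = h - j * t" "0 \<le> j" "j < s"
proof -
  obtain i j where ij: "h - e = i * s + j * t" "0 \<le> j" "j < s" by (rule semigroup_representation)
  have "i \<ge> 0"
    using assms(1) ij(1) mem_semigroup_iff[OF ij(2,3)] by (simp add: cone_def)
  moreover have "h - (e + s) = (i - 1) * s + j * t" using ij(1) by (simp add: algebra_simps)
  then have "\<not> i - 1 \<ge> 0"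
    using assms(2) mem_semigroup_iff[OF ij(2,3), of "i - 1"] by (simp add: cone_def)
  ultimately have "i = 0" by simp
  then show thesis using that[of j] ij by simp
qed

end


section \<open>The central hook of length \<open>st\<close>\<close>

locale unswitchable_solution_st = unswitchable_solution +
  assumes central_st_hook: "central_hook (s * t) B"
begin

definition centre :: int where
  "centre = inner (s * t)"

definition reduced :: "int set" where
  "reduced = flip (bar centre) B"

lemma commute_solution_st: "unswitchable_solution_st t s B \<beta> \<alpha>"
  using commute_solution central_st_hook
  by (simp add: unswitchable_solution_st_def unswitchable_solution_st_axioms_def mult.commute)

lemma odd_st: "odd s" "odd t"
  using central_st_hook by (auto simp: central_hook_def)

lemma bar_centre: "bar centre = centre + s * t"
  using odd_st by (simp add: centre_def bar_inner)

lemma bar_centre_cong: "[bar centre = centre] (mod s)" "[bar centre = centre] (mod t)"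
  by (simp_all add: bar_centre cong_iff_dvd_diff)

lemma bar_centre_mem: "bar centre \<in> B" and centre_notin: "centre \<notin> B"
  using central_st_hook bar_mem_iff by (simp_all add: central_hook_def centre_def)

lemma mem_reduced: "b \<in> reduced \<longleftrightarrow> b = centre \<or> b \<in> B \<and> b \<noteq> bar centre"
  by (simp add: reduced_def mem_move)

lemma mem_reduced_off_centre: "[b \<noteq> centre] (mod s) \<or> [b \<noteq> centre] (mod t) \<Longrightarrow> b \<in> reduced \<longleftrightarrow> b \<in> B"
  by (auto simp: mem_reduced bar_centre cong_iff_dvd_diff)

lemma maya_reduced: "maya reduced" and self_dual_reduced: "self_dual reduced"
  unfolding reduced_def using maya_move[OF maya_B] self_dual_flip[OF self_dual_B bar_centre_mem] by simp_all

lemma energy_reduced: "energy reduced = energy B - s * t"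
  unfolding reduced_def bar_bar
  using energy_move[OF maya_B bar_centre_mem centre_notin] bar_centre by simp

lemma core_of_reduced: "core_of s reduced \<alpha>" "core_of t reduced \<beta>"
  unfolding reduced_def bar_bar
  by (rule core_of_move[OF _ maya_B bar_centre_mem], rule core_s core_t,
      simp add: centre_notin, simp add: bar_centre cong_iff_dvd_diff)+

lemma maya_core_reduced: "maya_core (s * t) reduced"
proof -
  have "b - s * t \<in> reduced" if b: "b \<in> reduced" for b
  proof -
    consider "b = centre" | "b \<in> B" "b \<noteq> bar centre" using b by (auto simp: mem_reduced)
    then show ?thesis
    proof cases
      case 1
      have "bar centre - s * t * 2 \<in> B"
      proof (rule ccontr)
        assume "bar centre - s * t * 2 \<notin> B"
        then have "bar (bar centre) = bar centre - s * t * 2"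
          by (intro st_gap_central[OF maya_B unswitchable_B bar_centre_mem]) simp_all
        then show False unfolding bar_bar using bar_centre st_pos by linarith
      qed
      then show ?thesis using 1 bar_centre s_pos t_pos by (simp add: mem_reduced)
    next
      case 2
      have "b - s * t \<in> B"
        using st_gap_central[OF maya_B unswitchable_B 2(1), of 1] 2(2) bar_centre by (auto simp: bar_def)
      moreover have "b - s * t \<noteq> bar centre"
      proof
        assume outside: "b - s * t = bar centre"
        then have "b - s * t * 2 \<notin> B" using bar_centre centre_notin by (simp add: algebra_simps)
        then have "bar b = b - s * t * 2" using st_gap_central[OF maya_B unswitchable_B 2(1), of 2] by simp
        then show False using outside bar_centre st_pos by (simp add: bar_def)
      qed
      ultimately show ?thesis by (simp add: mem_reduced)
    qed
  qed
  then show ?thesis using maya_reduced st_pos by (simp add: maya_core_def down_closed_def)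
qed

abbreviation end_of :: "int \<Rightarrow> int" where
  "end_of \<equiv> runner_top (s * t) reduced"

lemma end_of_cong: "[end_of r = r] (mod s)" "[end_of r = r] (mod t)"
  using runner_top(1)[OF maya_core_reduced, of r] by algebra+

lemma end_of_centre:
  assumes "[r = centre] (mod s)" "[r = centre] (mod t)"
  shows "end_of r = centre"
proof (rule runner_top_eqI[OF maya_core_reduced])
  show "[centre = r] (mod s * t)" using cong_st[OF assms] by (rule cong_sym)
  show "centre \<in> reduced" "centre + s * t \<notin> reduced"
    using s_pos t_pos by (simp_all add: mem_reduced bar_centre)
qed

text \<open>
  With the central \<open>st\<close>-hook present, every rectangle through its ends is unobstructed. This makes the
  ends of the \<open>st\<close>-runners additive in rows and columns, so all \<open>t\<close>-runners are translates of each other.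
\<close>

context
  fixes u v x y
  assumes row: "[u = x] (mod s)" "[v = centre] (mod s)"
    and column: "[u = centre] (mod t)" "[v = x] (mod t)"
    and off_centre: "[x \<noteq> centre] (mod s)" "[x \<noteq> centre] (mod t)"
    and corner: "u + v = y + centre"
begin

lemma corner_cong: "[y = x] (mod s)" "[y = x] (mod t)"
  using corner row column by algebra+

lemma corner_off_centre: "[u \<noteq> centre] (mod s)" "[v \<noteq> centre] (mod t)" "[y \<noteq> centre] (mod s)" "[y \<noteq> centre] (mod t)"
  using row column off_centre corner_cong cong_sym cong_trans by blast+

lemma fourth_corner_bead:
  assumes "u \<in> B" "v \<in> B"
  shows "y \<in> B"
proof (rule ccontr)
  assume "y \<notin> B"
  have "[u = y] (mod s)" using row(1) corner_cong(1) cong_sym cong_trans by blast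
  then have "rectangle s t u v y centre" using corner column(1) by (simp add: rectangle_def)
  then consider "bar u = y" | "bar u = centre" | "bar v = y" | "bar v = centre"
    using unswitchableD[OF unswitchable_B assms \<open>y \<notin> B\<close> centre_notin] corner_off_centre(1) by blast
  then show False
  proof cases
    case 1
    have "[bar u = bar centre] (mod t)" using column(1) by simp
    then show False using 1 corner_off_centre(4) bar_centre_cong(2) cong_trans by metis
  next
    case 2
    then have "u = centre + s * t" using bar_centre by (metis bar_bar)
    then show False using corner_off_centre by (simp add: cong_iff_dvd_diff)
  next
    case 3
    have "[bar v = bar centre] (mod s)" using row(2) by simp
    then show False using 3 corner_off_centre(3) bar_centre_cong(1) cong_trans by metis
  next
    case 4
    then have "v = centre + s * t" using bar_centre by (metis bar_bar)
    then show False using corner_off_centre by (simp add: cong_iff_dvd_diff)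
  qed
qed

lemma fourth_corner_gap:
  assumes "u + s * t \<notin> B" "v + s * t \<notin> B"
  shows "y + s * t \<notin> B"
proof
  assume "y + s * t \<in> B"
  have "[bar centre = v + s * t] (mod s)" "[bar centre = u + s * t] (mod t)"
    unfolding bar_centre using row(2) column(1) by algebra+
  then have "rectangle s t (bar centre) (y + s * t) (v + s * t) (u + s * t)"
    using corner by (simp add: rectangle_def bar_centre)
  moreover have "[bar centre \<noteq> u + s * t] (mod s)"
  proof
    assume "[bar centre = u + s * t] (mod s)"
    then have "[u = centre] (mod s)" unfolding bar_centre by algebra
    then show False using corner_off_centre by blast
  qed
  ultimately consider "centre = v + s * t" | "centre = u + s * t"
    | "bar (y + s * t) = v + s * t" | "bar (y + s * t) = u + s * t"
    using unswitchableD[OF unswitchable_B bar_centre_mem \<open>y + s * t \<in> B\<close> assms(2,1)] by auto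
  then show False
  proof cases
    case 1
    then show False using corner_off_centre by (simp add: cong_iff_dvd_diff)
  next
    case 2
    then show False using corner_off_centre by (simp add: cong_iff_dvd_diff)
  next
    case 3
    then have "[y = centre] (mod s)" using row(2) bar_centre by algebra
    then show False using corner_off_centre by blast
  next
    case 4
    then have "[y = centre] (mod t)" using column(1) bar_centre by algebra
    then show False using corner_off_centre by blast
  qed
qed

end

lemma end_of_add_centre_off_centre:
  assumes p: "[p = x] (mod s)" "[p = centre] (mod t)" and q: "[q = centre] (mod s)" "[q = x] (mod t)"
    and off_centre: "[x \<noteq> centre] (mod s)" "[x \<noteq> centre] (mod t)"
  shows "end_of x + centre = end_of p + end_of q"
proof -
  define u v y where "u = end_of p" and "v = end_of q" and "y = u + v - centre"
  have row: "[u = x] (mod s)" "[v = centre] (mod s)" and column: "[u = centre] (mod t)" "[v = x] (mod t)"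
    unfolding u_def v_def using end_of_cong p q cong_trans by blast+
  have corner: "u + v = y + centre" by (simp add: y_def)
  note y = corner_cong[OF row column off_centre corner]
  note off = corner_off_centre[OF row column off_centre corner]
  have shifted: "[z + s * t = z] (mod s)" "[z + s * t = z] (mod t)" for z
    by (simp_all add: cong_iff_dvd_diff)
  have in_B: "z \<in> B" if "z \<in> reduced" "[z \<noteq> centre] (mod s) \<or> [z \<noteq> centre] (mod t)" for z
    using that mem_reduced_off_centre by blast
  have notin_B: "z + s * t \<notin> B"
    if "z + s * t \<notin> reduced" "[z \<noteq> centre] (mod s) \<or> [z \<noteq> centre] (mod t)" for z
    using that mem_reduced_off_centre shifted cong_sym cong_trans by blast
  note ends = runner_top(2,3)[OF maya_core_reduced]
  have "y \<in> B"
    using fourth_corner_bead[OF row column off_centre corner] in_B ends off by (simp add: u_def v_def)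
  moreover have "y + s * t \<notin> B"
    using fourth_corner_gap[OF row column off_centre corner] notin_B ends off by (simp add: u_def v_def)
  ultimately have "y \<in> reduced" "y + s * t \<notin> reduced"
    using mem_reduced_off_centre off shifted cong_sym cong_trans by blast+
  then have "end_of x = y" using cong_st[OF y] by (intro runner_top_eqI[OF maya_core_reduced])
  then show ?thesis by (simp add: corner[symmetric] u_def v_def)
qed

lemma end_of_add_centre:
  assumes p: "[p = x] (mod s)" "[p = centre] (mod t)" and q: "[q = centre] (mod s)" "[q = x] (mod t)"
  shows "end_of x + centre = end_of p + end_of q"
proof -
  consider "[x = centre] (mod s)" | "[x = centre] (mod t)" | "[x \<noteq> centre] (mod s)" "[x \<noteq> centre] (mod t)"
    by blast
  then show ?thesis
  proof cases
    case 1
    then have "[q = x] (mod s * t)" using q cong_st cong_sym cong_trans by blast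
    then have "end_of q = end_of x" by (rule runner_top_cong[OF maya_core_reduced])
    moreover have "end_of p = centre" using 1 p end_of_centre cong_trans by blast
    ultimately show ?thesis by simp
  next
    case 2
    then have "[p = x] (mod s * t)" using p cong_st cong_sym cong_trans by blast
    then have "end_of p = end_of x" by (rule runner_top_cong[OF maya_core_reduced])
    moreover have "end_of q = centre" using 2 q end_of_centre cong_trans by blast
    ultimately show ?thesis by simp
  next
    case 3
    then show ?thesis by (rule end_of_add_centre_off_centre[OF p q])
  qed
qed

lemma end_of_additive:
  assumes "[a = p] (mod s)" "[d = q] (mod s)" "[a = q] (mod t)" "[d = p] (mod t)"
  shows "end_of a + end_of d = end_of p + end_of q"
proof -
  note crt = binary_chinese_remainder_int[OF coprime_st]
  obtain row_a where row_a: "[row_a = a] (mod s)" "[row_a = centre] (mod t)" using crt by blast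
  obtain row_d where row_d: "[row_d = d] (mod s)" "[row_d = centre] (mod t)" using crt by blast
  obtain col_a where col_a: "[col_a = centre] (mod s)" "[col_a = a] (mod t)" using crt by blast
  obtain col_d where col_d: "[col_d = centre] (mod s)" "[col_d = d] (mod t)" using crt by blast
  have "end_of a + centre = end_of row_a + end_of col_a"
    using row_a col_a by (rule end_of_add_centre)
  moreover have "end_of d + centre = end_of row_d + end_of col_d"
    using row_d col_d by (rule end_of_add_centre)
  moreover have "end_of p + centre = end_of row_a + end_of col_d"
    using row_a col_d assms by (meson cong_trans end_of_add_centre)
  moreover have "end_of q + centre = end_of row_d + end_of col_a"
    using row_d col_a assms by (meson cong_trans end_of_add_centre)
  ultimately show ?thesis by linarith
qed

lemma reduced_meets_rectangle:
  assumes "a \<in> reduced" "d \<in> reduced" "rectangle s t a d p q"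
  shows "p \<in> reduced \<or> q \<in> reduced"
proof (rule ccontr)
  assume outside: "\<not> ?thesis"
  have rect: "a + d = p + q" "[a = p] (mod s)" "[a = q] (mod t)"
    using assms(3) by (simp_all add: rectangle_def)
  have "[d = q] (mod s)" "[d = p] (mod t)" using rect by algebra+
  then have "end_of a + end_of d = end_of p + end_of q" using rect(2,3) by (intro end_of_additive)
  moreover have "b \<in> reduced \<longleftrightarrow> b \<le> end_of b" for b
    using mem_iff_le_runner_top[OF maya_core_reduced cong_refl] .
  then have "a \<le> end_of a" "d \<le> end_of d" "end_of p < p" "end_of q < q"
    using assms(1,2) outside by (simp_all add: not_le)
  ultimately show False using rect(1) by linarith
qed

lemma maya_core_s_reduced: "maya_core s reduced"
proof -
  have "z - s \<in> reduced" if z: "z \<in> reduced" for z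
  proof (rule ccontr)
    assume gap: "z - s \<notin> reduced"
    obtain b where b: "[b = z - s] (mod t)" "b \<in> reduced" "b + s \<notin> reduced"
      by (rule step_down_exists[OF maya_reduced core_of_reduced(2) \<beta>_closed, of "{z - s}" "z - s" "{}"])
        (use z gap in auto)
    have "[z = b + s] (mod t)" using b(1) by algebra
    then have "rectangle s t z b (z - s) (b + s)"
      by (simp add: rectangle_def) (simp add: cong_iff_dvd_diff)
    then show False using reduced_meets_rectangle z b(2,3) gap by blast
  qed
  then show ?thesis using maya_reduced s_pos by (simp add: maya_core_def down_closed_def)
qed

lemma maya_core_t_reduced: "maya_core t reduced"
proof -
  interpret commuted: unswitchable_solution_st t s B \<beta> \<alpha> by (rule commute_solution_st)
  have "commuted.reduced = reduced"
    by (simp add: commuted.reduced_def reduced_def commuted.centre_def centre_def mult.commute)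
  then show ?thesis using commuted.maya_core_s_reduced by simp
qed

lemma runner_ends_congruent:
  assumes x: "x \<in> reduced" "x + t \<notin> reduced" and y: "y \<in> reduced" "y + t \<notin> reduced"
  shows "[x = y] (mod s)"
proof -
  have le: "end_of r \<le> z" if z: "z \<in> reduced" "z + t \<notin> reduced" "[r = z] (mod t)" for r z
    using mem_iff_le_runner_end[OF maya_core_t_reduced z(1,2)] runner_top(2)[OF maya_core_reduced]
      cong_trans[OF end_of_cong(2) z(3)] by blast
  have ends: "end_of z = z" if "z \<in> reduced" "z + t \<notin> reduced" for z
    using le[OF that cong_refl] mem_iff_le_runner_top[OF maya_core_reduced cong_refl] that(1)
    by (simp add: antisym)
  obtain p where p: "[p = x] (mod s)" "[p = y] (mod t)"
    using binary_chinese_remainder_int[OF coprime_st] by blast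
  obtain q where q: "[q = y] (mod s)" "[q = x] (mod t)"
    using binary_chinese_remainder_int[OF coprime_st] by blast
  have "end_of x + end_of y = end_of p + end_of q"
    using p q by (intro end_of_additive) (simp_all add: cong_sym)
  moreover have "end_of p \<le> y" "end_of q \<le> x" using le[OF y p(2)] le[OF x q(2)] by blast+
  ultimately have "end_of p = y" using ends x y by simp
  then show ?thesis using end_of_cong(1)[of p] p(1) cong_sym cong_trans by metis
qed

lemma reduced_eq_kappa_set: "reduced = kappa_set s t"
proof -
  obtain h where "reduced = cone s t h"
    using cone_if_runner_ends_congruent[OF maya_core_s_reduced maya_core_t_reduced] runner_ends_congruent
    by metis
  then show ?thesis using self_dual_cone self_dual_reduced by simp
qed

lemma cores_eq_kappa_set: "\<alpha> = kappa_set s t" "\<beta> = kappa_set s t"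
proof -
  have "core_of s reduced reduced" "core_of t reduced reduced"
    using maya_core_s_reduced maya_core_t_reduced by (simp_all add: core_of_def)
  then show "\<alpha> = kappa_set s t" "\<beta> = kappa_set s t"
    using core_of_unique core_of_reduced reduced_eq_kappa_set by metis+
qed

end


section \<open>Classification when both cores are \<open>(s,t)\<close>-cores\<close>

definition five_cases :: "int \<Rightarrow> int \<Rightarrow> int set \<Rightarrow> int set \<Rightarrow> int \<Rightarrow> bool" where
  "five_cases s t \<alpha> \<beta> n \<longleftrightarrow>
    \<alpha> = \<beta> \<and> n = energy \<alpha> \<or>
    odd t \<and> set_harpoon s t \<alpha> \<beta> \<and> n = energy \<beta> + t \<or>
    odd s \<and> set_harpoon t s \<beta> \<alpha> \<and> n = energy \<alpha> + s \<or>
    odd s \<and> odd t \<and> (\<exists>b c. set_harpoons s t \<alpha> \<beta> b c \<and> n = energy (flip c \<beta>) + s + t) \<or>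
    odd s \<and> odd t \<and> \<alpha> = kappa_set s t \<and> \<beta> = kappa_set s t \<and> n = energy (kappa_set s t) + s * t"

lemma core_diff_notin_numerical_semigroup:
  assumes "maya_core s C" "maya_core t C" "b \<in> C" "c \<notin> C"
  shows "b - c \<notin> numerical_semigroup s t"
  using core_diff_numerical_semigroup[OF assms(1-3), of "b - c"] assms(4) by auto

lemma flip_back:
  assumes "self_dual B" "b \<in> B"
  shows "flip (bar b) (flip b B) = B"
  using move_back[OF assms(2), of "bar b"] assms self_dualD by simp

lemma down_closed_intermediate_flip:
  assumes "self_dual C" "b \<in> C" "c \<in> C" "b \<noteq> c" "b \<noteq> c + m"
    and C: "down_closed m C" and A: "down_closed m (flip b (flip c C))"
  shows "down_closed m (flip c C)"
  unfolding down_closed_def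
proof
  fix y assume y: "y \<in> flip c C"
  have bars: "bar b \<notin> C" "bar c \<notin> C" using assms(1-3) self_dualD by blast+
  have step: "z - m \<in> flip b (flip c C)" if "z \<in> flip b (flip c C)" for z
    using A that by (simp add: down_closed_def)
  consider "y = bar c" | "y \<in> C" "y \<noteq> c" "y - m = c" | "y \<in> C" "y \<noteq> c" "y - m \<noteq> c"
    using y by (auto simp: mem_move)
  then show "y - m \<in> flip c C"
  proof cases
    case 1
    have "bar c \<in> flip b (flip c C)" using bars assms(2) by (auto simp: mem_move)
    then have "bar c - m \<in> flip b (flip c C)" by (rule step)
    moreover have "bar c - m \<noteq> bar b" using assms(5) by (auto simp: bar_def)
    ultimately show ?thesis using 1 by (simp add: mem_move)
  next
    case 2
    have "y \<noteq> b" using 2(3) assms(5) by auto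
    then have "y \<in> flip b (flip c C)" using 2(1,2) by (simp add: mem_move)
    then have "c \<in> flip b (flip c C)" using step 2(3) by blast
    then show ?thesis using bars assms(3) by (auto simp: mem_move)
  next
    case 3
    then show ?thesis using C by (simp add: down_closed_def mem_move)
  qed
qed

context coprime_pair
begin

lemma odd_gap_in_semigroup:
  assumes "odd s" "odd t" "odd x" "[x = t] (mod s)" "[x = - s] (mod t)"
  shows "x \<in> numerical_semigroup s t \<or> - x \<in> numerical_semigroup s t"
proof -
  have "[x = t - s] (mod s)" "[x = t - s] (mod t)" using assms(4,5) by algebra+
  then have "[x = t - s] (mod s * t)" by (rule cong_st)
  then obtain k where k: "x = t - s + s * t * k" by (metis cong_iff_lin cong_sym)
  then have "k \<noteq> 0" using assms(1-3) by auto
  then consider "k \<ge> 1" | "k \<le> - 1" by linarith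
  then show ?thesis
  proof cases
    case 1
    then have "t * k \<ge> 1" using t_pos mult_mono[of 1 t 1 k] by simp
    then have "x \<in> numerical_semigroup s t"
      by (intro numerical_semigroupI[of "t * k - 1" 1]) (simp_all add: k algebra_simps)
    then show ?thesis by blast
  next
    case 2
    then have "s * (- k) \<ge> 1" using s_pos mult_mono[of 1 s 1 "- k"] by simp
    then have "- x \<in> numerical_semigroup s t"
      by (intro numerical_semigroupI[of 1 "s * (- k) - 1"]) (simp_all add: k algebra_simps)
    then show ?thesis by blast
  qed
qed

lemma solution_iff_core_of:
  assumes "sym_core s t \<alpha>" "sym_core s t \<beta>"
  shows "solution s t \<alpha> \<beta> n B \<longleftrightarrow> maya B \<and> self_dual B \<and> core_of s B \<alpha> \<and> core_of t B \<beta> \<and> energy B = n"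
  using assms by (auto simp: solution_def core_of_def sym_core_def)

lemma sym_core_unique_solution:
  assumes \<alpha>: "sym_core s t \<alpha>"
  shows "\<exists>!B. solution s t \<alpha> \<alpha> (energy \<alpha>) B"
proof (rule ex1I)
  show "solution s t \<alpha> \<alpha> (energy \<alpha>) \<alpha>"
    using \<alpha> by (simp add: solution_def sym_core_def maya_core_def)
  show "B = \<alpha>" if "solution s t \<alpha> \<alpha> (energy \<alpha>) B" for B
    using that core_of_eqI[of B s \<alpha>] by (simp add: solution_iff_core_of \<alpha>)
qed

lemma harpoon_unique_solution:
  assumes \<alpha>: "sym_core s t \<alpha>" and \<beta>: "sym_core s t \<beta>" and "odd t" "set_harpoon s t \<alpha> \<beta>"
  shows "\<exists>!B. solution s t \<alpha> \<beta> (energy \<beta> + t) B"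
proof (rule ex1I)
  have "core_of s (flip (inner t) \<beta>) \<alpha>"
    using assms(4) set_harpoon_iff[OF sym_coreD(2)[OF \<alpha>] \<beta> \<open>odd t\<close>] by blast
  then show "solution s t \<alpha> \<beta> (energy \<beta> + t) (flip (inner t) \<beta>)"
    using flip_inner[OF \<beta> \<open>odd t\<close>] by (simp add: solution_iff_core_of \<alpha> \<beta>)
  show "B = flip (inner t) \<beta>" if "solution s t \<alpha> \<beta> (energy \<beta> + t) B" for B
    using that self_dual_weight_one(2)[of B t \<beta>] by (simp add: solution_iff_core_of \<alpha> \<beta>)
qed

end

locale harpoons_pair = coprime_pair s t for s t :: int +
  fixes \<alpha> \<beta> :: "int set" and b c :: int
  assumes core_\<alpha>: "sym_core s t \<alpha>" and core_\<beta>: "sym_core s t \<beta>" and odd_s: "odd s" and odd_t: "odd t"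
    and harpoons: "set_harpoons s t \<alpha> \<beta> b c"
begin

definition middle :: "int set" where
  "middle = flip c \<beta>"

lemma b_c_distinct: "b \<noteq> c" and b_mem: "b \<in> \<beta>" "b \<notin> \<alpha>" and c_mem: "c \<in> \<beta>" "c \<notin> \<alpha>"
  and \<alpha>_eq: "\<alpha> = flip b middle"
  using harpoons by (auto simp: set_harpoons_def middle_def)

lemma b_cong: "[b = inner t] (mod s)" and c_cong: "[bar c = inner s] (mod t)"
  using harpoons bar_diff_cong_iff[OF odd_t] bar_diff_cong_minus_iff[OF odd_s]
  by (auto simp: set_harpoons_def)

lemma bar_b: "bar b \<notin> \<beta>" "bar b \<in> \<alpha>" and bar_c: "bar c \<notin> \<beta>" "bar c \<in> \<alpha>"
  using b_mem c_mem self_dualD sym_coreD(1)[OF core_\<alpha>] sym_coreD(1)[OF core_\<beta>] by blast+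

lemma maya_middle: "maya middle" and self_dual_middle: "self_dual middle"
  unfolding middle_def using sym_coreD[OF core_\<beta>] c_mem by (auto intro: maya_move self_dual_flip)

lemma energy_middle: "energy middle = energy \<beta> + (bar c - c)"
  unfolding middle_def using energy_move[OF sym_coreD(4)[OF core_\<beta>] c_mem(1) bar_c(1)] by simp

lemma middle_mem: "b \<in> middle" "bar b \<notin> middle" "bar c \<in> middle" "c \<notin> middle"
  using b_mem c_mem b_c_distinct bar_b bar_c by (auto simp: middle_def mem_move)

lemma energy_\<alpha>: "energy \<alpha> = energy middle + (bar b - b)"
  unfolding \<alpha>_eq using energy_move[OF maya_middle middle_mem(1,2)] by simp

lemma \<beta>_eq: "\<beta> = flip (bar c) middle"
  unfolding middle_def using flip_back[OF sym_coreD(1)[OF core_\<beta>] c_mem(1)] by simp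

lemma bar_diff_notin_semigroup:
  "bar b - b \<notin> numerical_semigroup s t" "b - bar b \<notin> numerical_semigroup s t"
  "bar c - c \<notin> numerical_semigroup s t" "c - bar c \<notin> numerical_semigroup s t"
  using core_diff_notin_numerical_semigroup sym_coreD(2,3)[OF core_\<alpha>] sym_coreD(2,3)[OF core_\<beta>]
    b_mem c_mem bar_b bar_c by blast+

lemma not_adjacent: "b \<noteq> c + s" "b \<noteq> c + t"
proof -
  note centre = bar_inner[OF odd_s] bar_inner[OF odd_t]
  have odd_diff: "odd (bar x - x)" for x by (simp add: bar_def)
  show "b \<noteq> c + s"
  proof
    assume b: "b = c + s"
    have "[c = inner t] (mod s)" using b_cong unfolding b by algebra
    then have "[bar c - c = t] (mod s)" using centre(2) by algebra
    moreover have "[bar c - c = - s] (mod t)" using c_cong centre(1) by algebra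
    ultimately show False
      using odd_gap_in_semigroup[OF odd_s odd_t odd_diff] bar_diff_notin_semigroup by fastforce
  qed
  show "b \<noteq> c + t"
  proof
    assume b: "b = c + t"
    have "[bar (c + t) = inner s] (mod t)" using c_cong by algebra
    then have "[bar b - b = - s] (mod t)" unfolding b using centre(1) by algebra
    moreover have "[bar b - b = t] (mod s)" using b_cong centre(2) by algebra
    ultimately show False
      using odd_gap_in_semigroup[OF odd_s odd_t odd_diff] bar_diff_notin_semigroup by fastforce
  qed
qed

lemma sym_core_middle: "sym_core s t middle"
proof -
  have "down_closed m middle" if "down_closed m \<alpha>" "down_closed m \<beta>" "b \<noteq> c + m" for m
    unfolding middle_def
    using down_closed_intermediate_flip[OF sym_coreD(1)[OF core_\<beta>] b_mem(1) c_mem(1) b_c_distinct that(3,2)]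
      that(1) by (simp add: \<alpha>_eq middle_def)
  then show ?thesis
    using not_adjacent core_\<alpha> core_\<beta> maya_middle self_dual_middle
    by (simp add: sym_core_def maya_core_def)
qed

definition full :: "int set" where
  "full = flip (inner s) (flip (inner t) middle)"

lemma solution_full: "solution s t \<alpha> \<beta> (energy middle + s + t) full"
proof -
  interpret commuted: coprime_pair t s by (rule commute)
  have middle': "sym_core t s middle" using sym_core_middle by (simp add: sym_core_commute)
  have "set_harpoon s t \<alpha> middle"
    unfolding set_harpoon_def bar_diff_cong_iff[OF odd_t]
    using middle_mem(1) b_mem(2) b_cong \<alpha>_eq by blast
  then have "core_of s (flip (inner t) middle) \<alpha>"
    using set_harpoon_iff[OF sym_coreD(2)[OF core_\<alpha>] sym_core_middle odd_t] by blast
  then have "\<alpha> = flip (runner_top s middle (inner t)) middle"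
    using core_of_unique flip_inner(5)[OF sym_core_middle odd_t] by blast
  moreover have "set_harpoon t s \<beta> middle"
    unfolding set_harpoon_def bar_diff_cong_iff[OF odd_s]
    using middle_mem(3) bar_c(1) c_cong \<beta>_eq by blast
  then have "core_of t (flip (inner s) middle) \<beta>"
    using commuted.set_harpoon_iff[OF sym_coreD(3)[OF core_\<beta>] middle' odd_s] by blast
  then have "\<beta> = flip (runner_top t middle (inner s)) middle"
    using core_of_unique commuted.flip_inner(5)[OF middle' odd_s] by blast
  ultimately show ?thesis
    unfolding full_def solution_iff_core_of[OF core_\<alpha> core_\<beta>]
    using flip_inner_both[OF sym_core_middle odd_s odd_t] by metis
qed

end

locale harpoons_solution = harpoons_pair +
  fixes B :: "int set"
  assumes solution_B: "solution s t \<alpha> \<beta> (energy middle + s + t) B"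
begin

lemma maya_B: "maya B" and self_dual_B: "self_dual B" and core_s: "core_of s B \<alpha>"
  and core_t: "core_of t B \<beta>" and energy_B: "energy B = energy middle + s + t"
  using solution_B by (simp_all add: solution_iff_core_of core_\<alpha> core_\<beta>)

lemma diagonal_hook:
  obtains i where "bar (inner s) + s * i \<in> B" "i \<ge> 0"
proof -
  obtain k where "inner t = b + s * k" using b_cong by (metis cong_iff_lin)
  then have "bar b - b = t + s * (2 * k)" using bar_inner[OF odd_t] by (simp add: bar_def algebra_simps)
  then have "energy B - energy \<alpha> = s * (1 - 2 * k)"
    using energy_B energy_\<alpha> by (simp add: algebra_simps)
  then show thesis
    using odd_weight_diagonal_hook[OF maya_B self_dual_B core_s] that by force
qed

context
  fixes a i
  assumes a: "a = bar (inner s) + s * i" "a \<in> B" and i: "i \<ge> 0"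
begin

lemma bar_a: "bar a = inner s - s * i" "bar a \<notin> B" and a_diff: "a - bar a = s * (2 * i + 1)"
  using a(1) bar_inner[OF odd_s] self_dualD[OF self_dual_B] a(2) by (auto simp: bar_def algebra_simps)

lemma energy_flip_a: "energy (flip a B) = energy \<beta> + (bar c - c) + t - 2 * (s * i)"
  using energy_move[OF maya_B a(2) bar_a(2)] a_diff energy_B energy_middle by (simp add: algebra_simps)

lemma a_off_t_diagonal: "[a \<noteq> bar a] (mod t)"
proof
  assume diag_t: "[a = bar a] (mod t)"
  have diag_s: "[a = bar a] (mod s)" using a_diff by (simp add: cong_iff_dvd_diff)
  then have "s * t dvd a - bar a" using cong_st diag_t by (simp add: cong_iff_dvd_diff)
  moreover have "a - bar a > 0" using a_diff s_pos i by simp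
  ultimately have "s * t \<le> s * (2 * i + 1)" unfolding a_diff by (rule zdvd_imp_le)
  moreover have "bar c - c \<le> s * t - s - t"
    using semigroup_large bar_diff_notin_semigroup(3) not_less by blast
  ultimately have "energy (flip a B) \<le> energy \<beta>" by (simp add: energy_flip_a algebra_simps)
  moreover have "core_of t (flip a B) \<beta>" "core_of s (flip a B) \<alpha>"
    using core_of_move maya_B a(2) bar_a(2) diag_s diag_t core_s core_t by blast+
  ultimately have "core_of s \<beta> \<alpha>" using core_of_eqI maya_move[OF maya_B] by metis
  moreover have "core_of s \<beta> \<beta>" using core_\<beta> by (simp add: sym_core_def core_of_def)
  ultimately have "\<alpha> = \<beta>" by (rule core_of_unique)
  then show False using b_mem by simp
qed

lemma a_innermost: "i = 0"
proof (rule ccontr)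
  assume "i \<noteq> 0"
  define e where "e = runner_top t \<beta> a"
  note e = runner_top[OF sym_coreD(3)[OF core_\<beta>], of a, folded e_def]
  have "bar e \<notin> \<beta>" using e(2) self_dualD[OF sym_coreD(1)[OF core_\<beta>]] by blast
  have "energy (flip e \<beta>) \<le> energy (flip a B)"
    using core_of_flip[OF maya_B core_t sym_coreD(1)[OF core_\<beta>] a(2) bar_a(2) a_off_t_diagonal]
      core_of_energy_le[OF maya_move[OF maya_B]] by (simp add: e_def)
  then have upper: "bar e - e \<le> bar c - c + t - 2 * (s * i)"
    using energy_move[OF sym_coreD(4)[OF core_\<beta>] e(2) \<open>bar e \<notin> \<beta>\<close>] by (simp add: energy_flip_a)
  have "bar c - s * i \<in> middle"
    using down_closed_mult maya_coreD(3) sym_coreD(2)[OF sym_core_middle] middle_mem(3) i by blast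
  then have "bar c - s * i \<in> \<beta>" using \<open>i \<noteq> 0\<close> s_pos by (simp add: middle_def mem_move)
  moreover have "[bar e = bar a] (mod t)" using e(1) by simp
  then have "[bar c - s * i = bar e] (mod t)" unfolding bar_a(1) using c_cong by algebra
  ultimately have "bar c - s * i < bar e" "t dvd bar e - (bar c - s * i)"
    using maya_core_less[OF sym_coreD(3)[OF core_\<beta>] _ \<open>bar e \<notin> \<beta>\<close>]
    by (auto simp: cong_iff_dvd_diff dvd_diff_commute)
  then have "t \<le> bar e - (bar c - s * i)" using zdvd_imp_le by simp
  then show False using upper t_pos by (simp add: bar_def)
qed

lemma B_eq_full: "B = full"
proof -
  have a_eq: "a = bar (inner s)" using a(1) a_innermost by simp
  have "[bar (inner s) = bar (bar c)] (mod t)" unfolding bar_cong_bar using c_cong by (rule cong_sym)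
  then have "[a = c] (mod t)" by (simp add: a_eq)
  then have "same_charge t (flip a B) (flip c \<beta>)"
    using maya_B a(2) bar_a(2) sym_coreD(4)[OF core_\<beta>] c_mem(1) bar_c(1) core_t
    by (intro same_charge_move_cong) (simp_all add: core_of_def)
  then have "core_of t (flip a B) middle"
    using sym_coreD(3)[OF sym_core_middle] by (simp add: core_of_def middle_def)
  moreover have "energy (flip a B) = energy middle + t"
    using a_innermost by (simp add: energy_flip_a energy_middle)
  ultimately have "flip a B = flip (inner t) middle"
    using self_dual_weight_one(2) maya_move[OF maya_B] self_dual_flip[OF self_dual_B a(2)] by blast
  then show ?thesis
    using flip_back[OF self_dual_B a(2)] by (simp add: a_eq full_def)
qed

end

end

context coprime_pair
begin

lemma harpoons_unique_solution:
  assumes "sym_core s t \<alpha>" "sym_core s t \<beta>" "odd s" "odd t" "set_harpoons s t \<alpha> \<beta> b c"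
  shows "\<exists>!B. solution s t \<alpha> \<beta> (energy (flip c \<beta>) + s + t) B"
proof -
  interpret harpoons_pair s t \<alpha> \<beta> b c using assms by unfold_locales
  have "B = full" if sol: "solution s t \<alpha> \<beta> (energy middle + s + t) B" for B
  proof -
    interpret harpoons_solution s t \<alpha> \<beta> b c B using sol by unfold_locales
    show ?thesis using diagonal_hook B_eq_full by blast
  qed
  then show ?thesis using solution_full unfolding middle_def by blast
qed

lemma kappa_runner_end:
  assumes "e \<in> kappa_set s t" "e + s \<notin> kappa_set s t"
  obtains j where "2 * e + 1 = s * t - s - t - 2 * (j * t)" "j \<ge> 0"
proof -
  obtain j where "e = kappa_apex s t - j * t" "j \<ge> 0"
    using assms cone_runner_end unfolding kappa_set_def by metis
  then show thesis using that[of j] double_kappa_apex by simp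
qed

lemma kappa_diagonal_hook:
  assumes odd: "odd s" "odd t" and B: "maya B" "core_of s B (kappa_set s t)" "energy B = energy (kappa_set s t) + s * t"
    and a: "a = bar (inner t) + t * i" "a \<in> B" "bar a \<notin> B" and "i \<ge> 0"
  shows "[a = bar a] (mod s)"
proof (rule ccontr)
  assume off: "[a \<noteq> bar a] (mod s)"
  let ?K = "kappa_set s t"
  note K = sym_coreD[OF sym_core_kappa_set]
  define e where "e = runner_top s ?K a"
  note e = runner_top[OF K(2), of a, folded e_def]
  have "bar e \<notin> ?K" using e(2) self_dualD[OF K(1)] by blast
  have a_double: "2 * a + 1 = t * (2 * i + 1)"
    using a(1) bar_inner[OF odd(2)] by (simp add: bar_def algebra_simps)
  have "energy (flip e ?K) \<le> energy (flip a B)"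
    using core_of_flip[OF B(1,2) K(1) a(2,3) off] core_of_energy_le[OF maya_move[OF B(1)]]
    by (simp add: e_def)
  then have "bar e - e \<le> s * t + (bar a - a)"
    using energy_move[OF K(4) e(2) \<open>bar e \<notin> ?K\<close>] energy_move[OF B(1) a(2,3)] B(3) by simp
  then have upper: "- (2 * e + 1) \<le> s * t - (2 * a + 1)" by (simp add: bar_def)
  obtain j where j: "2 * e + 1 = s * t - s - t - 2 * (j * t)" "j \<ge> 0"
    using kappa_runner_end[OF e(2,3)] .
  have "t * (2 * (j + i + 1)) = 2 * (a - e) + s * (t - 1)"
    using j(1) a_double by (simp add: algebra_simps)
  then have "s dvd t * (2 * (j + i + 1))" using e(1) by algebra
  then have "s dvd 2 * (j + i + 1)" using coprime_st by (simp only: coprime_dvd_mult_right_iff)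
  then have "s dvd j + i + 1" using odd(1) by (metis coprime_dvd_mult_right_iff coprime_right_2_iff_odd)
  then have "s \<le> j + i + 1" using zdvd_imp_le j(2) assms(9) by simp
  then have "t * s \<le> t * (j + i + 1)" using t_pos by simp
  moreover have "2 * (t * (j + i + 1)) + s \<le> 2 * (t * s)"
    using upper j(1) a_double by (simp add: algebra_simps)
  ultimately show False using s_pos by linarith
qed

lemma kappa_set_solution:
  assumes odd: "odd s" "odd t"
  shows "solution s t (kappa_set s t) (kappa_set s t) (energy (kappa_set s t) + s * t)
    (flip (inner (s * t)) (kappa_set s t))"
proof -
  let ?K = "kappa_set s t" and ?c = "inner (s * t)"
  note K = sym_coreD[OF sym_core_kappa_set]
  have odd_st: "odd (s * t)" using odd by simp
  have core_self: "core_of s ?K ?K" "core_of t ?K ?K" using K(2,3) by (simp_all add: core_of_def)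
  have c: "?c \<in> ?K" "bar ?c \<notin> ?K"
    using inner_mem_core[OF maya_core_mult[OF K(2) t_pos] K(1) odd_st] .
  have "[?c = bar ?c] (mod s)" "[?c = bar ?c] (mod t)"
    by (simp_all add: bar_inner[OF odd_st] cong_iff_dvd_diff)
  then show ?thesis
    unfolding solution_iff_core_of[OF sym_core_kappa_set sym_core_kappa_set]
    using maya_move[OF K(4)] self_dual_flip[OF K(1) c(1)] core_of_move[OF _ K(4) c] core_self
      energy_move[OF K(4) c] bar_inner[OF odd_st] by simp
qed

lemma kappa_unique_solution:
  assumes odd: "odd s" "odd t"
  shows "\<exists>!B. solution s t (kappa_set s t) (kappa_set s t) (energy (kappa_set s t) + s * t) B"
proof (rule ex1I)
  let ?K = "kappa_set s t" and ?c = "inner (s * t)"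
  show "solution s t ?K ?K (energy ?K + s * t) (flip ?c ?K)" by (rule kappa_set_solution[OF odd])
  fix B assume "solution s t ?K ?K (energy ?K + s * t) B"
  then have B: "maya B" "self_dual B" "core_of s B ?K" "core_of t B ?K" "energy B = energy ?K + s * t"
    unfolding solution_iff_core_of[OF sym_core_kappa_set sym_core_kappa_set] by simp_all
  have "energy B - energy ?K = t * s" using B(5) by simp
  then obtain i where i: "bar (inner t) + t * i \<in> B" "i \<ge> 0"
    using odd_weight_diagonal_hook[OF B(1,2,4)] odd(1) by metis
  define a where "a = bar (inner t) + t * i"
  have a: "a \<in> B" "bar a \<notin> B" using i(1) self_dualD[OF B(2)] by (auto simp: a_def)
  have diag_s: "[a = bar a] (mod s)" by (rule kappa_diagonal_hook[OF odd B(1,3,5) a_def a i(2)])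
  have diff: "a - bar a = t * (2 * i + 1)"
    using bar_inner[OF odd(2)] by (simp add: a_def bar_def algebra_simps)
  then have diag_t: "[a = bar a] (mod t)" by (simp add: cong_iff_dvd_diff)
  have "s * t dvd a - bar a" using cong_st[OF diag_s diag_t] by (simp add: cong_iff_dvd_diff)
  moreover have "a - bar a > 0" using diff t_pos i(2) by simp
  ultimately have "s * t \<le> a - bar a" by (rule zdvd_imp_le)
  have core: "core_of t (flip a B) ?K" by (rule core_of_move[OF B(4,1) a diag_t])
  have energy: "energy (flip a B) = energy ?K + s * t - (a - bar a)"
    using energy_move[OF B(1) a] B(5) by simp
  have "energy ?K \<le> energy (flip a B)" by (rule core_of_energy_le[OF maya_move[OF B(1)] core])
  then have length: "a - bar a = s * t" using energy \<open>s * t \<le> a - bar a\<close> by simp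
  then have "flip a B = ?K" using core_of_eqI[OF maya_move[OF B(1)] core] energy by simp
  moreover have "bar (bar a) = bar a + s * t" using length by simp
  then have "bar a = ?c" by (simp only: bar_eq_add_iff)
  ultimately show "B = flip ?c ?K" using flip_back[OF B(2) a(1)] by simp
qed

lemma unique_solution_five_cases:
  assumes \<alpha>: "sym_core s t \<alpha>" and \<beta>: "sym_core s t \<beta>" and sol: "solution s t \<alpha> \<beta> n B"
    and uniq: "\<And>C. solution s t \<alpha> \<beta> n C \<Longrightarrow> C = B"
  shows "five_cases s t \<alpha> \<beta> n"
proof -
  have B: "maya B" "self_dual B" "core_of s B \<alpha>" "core_of t B \<beta>" "energy B = n"
    using sol by (simp_all add: solution_iff_core_of \<alpha> \<beta>)
  have "unswitchable s t B" using sol uniq by (rule unique_solution_unswitchable)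
  then interpret unswitchable_solution s t B \<alpha> \<beta>
    using B \<alpha> \<beta> by unfold_locales (simp_all add: sym_core_def maya_core_def)
  show ?thesis
  proof (cases "central_hook (s * t) B")
    case True
    interpret unswitchable_solution_st s t B \<alpha> \<beta> using True by unfold_locales
    show ?thesis
      using odd_st cores_eq_kappa_set energy_reduced B(5)
      by (simp add: five_cases_def reduced_eq_kappa_set)
  next
    case False
    interpret unswitchable_solution_no_st s t B \<alpha> \<beta> using False by unfold_locales
    interpret commuted: unswitchable_solution_no_st t s B \<beta> \<alpha> by (rule commute_solution_no_st)
    consider "\<not> central_hook s B" "\<not> central_hook t B" | "\<not> central_hook s B" "central_hook t B"
      | "central_hook s B" "\<not> central_hook t B" | "central_hook s B" "central_hook t B" by blast
    then show ?thesis
    proof cases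
      case 1
      then show ?thesis using both_cores_if_no_central_hook B(5) by (simp add: five_cases_def)
    next
      case 2
      then show ?thesis using harpoon_if_central_t_hook B(5) by (simp add: five_cases_def)
    next
      case 3
      then show ?thesis using commuted.harpoon_if_central_t_hook B(5) by (simp add: five_cases_def)
    next
      case 4
      then show ?thesis using harpoons_if_central_hooks B(5) unfolding five_cases_def by metis
    qed
  qed
qed

theorem sym_core_classification:
  assumes \<alpha>: "sym_core s t \<alpha>" and \<beta>: "sym_core s t \<beta>"
  shows "(\<exists>!B. solution s t \<alpha> \<beta> n B) \<longleftrightarrow> five_cases s t \<alpha> \<beta> n"
proof
  assume "\<exists>!B. solution s t \<alpha> \<beta> n B"
  then show "five_cases s t \<alpha> \<beta> n" using unique_solution_five_cases[OF \<alpha> \<beta>] by blast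
next
  interpret commuted: coprime_pair t s by (rule commute)
  assume "five_cases s t \<alpha> \<beta> n"
  then consider "\<alpha> = \<beta>" "n = energy \<alpha>" | "odd t" "set_harpoon s t \<alpha> \<beta>" "n = energy \<beta> + t"
    | "odd s" "set_harpoon t s \<beta> \<alpha>" "n = energy \<alpha> + s"
    | b c where "odd s" "odd t" "set_harpoons s t \<alpha> \<beta> b c" "n = energy (flip c \<beta>) + s + t"
    | "odd s" "odd t" "\<alpha> = kappa_set s t" "\<beta> = kappa_set s t" "n = energy (kappa_set s t) + s * t"
    unfolding five_cases_def by blast
  then show "\<exists>!B. solution s t \<alpha> \<beta> n B"
  proof cases
    case 1
    then show ?thesis using sym_core_unique_solution[OF \<alpha>] by simp
  next
    case 2
    then show ?thesis using harpoon_unique_solution[OF \<alpha> \<beta>] by simp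
  next
    case 3
    then show ?thesis
      using commuted.harpoon_unique_solution \<alpha> \<beta> unfolding solution_commute[of s t] sym_core_commute[of s t]
      by blast
  next
    case 4
    then show ?thesis using harpoons_unique_solution[OF \<alpha> \<beta>] by simp
  next
    case 5
    then show ?thesis using kappa_unique_solution by simp
  qed
qed

end


section \<open>Reduction to \<open>(s,t)\<close>-cores\<close>

locale sym_shift =
  fixes s t :: int and \<phi> :: "int \<Rightarrow> int"
  assumes involution [simp]: "\<phi> (\<phi> b) = b" and shift_t: "\<phi> (b + t) = \<phi> b + t"
    and cong_s: "[\<phi> b = b] (mod s)" and shift_bar: "\<phi> (bar b) = bar (\<phi> b)"
    and bounded: "\<exists>M. \<forall>b. \<bar>\<phi> b - b\<bar> \<le> M"
begin

lemma bij: "bij \<phi>"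
  by (rule o_bij[of \<phi>]) auto

lemma mem_image: "b \<in> \<phi> ` B \<longleftrightarrow> \<phi> b \<in> B"
  by (metis image_iff involution)

lemma image_image_id: "\<phi> ` \<phi> ` B = B"
  by (simp add: image_image)

lemma maya_shift: "maya B \<Longrightarrow> maya (\<phi> ` B)"
  using bounded maya_image[OF _ bij] by blast

lemma charge_shift_diff:
  "maya B \<Longrightarrow> maya C \<Longrightarrow> charge w (\<phi> ` B) - charge w (\<phi> ` C) = charge (w \<circ> \<phi>) B - charge (w \<circ> \<phi>) C"
  using bounded charge_image_diff[OF _ _ bij] by blast

lemma sum_image_Diff: "sum w (\<phi> ` B - B) = sum (w \<circ> \<phi>) (B - \<phi> ` B)"
proof -
  have "\<phi> ` B - B = \<phi> ` (B - \<phi> ` B)" by (auto simp: mem_image)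
  then show ?thesis using bij by (simp add: sum.reindex inj_on_subset[OF bij_is_inj])
qed

lemma self_dual_shift: "self_dual B \<Longrightarrow> self_dual (\<phi> ` B)"
  by (simp add: self_dual_iff mem_image shift_bar)

lemma maya_core_shift:
  assumes "maya_core t C"
  shows "maya_core t (\<phi> ` C)"
proof -
  have "\<phi> (b - t) = \<phi> b - t" for b using shift_t[of "b - t"] by simp
  then have "b - t \<in> \<phi> ` C" if "b \<in> \<phi> ` C" for b
    using that maya_coreD(3)[OF assms] by (simp add: mem_image down_closed_def)
  then show ?thesis
    using maya_coreD(1)[OF assms] maya_shift[OF maya_coreD(2)[OF assms]]
    by (simp add: maya_core_def down_closed_def)
qed

lemma same_charge_s_shift:
  assumes "maya B"
  shows "same_charge s (\<phi> ` B) B"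
  unfolding same_charge_def
proof (intro allI impI)
  fix g :: "int \<Rightarrow> int" assume "\<forall>b. g (b + s) = g b"
  then have "g (\<phi> b) = g b" for b using periodic_cong[of g s] cong_s by blast
  then have "g \<circ> \<phi> = g" by (simp add: fun_eq_iff)
  then show "charge g (\<phi> ` B) = charge g B"
    using charge_diff[OF maya_shift[OF assms] assms, of g] by (simp add: sum_image_Diff)
qed

lemma charge_shift_eq:
  assumes "maya B" "maya C" "same_charge t B C" and "\<And>b. w (\<phi> (b + t)) = w (\<phi> b)"
  shows "charge w (\<phi> ` B) = charge w (\<phi> ` C)"
  using charge_shift_diff[OF assms(1,2), of w] same_chargeD[OF assms(3), of "w \<circ> \<phi>"] assms(4) by simp

lemma energy_shift_diff:
  assumes "maya B" "maya C" "same_charge t B C"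
  shows "energy (\<phi> ` B) - energy (\<phi> ` C) = energy B - energy C"
proof -
  have "charge (\<lambda>b. \<phi> b - b) B = charge (\<lambda>b. \<phi> b - b) C"
    by (rule same_chargeD[OF assms(3)]) (simp add: shift_t)
  moreover have "charge \<phi> X = energy X + charge (\<lambda>b. \<phi> b - b) X" for X
    using charge_add[of "\<lambda>b. b" "\<lambda>b. \<phi> b - b" X] by (simp add: energy_def)
  moreover have "energy (\<phi> ` B) - energy (\<phi> ` C) = charge \<phi> B - charge \<phi> C"
    using charge_shift_diff[OF assms(1,2), of "\<lambda>b. b"] by (simp add: energy_def o_def)
  ultimately show ?thesis by simp
qed

lemma solution_shift:
  assumes \<tau>: "maya \<tau>" and sol: "solution s t \<sigma> \<tau> n B"
  shows "solution s t \<sigma> (\<phi> ` \<tau>) (n - energy \<tau> + energy (\<phi> ` \<tau>)) (\<phi> ` B)"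
proof -
  have B: "maya B" "self_dual B" "same_charge s B \<sigma>" "same_charge t B \<tau>" "energy B = n"
    using sol by (auto simp: solution_def)
  have "same_charge t (\<phi> ` B) (\<phi> ` \<tau>)"
    unfolding same_charge_def using charge_shift_eq[OF B(1) \<tau> B(4)] by (simp add: shift_t)
  moreover have "same_charge s (\<phi> ` B) \<sigma>"
    using same_charge_trans[OF same_charge_s_shift[OF B(1)] B(3)] .
  moreover have "energy (\<phi> ` B) = n - energy \<tau> + energy (\<phi> ` \<tau>)"
    using energy_shift_diff[OF B(1) \<tau> B(4)] B(5) by simp
  ultimately show ?thesis
    using B(1,2) maya_shift self_dual_shift by (simp add: solution_def)
qed

lemma unique_solution_shift:
  assumes "maya \<tau>"
  shows "(\<exists>!B. solution s t \<sigma> \<tau> n B) \<longleftrightarrow>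
    (\<exists>!B. solution s t \<sigma> (\<phi> ` \<tau>) (n - energy \<tau> + energy (\<phi> ` \<tau>)) B)"
proof -
  let ?P = "solution s t \<sigma> \<tau> n" and ?Q = "solution s t \<sigma> (\<phi> ` \<tau>) (n - energy \<tau> + energy (\<phi> ` \<tau>))"
  have forward: "?Q (\<phi> ` B)" if "?P B" for B using solution_shift[OF assms that] .
  have backward: "?P (\<phi> ` B)" if "?Q B" for B
    using solution_shift[OF maya_shift[OF assms] that] by (simp add: image_image_id)
  have transfer: "\<exists>!B. R (\<phi> ` B)" if "\<exists>!B. R B" for R
    using that image_image_id by metis
  have "?P B \<longleftrightarrow> ?Q (\<phi> ` B)" for B using forward backward image_image_id by metis
  then have "(\<exists>!B. ?P B) \<longleftrightarrow> (\<exists>!B. ?Q (\<phi> ` B))" by simp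
  also have "\<dots> \<longleftrightarrow> (\<exists>!B. ?Q B)"
    by (rule iffI[OF transfer[of "\<lambda>B. ?Q (\<phi> ` B)", unfolded image_image_id] transfer[of ?Q]])
  finally show ?thesis .
qed

lemma energy_shift_less:
  assumes \<tau>: "maya \<tau>" and lower: "\<And>b. b \<in> \<tau> \<Longrightarrow> \<phi> b \<notin> \<tau> \<Longrightarrow> \<phi> b < b" and y: "y \<in> \<tau>" "\<phi> y \<notin> \<tau>"
  shows "energy (\<phi> ` \<tau>) < energy \<tau>"
proof -
  let ?D = "\<tau> - \<phi> ` \<tau>"
  have "sum \<phi> ?D < sum (\<lambda>b. b) ?D"
  proof (rule sum_strict_mono)
    show "finite ?D" using \<tau> maya_shift by (intro finite_maya_diff)
    show "?D \<noteq> {}" using y by (auto simp: mem_image)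
  qed (use lower in \<open>auto simp: mem_image\<close>)
  then show ?thesis
    using charge_diff[OF maya_shift[OF \<tau>] \<tau>, of "\<lambda>b. b"] sum_image_Diff[of "\<lambda>b. b" \<tau>]
    by (simp add: energy_def o_def)
qed

end

definition swap_classes :: "int \<Rightarrow> (int \<Rightarrow> bool) \<Rightarrow> int \<Rightarrow> int" where
  "swap_classes K P b = (if P b then b - K else if P (b + K) then b + K else b)"

lemma sym_shift_swap_classes:
  assumes K: "K > 0" "[K = 0] (mod s)"
    and periodic: "\<And>b. P (b + t) \<longleftrightarrow> P b" and mirror: "\<And>b. P (bar b) \<longleftrightarrow> P (b + K)"
    and disjoint: "\<And>b. P b \<Longrightarrow> \<not> P (b + K)"
  shows "sym_shift s t (swap_classes K P)"
proof
  let ?\<phi> = "swap_classes K P"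
  show "?\<phi> (?\<phi> b) = b" for b using disjoint[of b] disjoint[of "b - K"] by (auto simp: swap_classes_def)
  have "P (b + t + K) \<longleftrightarrow> P (b + K)" for b using periodic[of "b + K"] by (simp add: ac_simps)
  then show "?\<phi> (b + t) = ?\<phi> b + t" for b by (simp add: swap_classes_def periodic)
  show "[?\<phi> b = b] (mod s)" for b using K(2) by (auto simp: swap_classes_def cong_iff_dvd_diff)
  have "P (bar b + K) \<longleftrightarrow> P b" for b using mirror[of "bar b"] by simp
  then show "?\<phi> (bar b) = bar (?\<phi> b)" for b
    using disjoint[of b] mirror[of b] unfolding swap_classes_def by (simp add: bar_def)
  show "\<exists>M. \<forall>b. \<bar>?\<phi> b - b\<bar> \<le> M" using K(1) by (intro exI[of _ K]) (auto simp: swap_classes_def)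
qed

lemma mirrored_classes:
  assumes mirror: "\<And>r. r \<in> R \<Longrightarrow> \<exists>r'\<in>R. [bar r = r' - K] (mod t)"
  shows "(\<exists>r\<in>R. [bar b = r] (mod t)) \<longleftrightarrow> (\<exists>r\<in>R. [b + K = r] (mod t))"
proof
  assume "\<exists>r\<in>R. [bar b = r] (mod t)"
  then obtain r where r: "r \<in> R" "[bar b = r] (mod t)" by blast
  then obtain r' where r': "r' \<in> R" "[bar r = r' - K] (mod t)" using mirror by blast
  have "[b + K = r'] (mod t)" using r(2) r'(2) by algebra
  then show "\<exists>r\<in>R. [b + K = r] (mod t)" using r'(1) by blast
next
  assume "\<exists>r\<in>R. [b + K = r] (mod t)"
  then obtain r where r: "r \<in> R" "[b + K = r] (mod t)" by blast
  then obtain r' where r': "r' \<in> R" "[bar r = r' - K] (mod t)" using mirror by blast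
  have "[bar b = r'] (mod t)" using r(2) r'(2) by algebra
  then show "\<exists>r\<in>R. [bar b = r] (mod t)" using r'(1) by blast
qed

text \<open>
  The classes of \<open>R\<close> and of \<open>R - K\<close> are interchanged, which lowers the energy because on each class of
  \<open>R\<close> the runner of the core reaches further than on its partner.
\<close>

lemma lowering_class_swap:
  assumes \<tau>: "maya_core t \<tau>" and K: "K > 0" "[K = 0] (mod s)"
    and R: "R \<noteq> {}" "\<And>r. r \<in> R \<Longrightarrow> r \<in> \<tau>" "\<And>r. r \<in> R \<Longrightarrow> r - K \<notin> \<tau>"
    and mirror: "\<And>r. r \<in> R \<Longrightarrow> \<exists>r'\<in>R. [bar r = r' - K] (mod t)"
    and disjoint: "\<And>r r'. r \<in> R \<Longrightarrow> r' \<in> R \<Longrightarrow> [r \<noteq> r' - K] (mod t)"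
  shows "\<exists>\<phi>. sym_shift s t \<phi> \<and> energy (\<phi> ` \<tau>) < energy \<tau>"
proof -
  define P where "P b \<longleftrightarrow> (\<exists>r\<in>R. [b = r] (mod t))" for b
  define \<phi> where "\<phi> = swap_classes K P"
  have mirror_P: "P (bar b) \<longleftrightarrow> P (b + K)" for b
    unfolding P_def using mirror by (rule mirrored_classes)
  have disjoint_P: "\<not> P (b + K)" if "P b" for b
  proof
    assume "P (b + K)"
    with that obtain r r' where r: "r \<in> R" "r' \<in> R" "[b = r] (mod t)" "[b + K = r'] (mod t)"
      by (auto simp: P_def)
    then have "[r = r' - K] (mod t)" by algebra
    then show False using disjoint r(1,2) by blast
  qed
  have "P (b + t) \<longleftrightarrow> P b" for b by (simp add: P_def cong_def)
  then interpret sym_shift s t \<phi>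
    unfolding \<phi>_def using K mirror_P disjoint_P by (intro sym_shift_swap_classes)
  note \<phi>_eq = swap_classes_def[of K P, folded \<phi>_def]
  have "\<phi> b < b" if b: "b \<in> \<tau>" "\<phi> b \<notin> \<tau>" for b
  proof (cases "P b")
    case True
    then show ?thesis using K(1) by (simp add: \<phi>_eq)
  next
    case False
    then have "P (b + K)" "b + K \<notin> \<tau>" using b by (auto simp: \<phi>_eq split: if_splits)
    then obtain r where r: "r \<in> R" "[b + K = r] (mod t)" by (auto simp: P_def)
    then have "r < b + K" using maya_core_less[OF \<tau>] R(2) \<open>b + K \<notin> \<tau>\<close> cong_sym by blast
    moreover have "[b = r - K] (mod t)" using r(2) by algebra
    then have "b < r - K" using maya_core_less[OF \<tau> b(1)] R(3) r(1) by blast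
    ultimately show ?thesis by simp
  qed
  moreover obtain r where r: "r \<in> R" using R(1) by blast
  then have "\<phi> r = r - K" by (auto simp: \<phi>_eq P_def)
  ultimately have "energy (\<phi> ` \<tau>) < energy \<tau>"
    using energy_shift_less[OF maya_coreD(2)[OF \<tau>]] R(2,3) r by metis
  then show ?thesis using sym_shift_axioms by blast
qed

context coprime_pair
begin

lemma lowering_shift_self_dual_class:
  assumes \<tau>: "self_dual \<tau>" "maya_core t \<tau>" and z: "z \<in> \<tau>" "z - s \<notin> \<tau>" "[z = bar z] (mod t)"
  shows "\<exists>\<phi>. sym_shift s t \<phi> \<and> energy (\<phi> ` \<tau>) < energy \<tau>"
proof -
  have "t dvd 2 * z + 1" using z(3) by (simp add: cong_iff_dvd_diff bar_def)
  then have "odd t" by (metis dvd_trans even_add even_mult_iff odd_one dvd_triv_left)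
  define c where "c = inner t"
  have c: "bar c = c + t" using \<open>odd t\<close> by (simp add: c_def bar_inner)
  have c_mem: "c \<in> \<tau>" "c + t \<notin> \<tau>" using inner_mem_core[OF \<tau>(2,1) \<open>odd t\<close>] c by (simp_all add: c_def)
  have "[2 * z = 2 * c] (mod t)" using z(3) c by algebra
  then have zc: "[z = c] (mod t)" using \<open>odd t\<close> by (simp add: cong_mult_lcancel)
  then have "z \<le> c" using mem_iff_le_runner_end[OF \<tau>(2) c_mem] z(1) by blast
  moreover have "[c - s = z - s] (mod t)" using zc by algebra
  ultimately have "c - s \<notin> \<tau>" using maya_core_le[OF \<tau>(2) _ _ , of "c - s" "z - s"] z(2) by auto
  then have "bar (c - s) \<in> \<tau>" by (simp add: self_dualD[OF \<tau>(1)])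
  moreover have "bar (c - s) = c + s + t" using c by (simp add: bar_def)
  ultimately have "c + s \<in> \<tau>"
    using maya_coreD(3)[OF \<tau>(2)] unfolding down_closed_def by force
  show ?thesis
  proof (rule lowering_class_swap[OF \<tau>(2), of "2 * s" s "{c + s}"])
    show "[2 * s = 0] (mod s)" by (simp add: cong_iff_dvd_diff)
    have "bar (c + s) = c + s - 2 * s + t" using c by (simp add: bar_def)
    then show "\<exists>r'\<in>{c + s}. [bar r = r' - 2 * s] (mod t)" if "r \<in> {c + s}" for r
      using that by (simp add: cong_iff_dvd_diff)
    show "[r \<noteq> r' - 2 * s] (mod t)" if "r \<in> {c + s}" "r' \<in> {c + s}" for r r'
      using that coprime_pair.not_s_dvd_double_t[OF commute \<open>odd t\<close>] by (simp add: cong_iff_dvd_diff)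
  qed (use \<open>c + s \<in> \<tau>\<close> \<open>c - s \<notin> \<tau>\<close> s_pos in auto)
qed

lemma lowering_shift_exists:
  assumes \<tau>: "self_dual \<tau>" "maya_core t \<tau>" and "\<not> down_closed s \<tau>"
  shows "\<exists>\<phi>. sym_shift s t \<phi> \<and> energy (\<phi> ` \<tau>) < energy \<tau>"
proof -
  obtain z where z: "z \<in> \<tau>" "z - s \<notin> \<tau>" using assms(3) by (auto simp: down_closed_def)
  have bar_z: "bar z = bar (z - s) - s" by (simp add: bar_def)
  have mirror: "bar (z - s) \<in> \<tau>" "bar (z - s) - s \<notin> \<tau>"
    unfolding bar_z[symmetric] using z self_dualD[OF \<tau>(1)] by simp_all
  consider "[z = bar z] (mod t)" | "[bar (z - s) = z - s] (mod t)"
    | "[z \<noteq> bar z] (mod t)" "[bar (z - s) \<noteq> z - s] (mod t)" by blast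
  then show ?thesis
  proof cases
    case 1
    then show ?thesis by (rule lowering_shift_self_dual_class[OF \<tau> z])
  next
    case 2
    then show ?thesis using lowering_shift_self_dual_class[OF \<tau> mirror] by simp
  next
    case 3
    show ?thesis
    proof (rule lowering_class_swap[OF \<tau>(2), of s s "{z, bar (z - s)}"])
      show "\<exists>r'\<in>{z, bar (z - s)}. [bar r = r' - s] (mod t)" if "r \<in> {z, bar (z - s)}" for r
        using that bar_z by auto
      show "[r \<noteq> r' - s] (mod t)" if "r \<in> {z, bar (z - s)}" "r' \<in> {z, bar (z - s)}" for r r'
        using that 3 not_t_dvd_s by (auto simp: bar_z cong_iff_dvd_diff)
    qed (use z mirror s_pos in \<open>auto simp: cong_def\<close>)
  qed
qed

lemma unique_solution_reduce_core:
  assumes "self_dual \<tau>" "maya_core t \<tau>" "core_of s \<tau> \<beta>"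
  shows "sym_core s t \<beta>"
    and "(\<exists>!B. solution s t \<sigma> \<tau> n B) \<longleftrightarrow> (\<exists>!B. solution s t \<sigma> \<beta> (n - energy \<tau> + energy \<beta>) B)"
proof -
  have reduce: "sym_core s t \<beta> \<and>
      ((\<exists>!B. solution s t \<sigma> \<tau> n B) \<longleftrightarrow> (\<exists>!B. solution s t \<sigma> \<beta> (n - energy \<tau> + energy \<beta>) B))"
    using assms
  proof (induction "nat (energy \<tau>)" arbitrary: \<tau> n rule: less_induct)
    case less
    show ?case
    proof (cases "down_closed s \<tau>")
      case True
      then have "maya_core s \<tau>" using less.prems(2) s_pos by (simp add: maya_core_def)
      moreover from this have "\<beta> = \<tau>"
        using core_of_unique[OF less.prems(3)] by (simp add: core_of_def)
      ultimately show ?thesis using less.prems(1,2) by (simp add: sym_core_def)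
    next
      case False
      then obtain \<phi> where "sym_shift s t \<phi>" and lower: "energy (\<phi> ` \<tau>) < energy \<tau>"
        using lowering_shift_exists less.prems(1,2) by blast
      then interpret sym_shift s t \<phi> by simp
      note maya = maya_coreD(2)[OF less.prems(2)]
      have smaller: "nat (energy (\<phi> ` \<tau>)) < nat (energy \<tau>)"
        using lower energy_nonneg[of "\<phi> ` \<tau>"] by linarith
      have core: "core_of s (\<phi> ` \<tau>) \<beta>"
        using less.prems(3) same_charge_trans[OF same_charge_s_shift[OF maya]] by (simp add: core_of_def)
      note IH = less.hyps[OF smaller self_dual_shift[OF less.prems(1)] maya_core_shift[OF less.prems(2)] core]
      show ?thesis
        unfolding unique_solution_shift[OF maya, of \<sigma> n] conjunct2[OF IH] by (simp add: conjunct1[OF IH])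
    qed
  qed
  show "sym_core s t \<beta>" using reduce by (rule conjunct1)
  show "(\<exists>!B. solution s t \<sigma> \<tau> n B) \<longleftrightarrow> (\<exists>!B. solution s t \<sigma> \<beta> (n - energy \<tau> + energy \<beta>) B)"
    using reduce by (rule conjunct2)
qed

theorem unique_solution_classification:
  assumes \<sigma>: "self_dual \<sigma>" "maya_core s \<sigma>" "core_of t \<sigma> \<alpha>" and \<tau>: "self_dual \<tau>" "maya_core t \<tau>" "core_of s \<tau> \<beta>"
  shows "sym_core s t \<alpha>" "sym_core s t \<beta>"
    and "(\<exists>!B. solution s t \<sigma> \<tau> n B) \<longleftrightarrow>
      five_cases s t \<alpha> \<beta> (n - (energy \<sigma> - energy \<alpha>) - (energy \<tau> - energy \<beta>))"
proof -
  interpret commuted: coprime_pair t s by (rule commute)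
  show \<alpha>: "sym_core s t \<alpha>"
    using commuted.unique_solution_reduce_core(1)[OF \<sigma>] by (simp add: sym_core_commute)
  show \<beta>: "sym_core s t \<beta>" using unique_solution_reduce_core(1)[OF \<tau>] .
  have "(\<exists>!B. solution s t \<sigma> \<tau> n B) \<longleftrightarrow> (\<exists>!B. solution s t \<sigma> \<beta> (n - energy \<tau> + energy \<beta>) B)"
    by (rule unique_solution_reduce_core(2)[OF \<tau>])
  also have "\<dots> \<longleftrightarrow> (\<exists>!B. solution s t \<alpha> \<beta> (n - energy \<tau> + energy \<beta> - energy \<sigma> + energy \<alpha>) B)"
    unfolding solution_commute[of s t] by (rule commuted.unique_solution_reduce_core(2)[OF \<sigma>])
  also have "n - energy \<tau> + energy \<beta> - energy \<sigma> + energy \<alpha> = n - (energy \<sigma> - energy \<alpha>) - (energy \<tau> - energy \<beta>)"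
    by simp
  finally show "(\<exists>!B. solution s t \<sigma> \<tau> n B) \<longleftrightarrow>
      five_cases s t \<alpha> \<beta> (n - (energy \<sigma> - energy \<alpha>) - (energy \<tau> - energy \<beta>))"
    unfolding sym_core_classification[OF \<alpha> \<beta>] .
qed

corollary unique_solution_iff:
  assumes \<sigma>: "maya_core s \<sigma>" "core_of t \<sigma> \<alpha>" and \<tau>: "maya_core t \<tau>" "core_of s \<tau> \<beta>"
  shows "(\<exists>!B. solution s t \<sigma> \<tau> n B) \<longleftrightarrow> self_dual \<sigma> \<and> self_dual \<tau> \<and>
    five_cases s t \<alpha> \<beta> (n - (energy \<sigma> - energy \<alpha>) - (energy \<tau> - energy \<beta>))"
proof (cases "self_dual \<sigma> \<and> self_dual \<tau>")
  case True
  then show ?thesis using unique_solution_classification(3)[OF _ \<sigma> _ \<tau>] by blast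
next
  case False
  have "self_dual \<sigma> \<and> self_dual \<tau>" if "solution s t \<sigma> \<tau> n B" for B
    using that \<sigma>(1) \<tau>(1) core_of_self_dual[of B] by (auto simp: solution_def core_of_def)
  then show ?thesis using False by blast
qed

end


section \<open>The largest \<open>(s,t)\<close>-core\<close>

lemma charge_subtract: "charge (\<lambda>b. v b - w b) B = charge v B - charge w B"
  by (simp add: charge_def sum_subtractf)

lemma maya_negatives: "maya {..<0}" and charge_negatives: "charge w {..<0} = 0"
  by (simp_all add: maya_def charge_def)

lemma charge_one_lessThan: "charge (\<lambda>_. 1) {..<d} = d"
proof -
  have "{..<d} - {..<0} = {0..<d}" "{..<0} - {..<d} = {d..<0}" by auto
  then show ?thesis by (simp add: charge_def)
qed

lemma mem_translate: "b \<in> (\<lambda>b. b + d) ` C \<longleftrightarrow> b - d \<in> C" for b d :: int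
  by (auto intro: image_eqI[of _ _ "b - d"])

lemma charge_translate:
  assumes "maya C"
  shows "charge w ((\<lambda>b. b + d) ` C) = charge (\<lambda>b. w (b + d)) C + charge w {..<d}"
proof -
  have "charge w ((\<lambda>b. b + d) ` C) - charge w ((\<lambda>b. b + d) ` {..<0}) = charge (\<lambda>b. w (b + d)) C"
    using charge_image_diff[OF assms maya_negatives bij_plus_right[of d], of "\<bar>d\<bar>" w]
    by (simp add: charge_negatives o_def)
  moreover have "(\<lambda>b. b + d) ` {..<0} = {..<d}"
    by (rule set_eqI) (simp add: mem_translate)
  ultimately show ?thesis by simp
qed

definition runner_ends :: "int \<Rightarrow> int set \<Rightarrow> int set" where
  "runner_ends m C = {b \<in> C. b + m \<notin> C}"

lemma charge_telescope:
  assumes "maya_core t C"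
  shows "charge (\<lambda>b. G b - G (b - t)) C = sum G (runner_ends t C) - sum G {-t..<0}"
proof -
  note C = maya_coreD[OF assms]
  let ?C' = "(\<lambda>b. b + - t) ` C"
  have mem: "b \<in> ?C' \<longleftrightarrow> b + t \<in> C" for b using mem_translate[of b "- t"] by simp
  have "maya ?C'"
    by (rule maya_image[OF C(2) bij_plus_right, of _ "\<bar>t\<bar>"]) simp
  moreover have "C - ?C' = runner_ends t C"
    unfolding set_eq_iff Diff_iff mem runner_ends_def by simp
  moreover have "b \<in> C" if "b + t \<in> C" for b
    using C(3) that by (force simp: down_closed_def)
  then have "?C' - C = {}" unfolding set_eq_iff Diff_iff mem by simp
  ultimately have "charge G C - charge G ?C' = sum G (runner_ends t C)"
    using charge_diff[OF C(2), of ?C' G] by (simp only: sum.empty diff_zero)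
  moreover have "{..<- t} - {..<0} = {}" "{..<0} - {..<- t} = {-t..<0}" using C(1) by auto
  then have "charge G {..<- t} = - sum G {-t..<0}" by (simp add: charge_def)
  ultimately show ?thesis
    using charge_translate[OF C(2), of G "- t"] by (simp add: charge_subtract)
qed

lemma sum_runner_ends:
  assumes "maya_core t C" "charge (\<lambda>_. 1) C = 0"
  shows "(\<Sum>b\<in>runner_ends t C. b) = (\<Sum>b\<in>{-t..<0}. b)"
  using charge_telescope[OF assms(1), of "\<lambda>b. b"] charge_mult[of t "\<lambda>_. 1" C] assms(2) by simp

lemma energy_runner_ends:
  assumes "maya_core t C" "charge (\<lambda>_. 1) C = 0"
  shows "2 * t * energy C = (\<Sum>b\<in>runner_ends t C. b * b) - (\<Sum>b\<in>{-t..<0}. b * b)"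
proof -
  have "(\<lambda>b. b * b + t * b - ((b - t) * (b - t) + t * (b - t))) = (\<lambda>b. 2 * t * b)"
    by (auto simp: algebra_simps)
  then have "2 * t * energy C = (\<Sum>b\<in>runner_ends t C. b * b + t * b) - (\<Sum>b\<in>{-t..<0}. b * b + t * b)"
    using charge_telescope[OF assms(1), of "\<lambda>b. b * b + t * b"] charge_mult[of "2 * t" "\<lambda>b. b" C]
    by (simp add: energy_def)
  then show ?thesis
    using sum_runner_ends[OF assms] by (simp add: sum.distrib flip: sum_distrib_left)
qed

lemma sum_periodic_shift:
  fixes f :: "int \<Rightarrow> 'a::comm_monoid_add"
  assumes "\<And>j. f (j + t) = f j" "t > 0"
  shows "(\<Sum>j\<in>{0..<t}. f (j + i)) = (\<Sum>j\<in>{0..<t}. f j)"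
proof (rule sum.reindex_bij_witness[of _ "\<lambda>j. (j - i) mod t" "\<lambda>j. (j + i) mod t"])
  show "f ((j + i) mod t) = f (j + i)" for j
    by (rule periodic_cong[of f t]) (simp_all add: assms(1) cong_def)
qed (use assms(2) in \<open>simp_all add: mod_diff_left_eq mod_add_left_eq\<close>)

lemma sum_sum_square_diff:
  fixes T :: "int \<Rightarrow> int"
  assumes "\<And>j. T (j + t) = T j" "t > 0"
  shows "(\<Sum>i\<in>{0..<t}. \<Sum>j\<in>{0..<t}. (T (j + i) - T j)^2)
    = 2 * t * (\<Sum>j\<in>{0..<t}. T j * T j) - 2 * (\<Sum>j\<in>{0..<t}. T j)^2"
proof -
  let ?S = "\<Sum>j\<in>{0..<t}. T j" and ?Q = "\<Sum>j\<in>{0..<t}. T j * T j"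
  have row: "(\<Sum>i\<in>{0..<t}. (T (i + j) - T j)^2) = ?Q - 2 * ?S * T j + t * (T j * T j)" for j
  proof -
    have "(\<Sum>i\<in>{0..<t}. (T (i + j) - T j)^2) = (\<Sum>i\<in>{0..<t}. (T i - T j)^2)"
      using sum_periodic_shift[of "\<lambda>i. (T i - T j)^2" t j] assms by simp
    also have "\<dots> = (\<Sum>i\<in>{0..<t}. T i * T i - 2 * T j * T i + T j * T j)"
      by (rule sum.cong) (auto simp: power2_eq_square algebra_simps)
    also have "\<dots> = ?Q - 2 * T j * ?S + t * (T j * T j)"
      using assms(2) by (simp add: sum.distrib sum_subtractf flip: sum_distrib_left)
    finally show ?thesis by (simp only: ac_simps)
  qed
  have "(\<Sum>i\<in>{0..<t}. \<Sum>j\<in>{0..<t}. (T (j + i) - T j)^2) = (\<Sum>j\<in>{0..<t}. \<Sum>i\<in>{0..<t}. (T (i + j) - T j)^2)"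
    by (subst sum.swap) (simp add: add.commute)
  also have "\<dots> = (\<Sum>j\<in>{0..<t}. ?Q - 2 * ?S * T j + t * (T j * T j))" by (simp only: row)
  also have "\<dots> = t * ?Q - 2 * ?S * ?S + t * ?Q"
    using assms(2) by (simp add: sum.distrib sum_subtractf flip: sum_distrib_left)
  finally show ?thesis by (simp add: power2_eq_square)
qed

lemma cone_commute: "cone t s h = cone s t h"
  by (simp add: cone_def numerical_semigroup_commute)

context coprime_pair
begin

definition row_end :: "int set \<Rightarrow> int \<Rightarrow> int" where
  "row_end C j = runner_top t C (j * s)"

lemma row_end_periodic: "maya_core t C \<Longrightarrow> row_end C (j + t) = row_end C j"
  unfolding row_end_def by (rule runner_top_cong) (simp_all add: cong_iff_dvd_diff distrib_right)

lemma runner_end_is_row_end: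
  assumes "maya_core t C" "b \<in> runner_ends t C"
  obtains j where "b = row_end C j" "j \<in> {0..<t}"
proof -
  obtain i j where ij: "b = i * t + j * s" "0 \<le> j" "j < t"
    using coprime_pair.semigroup_representation[OF commute] .
  have "[b = j * s] (mod t)" by (simp add: ij(1) cong_iff_dvd_diff)
  then have "row_end C j = b"
    unfolding row_end_def using assms by (intro runner_top_eqI) (auto simp: runner_ends_def)
  then show thesis using that[of j] ij(2,3) by simp
qed

lemma sum_row_end:
  assumes "maya_core t C"
  shows "(\<Sum>b\<in>runner_ends t C. G b) = (\<Sum>j\<in>{0..<t}. G (row_end C j))"
proof -
  have "inj_on (row_end C) {0..<t}"
  proof (rule inj_onI)
    fix i j assume ij: "i \<in> {0..<t}" "j \<in> {0..<t}" "row_end C i = row_end C j"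
    have "[i * s = j * s] (mod t)"
      using runner_top(1)[OF assms] ij(3) unfolding row_end_def by (metis cong_sym cong_trans)
    then have "[i = j] (mod t)" using coprime_st by (simp add: cong_mult_rcancel coprime_commute)
    then show "i = j" using ij(1,2) by (simp add: cong_def)
  qed
  moreover have "row_end C j \<in> runner_ends t C" for j
    using runner_top(2,3)[OF assms] by (simp add: row_end_def runner_ends_def)
  then have "row_end C ` {0..<t} = runner_ends t C"
    using runner_end_is_row_end[OF assms] by (metis (no_types, lifting) image_iff subsetI subset_antisym)
  ultimately show ?thesis by (metis (no_types, lifting) sum.reindex_cong)
qed

lemma row_end_step:
  assumes C: "maya_core s C" "maya_core t C" and "i \<ge> 0"
  shows "row_end C (j + i) \<le> row_end C j + i * s"
proof -
  note ends = runner_top[OF C(2), of "(j + i) * s"]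
  have "row_end C (j + i) - s * i \<in> C"
    unfolding row_end_def using down_closed_mult[OF maya_coreD(3)[OF C(1)] ends(2) assms(3)] .
  moreover have "[row_end C (j + i) - s * i = j * s] (mod t)"
    using ends(1) unfolding row_end_def by algebra
  ultimately have "row_end C (j + i) - s * i \<le> row_end C j"
    unfolding row_end_def using mem_iff_le_runner_top[OF C(2)] by blast
  then show ?thesis by (simp add: algebra_simps)
qed

text \<open>
  The differences of row ends lie in \<open>[is - ts, is]\<close>, so each summand is nonnegative; summed over \<open>i\<close>
  it is, for charge zero, a constant minus a multiple of the energy, and it vanishes for \<open>kappa_set\<close>.
\<close>

definition spread :: "int set \<Rightarrow> int \<Rightarrow> int" where
  "spread C i = (\<Sum>j\<in>{0..<t}. (i * s - (row_end C (j + i) - row_end C j)) *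
     (row_end C (j + i) - row_end C j - i * s + t * s))"

lemma spread_summand_nonneg:
  assumes C: "maya_core s C" "maya_core t C" and i: "i \<in> {0..<t}"
  shows "(i * s - (row_end C (j + i) - row_end C j)) *
    (row_end C (j + i) - row_end C j - i * s + t * s) \<ge> 0"
proof (rule mult_nonneg_nonneg)
  show "i * s - (row_end C (j + i) - row_end C j) \<ge> 0"
    using row_end_step[OF C, of i j] i by simp
  have "row_end C (j + i + (t - i)) \<le> row_end C (j + i) + (t - i) * s"
    using i by (intro row_end_step[OF C]) simp
  then show "row_end C (j + i) - row_end C j - i * s + t * s \<ge> 0"
    using row_end_periodic[OF C(2), of j] by (simp add: algebra_simps)
qed

lemma spread_nonneg: "maya_core s C \<Longrightarrow> maya_core t C \<Longrightarrow> i \<in> {0..<t} \<Longrightarrow> spread C i \<ge> 0"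
  unfolding spread_def by (intro sum_nonneg spread_summand_nonneg)

lemma spread_eq:
  assumes "maya_core t C"
  shows "spread C i = t * (i * s * (t * s - i * s)) - (\<Sum>j\<in>{0..<t}. (row_end C (j + i) - row_end C j)^2)"
proof -
  let ?d = "\<lambda>j. row_end C (j + i) - row_end C j"
  have "(\<Sum>j\<in>{0..<t}. ?d j) = 0"
    using sum_periodic_shift[of "row_end C" t i] row_end_periodic[OF assms] t_pos by (simp add: sum_subtractf)
  moreover have "spread C i = (\<Sum>j\<in>{0..<t}. i * s * (t * s - i * s) + (2 * i * s - t * s) * ?d j - (?d j)^2)"
    unfolding spread_def by (rule sum.cong) (auto simp: power2_eq_square algebra_simps)
  ultimately show ?thesis
    using t_pos by (simp add: sum.distrib sum_subtractf flip: sum_distrib_left)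
qed

lemma sum_spread_diff:
  assumes C: "maya_core t C" "charge (\<lambda>_. 1) C = 0" and D: "maya_core t D" "charge (\<lambda>_. 1) D = 0"
  shows "(\<Sum>i\<in>{0..<t}. spread C i) - (\<Sum>i\<in>{0..<t}. spread D i) = 4 * t * t * (energy D - energy C)"
proof -
  let ?ends = "\<Sum>b\<in>{-t..<0}. b" and ?squares = "\<Sum>b\<in>{-t..<0}. b * b"
  have sum: "(\<Sum>i\<in>{0..<t}. spread X i) = (\<Sum>i\<in>{0..<t}. t * (i * s * (t * s - i * s)))
      - 2 * t * (2 * t * energy X + ?squares) + 2 * ?ends^2"
    if X: "maya_core t X" "charge (\<lambda>_. 1) X = 0" for X
  proof -
    have "(\<Sum>j\<in>{0..<t}. row_end X j) = ?ends"
      using sum_row_end[OF X(1), of "\<lambda>b. b"] sum_runner_ends[OF X] by simp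
    moreover have "(\<Sum>j\<in>{0..<t}. row_end X j * row_end X j) = 2 * t * energy X + ?squares"
      using sum_row_end[OF X(1), of "\<lambda>b. b * b"] energy_runner_ends[OF X] by simp
    ultimately show ?thesis
      using sum_sum_square_diff[of "row_end X" t] row_end_periodic[OF X(1)] t_pos
      by (simp add: spread_eq[OF X(1)] sum_subtractf)
  qed
  show ?thesis unfolding sum[OF C] sum[OF D] by (simp add: algebra_simps)
qed

lemma kappa_row_end:
  obtains m where "row_end (kappa_set s t) j = kappa_apex s t - m * s" "0 \<le> m" "m < t"
proof -
  note ends = runner_top[OF sym_coreD(3)[OF sym_core_kappa_set], of "j * s", folded row_end_def]
  show thesis
    using coprime_pair.cone_runner_end[OF commute] ends(2,3) that
    unfolding kappa_set_def cone_commute[of t s] by metis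
qed

lemma kappa_spread:
  assumes "i \<in> {0..<t}"
  shows "spread (kappa_set s t) i = 0"
  unfolding spread_def
proof (rule sum.neutral, rule ballI)
  fix j
  let ?T = "row_end (kappa_set s t)"
  obtain m where m: "?T j = kappa_apex s t - m * s" "0 \<le> m" "m < t" by (rule kappa_row_end)
  obtain m' where m': "?T (j + i) = kappa_apex s t - m' * s" "0 \<le> m'" "m' < t" by (rule kappa_row_end)
  have "[?T r = r * s] (mod t)" for r
    unfolding row_end_def by (rule runner_top(1)[OF sym_coreD(3)[OF sym_core_kappa_set]])
  from this[of j] this[of "j + i"] have "[(m - m') * s = i * s] (mod t)"
    unfolding m(1) m'(1) by algebra
  then have "[m - m' = i] (mod t)"
    using coprime_st by (simp add: cong_mult_rcancel coprime_commute)
  then have "(m - m') mod t = i" using assms by (simp add: cong_def)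
  then have "m - m' = i \<or> m - m' = i - t"
    using m(2,3) m'(2,3) mod_pos_pos_trivial[of "m - m'" t] mod_pos_pos_trivial[of "m - m' + t" t]
    by (cases "m' \<le> m") auto
  moreover have diff: "?T (j + i) - ?T j = (m - m') * s" unfolding m(1) m'(1) by (simp add: left_diff_distrib)
  ultimately show "(i * s - (?T (j + i) - ?T j)) * (?T (j + i) - ?T j - i * s + t * s) = 0"
    unfolding diff by (elim disjE; simp only:; simp add: left_diff_distrib)
qed

lemma sum_spread_eq_energy_deficit:
  assumes "maya_core t C" "charge (\<lambda>_. 1) C = 0"
  shows "(\<Sum>i\<in>{0..<t}. spread C i) = 4 * t * t * (energy (kappa_set s t) - energy C)"
  using sum_spread_diff[OF assms sym_coreD(3)[OF sym_core_kappa_set]]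
    self_dual_charge[OF sym_coreD(1)[OF sym_core_kappa_set]] kappa_spread by simp

theorem energy_le_kappa_set:
  assumes "maya_core s C" "maya_core t C" "charge (\<lambda>_. 1) C = 0"
  shows "energy C \<le> energy (kappa_set s t)"
proof -
  have "(\<Sum>i\<in>{0..<t}. spread C i) \<ge> 0" using spread_nonneg[OF assms(1,2)] by (intro sum_nonneg)
  then have "0 \<le> 4 * t * t * (energy (kappa_set s t) - energy C)"
    using sum_spread_eq_energy_deficit[OF assms(2,3)] by simp
  moreover have "0 < 4 * t * t" using t_pos by simp
  ultimately show ?thesis by (simp only: zero_le_mult_iff) linarith
qed

lemma row_ends_congruent_if_spread_zero:
  assumes C: "maya_core s C" "maya_core t C" and "spread C 1 = 0" and j: "j \<in> {0..<t}"
  shows "[row_end C j = row_end C 0] (mod s)"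
proof -
  have one: "1 \<in> {0..<t}" using t_gt_1 by simp
  have step: "[row_end C (j + 1) = row_end C j] (mod s)" if "j \<in> {0..<t}" for j
  proof -
    have "(1 * s - (row_end C (j + 1) - row_end C j)) *
        (row_end C (j + 1) - row_end C j - 1 * s + t * s) = 0"
      using assms(3) spread_summand_nonneg[OF C one] that
      unfolding spread_def by (subst (asm) sum_nonneg_eq_0_iff) auto
    then have "row_end C (j + 1) - row_end C j = s \<or> row_end C (j + 1) - row_end C j = s * (1 - t)"
      unfolding mult_eq_0_iff by (auto simp: algebra_simps)
    then show ?thesis by (auto simp: cong_iff_dvd_diff)
  qed
  have "[row_end C (int n) = row_end C 0] (mod s)" if "int n < t" for n
    using that
  proof (induction n)
    case (Suc n)
    then show ?case using step[of "int n"] cong_trans by (force simp: add.commute)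
  qed simp
  from this[of "nat j"] j show ?thesis by simp
qed

theorem kappa_set_unique_largest:
  assumes C: "maya_core s C" "maya_core t C" "charge (\<lambda>_. 1) C = 0" and "energy C = energy (kappa_set s t)"
  shows "C = kappa_set s t"
proof -
  let ?K = "kappa_set s t"
  have "1 \<in> {0..<t}" using t_gt_1 by simp
  moreover have "(\<Sum>i\<in>{0..<t}. spread C i) = 0"
    using sum_spread_eq_energy_deficit[OF C(2,3)] assms(4) by simp
  ultimately have "spread C 1 = 0"
    using spread_nonneg[OF C(1,2)] by (subst (asm) sum_nonneg_eq_0_iff) auto
  then have "[x = row_end C 0] (mod s)" if "x \<in> runner_ends t C" for x
    using runner_end_is_row_end[OF C(2) that] row_ends_congruent_if_spread_zero[OF C(1,2)] by metis
  then have "[x = y] (mod s)" if "x \<in> runner_ends t C" "y \<in> runner_ends t C" for x y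
    using that cong_sym cong_trans by blast
  then obtain h where h: "C = cone s t h"
    using cone_if_runner_ends_congruent[OF C(1,2)] by (auto simp: runner_ends_def)
  define d where "d = h - kappa_apex s t"
  have "C = (\<lambda>b. b + d) ` ?K"
    by (rule set_eqI) (simp add: mem_translate h kappa_set_def cone_def d_def)
  then have "charge (\<lambda>_. 1) C = charge (\<lambda>_. 1) ?K + d"
    using charge_translate[OF sym_coreD(4)[OF sym_core_kappa_set], of "\<lambda>_. 1" d]
    by (simp add: charge_one_lessThan)
  then have "d = 0" using C(3) self_dual_charge[OF sym_coreD(1)[OF sym_core_kappa_set]] by simp
  then show ?thesis by (simp add: h kappa_set_def d_def)
qed

end


section \<open>Partitions and beta-sets\<close>

definition bead :: "(nat \<Rightarrow> nat) \<Rightarrow> nat \<Rightarrow> int" where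
  "bead \<nu> r = int (\<nu> r) - (int r + 1)"

lemma beta_set_eq_range: "beta_set \<nu> = range (bead \<nu>)"
  unfolding beta_set_def bead_def by blast

lemma bead_mem: "bead \<nu> r \<in> beta_set \<nu>"
  by (simp add: beta_set_eq_range)

lemma beta_setE:
  assumes "b \<in> beta_set \<nu>"
  obtains r where "b = bead \<nu> r"
  using assms by (auto simp: beta_set_eq_range)

lemma partition_antimono: "is_partition \<nu> \<Longrightarrow> r \<le> q \<Longrightarrow> \<nu> q \<le> \<nu> r"
  by (simp add: is_partition_def antimonoD)

lemma partition_eventually_zero:
  assumes "is_partition \<nu>"
  obtains N where "\<And>r. r \<ge> N \<Longrightarrow> \<nu> r = 0"
proof -
  have "finite {r. \<nu> r \<noteq> 0}" using assms by (simp add: is_partition_def)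
  then obtain N where "\<forall>r\<in>{r. \<nu> r \<noteq> 0}. r < N" using finite_nat_set_iff_bounded by blast
  then show thesis using that[of N] by force
qed

lemma partition_if_le:
  assumes "is_partition \<nu>" "antimono \<mu>" "\<And>r. \<mu> r \<le> \<nu> r"
  shows "is_partition \<mu>"
proof -
  have "{r. \<mu> r \<noteq> 0} \<subseteq> {r. \<nu> r \<noteq> 0}" using assms(3) by (metis (mono_tags, lifting) Collect_mono le_zero_eq)
  then show ?thesis using assms(1,2) by (auto simp: is_partition_def intro: finite_subset)
qed

lemma bead_less: "is_partition \<nu> \<Longrightarrow> r < q \<Longrightarrow> bead \<nu> q < bead \<nu> r"
  using partition_antimono[of \<nu> r q] by (simp add: bead_def)

lemma bead_less_iff: "is_partition \<nu> \<Longrightarrow> bead \<nu> q < bead \<nu> r \<longleftrightarrow> r < q"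
  using bead_less[of \<nu> r q] bead_less[of \<nu> q r] by (metis less_asym less_irrefl linorder_neqE_nat)

lemma bead_inject: "is_partition \<nu> \<Longrightarrow> bead \<nu> r = bead \<nu> q \<longleftrightarrow> r = q"
  using bead_less_iff[of \<nu>] by (metis less_irrefl linorder_neqE_nat)

lemma mem_beta_set_iff:
  assumes "\<And>r. r \<ge> N \<Longrightarrow> \<nu> r = 0"
  shows "b \<in> beta_set \<nu> \<longleftrightarrow> b \<in> bead \<nu> ` {..<N} \<or> b < - int N"
proof
  assume "b \<in> beta_set \<nu>"
  then obtain r where "b = bead \<nu> r" by (rule beta_setE)
  then show "b \<in> bead \<nu> ` {..<N} \<or> b < - int N"
    using assms[of r] by (cases "r < N") (auto simp: bead_def)
next
  assume "b \<in> bead \<nu> ` {..<N} \<or> b < - int N"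
  then show "b \<in> beta_set \<nu>"
  proof
    assume "b < - int N"
    then have "b = bead \<nu> (nat (- b - 1))" using assms[of "nat (- b - 1)"] by (simp add: bead_def)
    then show ?thesis using bead_mem by metis
  qed (auto simp: bead_mem)
qed

lemma charge_beta_set_eq_sum:
  assumes "is_partition \<nu>" "\<And>r. r \<ge> N \<Longrightarrow> \<nu> r = 0"
  shows "maya (beta_set \<nu>)" "charge w (beta_set \<nu>) = (\<Sum>r<N. w (bead \<nu> r) - w (- int r - 1))"
proof -
  let ?B = "beta_set \<nu>" and ?I = "bead \<nu> ` {..<N}" and ?J = "{- int N..<0}"
  note mem = mem_beta_set_iff[of N \<nu>, OF assms(2)]
  have sub: "?B - {..<0} \<subseteq> ?I \<union> ?J" "{..<0} - ?B \<subseteq> ?I \<union> ?J" by (auto simp: mem)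
  moreover have "finite (?I \<union> ?J)" by simp
  ultimately show "maya ?B" unfolding maya_def by (meson finite_subset)
  have I_ge: "- int N \<le> b" if "b \<in> ?I" for b using that by (auto simp: bead_def)
  have "charge w ?B = (\<Sum>b\<in>?I \<union> ?J. (of_bool (b \<in> ?B) - of_bool (b < 0)) * w b)"
    using sub by (intro charge_eq_sum) auto
  also have "\<dots> = sum w ((?I \<union> ?J) \<inter> ?B) - sum w ((?I \<union> ?J) \<inter> {..<0})"
    by (simp add: left_diff_distrib sum_subtractf lessThan_def)
  also have "(?I \<union> ?J) \<inter> ?B = ?I" using mem by auto
  also have "(?I \<union> ?J) \<inter> {..<0} = ?J" using I_ge by auto
  also have "sum w ?I = (\<Sum>r<N. w (bead \<nu> r))"
    by (subst sum.reindex) (auto simp: inj_on_def bead_inject[OF assms(1)])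
  also have "sum w ?J = (\<Sum>r<N. w (- int r - 1))"
    by (rule sum.reindex_bij_witness[of _ "\<lambda>r. - int r - 1" "\<lambda>b. nat (- b - 1)"]) auto
  finally show "charge w ?B = (\<Sum>r<N. w (bead \<nu> r) - w (- int r - 1))" by (simp add: sum_subtractf)
qed

lemma maya_beta_set: "is_partition \<nu> \<Longrightarrow> maya (beta_set \<nu>)"
  using charge_beta_set_eq_sum(1) partition_eventually_zero by metis

lemma charge_one_beta_set:
  assumes "is_partition \<nu>"
  shows "charge (\<lambda>_. 1) (beta_set \<nu>) = 0"
proof -
  obtain N where N: "\<And>r. r \<ge> N \<Longrightarrow> \<nu> r = 0" using partition_eventually_zero[OF assms] by metis
  have "charge (\<lambda>_. 1) (beta_set \<nu>) = (\<Sum>r<N. 1 - 1)" by (rule charge_beta_set_eq_sum(2)[OF assms N])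
  then show ?thesis by simp
qed

lemma psize_eq_sum:
  assumes "\<And>r. r \<ge> N \<Longrightarrow> \<nu> r = 0"
  shows "psize \<nu> = (\<Sum>r<N. \<nu> r)"
  unfolding psize_def
proof (rule sum.mono_neutral_left)
  have "r < N" if "\<nu> r \<noteq> 0" for r using assms[of r] that by (cases "r < N") auto
  then show "{r. \<nu> r \<noteq> 0} \<subseteq> {..<N}" by blast
qed auto

lemma energy_beta_set:
  assumes "is_partition \<nu>"
  shows "energy (beta_set \<nu>) = int (psize \<nu>)"
proof -
  obtain N where N: "\<And>r. r \<ge> N \<Longrightarrow> \<nu> r = 0" using partition_eventually_zero[OF assms] by metis
  have "energy (beta_set \<nu>) = (\<Sum>r<N. bead \<nu> r - (- int r - 1))"
    unfolding energy_def by (rule charge_beta_set_eq_sum(2)[OF assms N])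
  also have "\<dots> = int (psize \<nu>)" by (simp add: bead_def psize_eq_sum[OF N])
  finally show ?thesis .
qed

lemma beta_set_inject:
  assumes "is_partition \<nu>" "is_partition \<mu>" "beta_set \<nu> = beta_set \<mu>"
  shows "\<nu> = \<mu>"
proof -
  have le: "bead x r \<le> bead y r"
    if xy: "is_partition x" "is_partition y" "beta_set x = beta_set y" "\<And>q. q < r \<Longrightarrow> bead x q = bead y q"
    for x y r
  proof -
    have "bead x r \<in> beta_set y" using bead_mem[of x r] xy(3) by simp
    then obtain q where q: "bead x r = bead y q" by (rule beta_setE)
    have "\<not> q < r" using q xy(4) bead_inject[OF xy(1), of r q] by (metis less_irrefl)
    then show ?thesis using q bead_less[OF xy(2), of r q] by (cases "q = r") auto
  qed
  have "bead \<nu> r = bead \<mu> r" for r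
  proof (induction r rule: less_induct)
    case (less r)
    then show ?case using le[OF assms, of r] le[OF assms(2,1) assms(3)[symmetric], of r] by force
  qed
  then show ?thesis by (simp add: bead_def fun_eq_iff)
qed

lemma partition_increment:
  assumes "is_partition \<mu>" "bead \<mu> r + 1 \<notin> beta_set \<mu>"
  shows "is_partition (\<mu>(r := \<mu> r + 1))"
    "beta_set (\<mu>(r := \<mu> r + 1)) = move (bead \<mu> r) (bead \<mu> r + 1) (beta_set \<mu>)"
proof -
  let ?\<nu> = "\<mu>(r := \<mu> r + 1)"
  have step: "\<mu> r + 1 \<le> \<mu> q" if "q < r" for q
  proof -
    have "bead \<mu> (r - 1) \<noteq> bead \<mu> r + 1" using assms(2) bead_mem by metis
    then have "\<mu> (r - 1) \<noteq> \<mu> r" using that by (auto simp: bead_def)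
    then have "\<mu> r + 1 \<le> \<mu> (r - 1)" using partition_antimono[OF assms(1), of "r - 1" r] by simp
    also have "\<dots> \<le> \<mu> q" using that by (intro partition_antimono[OF assms(1)]) simp
    finally show ?thesis .
  qed
  have "antimono ?\<nu>"
    unfolding monotone_def using partition_antimono[OF assms(1)] step by (auto simp: le_Suc_eq)
  moreover have "finite {q. ?\<nu> q \<noteq> 0}"
    by (rule finite_subset[of _ "insert r {q. \<mu> q \<noteq> 0}"]) (use assms(1) in \<open>auto simp: is_partition_def\<close>)
  ultimately show "is_partition ?\<nu>" by (simp add: is_partition_def)
  have "bead ?\<nu> = (bead \<mu>)(r := bead \<mu> r + 1)" by (auto simp: bead_def)
  then show "beta_set ?\<nu> = move (bead \<mu> r) (bead \<mu> r + 1) (beta_set \<mu>)"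
    unfolding beta_set_eq_range by (auto simp: mem_move bead_inject[OF assms(1)])
qed

lemma empty_partition: "is_partition (\<lambda>_. 0)" "beta_set (\<lambda>_. 0) = {..<0}"
  using mem_beta_set_iff[of 0 "\<lambda>_. 0"] by (auto simp: is_partition_def monotone_def)

lemma maya_core_one_charge_zero:
  assumes "maya_core 1 B" "charge (\<lambda>_. 1) B = 0"
  shows "B = {..<0}"
proof (rule maya_core_unique)
  show "maya_core 1 {..<0}" by (simp add: maya_core_def maya_negatives down_closed_def)
  show "same_charge 1 B {..<0}" unfolding same_charge_def
  proof (intro allI impI)
    fix g :: "int \<Rightarrow> int" assume "\<forall>b. g (b + 1) = g b"
    then have "g b = g 0 * 1" for b using periodic_cong[of g 1 b 0] by simp
    then have g_eq: "g = (\<lambda>b. g 0 * 1)" by (rule ext)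
    have "charge g X = g 0 * charge (\<lambda>_. 1) X" for X by (subst g_eq) (rule charge_mult)
    then show "charge g B = charge g {..<0}" using assms(2) by (simp add: charge_negatives)
  qed
qed (rule assms(1))

lemma beta_set_surj:
  assumes "maya B" "charge (\<lambda>_. 1) B = 0"
  obtains \<nu> where "is_partition \<nu>" "beta_set \<nu> = B"
proof -
  have "\<exists>\<nu>. is_partition \<nu> \<and> beta_set \<nu> = B"
    using assms
  proof (induction "nat (energy B)" arbitrary: B rule: less_induct)
    case less
    show ?case
    proof (cases "down_closed 1 B")
      case True
      then have "B = {..<0}" using less.prems by (simp add: maya_core_one_charge_zero maya_core_def)
      then show ?thesis using empty_partition by blast
    next
      case False
      then obtain z where z: "z \<in> B" "z - 1 \<notin> B" by (auto simp: down_closed_def)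
      define B' where "B' = move z (z - 1) B"
      have B': "maya B'" "energy B' = energy B - 1" "charge (\<lambda>_. 1) B' = 0"
        unfolding B'_def using less.prems(2) maya_move[OF less.prems(1)]
          energy_move[OF less.prems(1) z] charge_move[OF less.prems(1) z, of "\<lambda>_. 1"] by simp_all
      have "nat (energy B') < nat (energy B)" using B'(2) energy_nonneg[of B'] by linarith
      from less.hyps[OF this B'(1,3)] obtain \<mu> where \<mu>: "is_partition \<mu>" "beta_set \<mu> = B'" by blast
      have "z - 1 \<in> beta_set \<mu>" by (simp add: \<mu>(2) B'_def mem_move)
      then obtain r where r: "z - 1 = bead \<mu> r" by (rule beta_setE)
      then have z_eq: "bead \<mu> r + 1 = z" "bead \<mu> r = z - 1" by simp_all
      have "bead \<mu> r + 1 \<notin> beta_set \<mu>" by (simp add: z_eq \<mu>(2) B'_def mem_move)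
      from partition_increment[OF \<mu>(1) this]
      have "is_partition (\<mu>(r := \<mu> r + 1))" "beta_set (\<mu>(r := \<mu> r + 1)) = B"
        using z_eq move_back[OF z] by (simp_all add: \<mu>(2) B'_def)
      then show ?thesis by blast
    qed
  qed
  then show thesis using that by blast
qed

lemma less_conjugate_iff:
  assumes "is_partition \<nu>"
  shows "c < conjugate_partition \<nu> r \<longleftrightarrow> r < \<nu> c"
proof -
  obtain N where N: "\<And>r. r \<ge> N \<Longrightarrow> \<nu> r = 0" using partition_eventually_zero[OF assms] by metis
  define k where "k = (LEAST c. \<nu> c \<le> r)"
  have "\<nu> N \<le> r" using N[of N] by simp
  then have k: "\<nu> k \<le> r" unfolding k_def by (rule LeastI)
  have mem: "r < \<nu> c \<longleftrightarrow> c < k" for c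
  proof
    assume "r < \<nu> c"
    then show "c < k" using k partition_antimono[OF assms, of k c] by (metis le_trans not_le)
  next
    assume "c < k"
    then show "r < \<nu> c" using not_less_Least[of c "\<lambda>c. \<nu> c \<le> r"] by (simp add: k_def not_le)
  qed
  then have "{c. \<nu> c \<ge> r + 1} = {..<k}" by (auto simp: Suc_le_eq)
  then show ?thesis using mem[of c] by (simp add: conjugate_partition_def)
qed

lemma conjugate_is_partition:
  assumes "is_partition \<nu>"
  shows "is_partition (conjugate_partition \<nu>)"
  unfolding is_partition_def
proof
  show "antimono (conjugate_partition \<nu>)"
  proof (rule antimonoI)
    fix x y :: nat assume "x \<le> y"
    then show "conjugate_partition \<nu> y \<le> conjugate_partition \<nu> x"
      using less_conjugate_iff[OF assms] by (meson leI le_less_trans less_irrefl)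
  qed
  have "{r. conjugate_partition \<nu> r \<noteq> 0} \<subseteq> {..<\<nu> 0}"
    using less_conjugate_iff[OF assms, of 0] by auto
  then show "finite {r. conjugate_partition \<nu> r \<noteq> 0}" using finite_subset by blast
qed

lemma beta_set_conjugate:
  assumes "is_partition \<nu>"
  shows "beta_set (conjugate_partition \<nu>) = dual_set (beta_set \<nu>)"
proof -
  let ?B = "beta_set (conjugate_partition \<nu>)" and ?D = "dual_set (beta_set \<nu>)"
  note conj = conjugate_is_partition[OF assms]
  have "?B \<subseteq> ?D"
  proof
    fix b assume "b \<in> ?B"
    then obtain r where r: "b = bead (conjugate_partition \<nu>) r" by (rule beta_setE)
    have "bar b \<noteq> bead \<nu> c" for c
      using less_conjugate_iff[OF assms, of c r] unfolding r bead_def bar_def by linarith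
    then show "b \<in> ?D" by (auto simp: dual_set_def beta_set_eq_range)
  qed
  have maya: "maya ?B" "maya ?D"
    using maya_beta_set[OF conj] maya_dual_set[OF maya_beta_set[OF assms]] by simp_all
  have "charge (\<lambda>_. 1) ?B = charge (\<lambda>_. 1) ?D"
    using charge_one_beta_set[OF conj] charge_one_beta_set[OF assms] by (simp add: charge_dual_set o_def)
  then have "card (?D - ?B) = card (?B - ?D)" using charge_diff[OF maya, of "\<lambda>_. 1"] by simp
  then have "?D - ?B = {}" using \<open>?B \<subseteq> ?D\<close> finite_maya_diff[OF maya(2,1)] by (simp add: Diff_eq_empty_iff[THEN iffD2])
  then show ?thesis using \<open>?B \<subseteq> ?D\<close> by blast
qed

lemma self_conjugate_iff:
  assumes "is_partition \<nu>"
  shows "conjugate_partition \<nu> = \<nu> \<longleftrightarrow> self_dual (beta_set \<nu>)"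
proof -
  have "conjugate_partition \<nu> = \<nu> \<longleftrightarrow> beta_set (conjugate_partition \<nu>) = beta_set \<nu>"
    using beta_set_inject[OF conjugate_is_partition[OF assms] assms] by metis
  then show ?thesis by (simp add: beta_set_conjugate[OF assms] self_dual_def)
qed


section \<open>Rim hooks, cores and weights\<close>

text \<open>Removing a rim hook that occupies the rows \<open>p, \<dots>, q\<close> of \<open>\<nu>\<close> leaves \<open>\<mu>\<close>.\<close>

definition strip_removed :: "(nat \<Rightarrow> nat) \<Rightarrow> (nat \<Rightarrow> nat) \<Rightarrow> nat \<Rightarrow> nat \<Rightarrow> bool" where
  "strip_removed \<nu> \<mu> p q \<longleftrightarrow> p \<le> q \<and> \<mu> q < \<nu> q \<and> (\<forall>r. r < p \<or> q < r \<longrightarrow> \<mu> r = \<nu> r) \<and>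
     (\<forall>r. p \<le> r \<and> r < q \<longrightarrow> \<mu> r + 1 = \<nu> (r + 1))"

definition skew_diagram :: "(nat \<Rightarrow> nat) \<Rightarrow> (nat \<Rightarrow> nat) \<Rightarrow> (nat \<times> nat) set" where
  "skew_diagram \<nu> \<mu> = {(r, c). \<mu> r \<le> c \<and> c < \<nu> r}"

lemma psize_skew_diagram:
  assumes \<nu>: "is_partition \<nu>" and le: "\<And>r. \<mu> r \<le> \<nu> r"
  shows "finite (skew_diagram \<nu> \<mu>)" "psize \<nu> = psize \<mu> + card (skew_diagram \<nu> \<mu>)"
proof -
  obtain N where N: "\<And>r. r \<ge> N \<Longrightarrow> \<nu> r = 0" using partition_eventually_zero[OF \<nu>] by metis
  have N': "\<mu> r = 0" if "r \<ge> N" for r using le[of r] N[OF that] by simp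
  have "r < N" if "c < \<nu> r" for r c using N[of r] that by (metis not_le not_less0)
  then have skew: "skew_diagram \<nu> \<mu> = (SIGMA r:{..<N}. {\<mu> r..<\<nu> r})" by (auto simp: skew_diagram_def)
  show "finite (skew_diagram \<nu> \<mu>)" unfolding skew by simp
  have "card (skew_diagram \<nu> \<mu>) = (\<Sum>r<N. \<nu> r - \<mu> r)" unfolding skew by simp
  moreover have "(\<Sum>r<N. \<nu> r) = (\<Sum>r<N. \<mu> r) + (\<Sum>r<N. \<nu> r - \<mu> r)"
    unfolding sum.distrib[symmetric] by (rule sum.cong) (use le in auto)
  ultimately show "psize \<nu> = psize \<mu> + card (skew_diagram \<nu> \<mu>)"
    using psize_eq_sum[OF N] psize_eq_sum[OF N'] by simp
qed

lemma young_diagram_skew: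
  assumes "\<And>r. \<mu> r \<le> \<nu> r"
  shows "young_diagram \<mu> = young_diagram \<nu> - skew_diagram \<nu> \<mu>"
  using assms by (auto simp: young_diagram_def skew_diagram_def not_le intro: less_le_trans)

lemma skew_diagram_of_removal:
  assumes "young_diagram \<mu> = young_diagram \<nu> - H" "H \<subseteq> young_diagram \<nu>"
  shows "\<mu> r \<le> \<nu> r" "H = skew_diagram \<nu> \<mu>"
proof -
  have mem: "c < \<mu> r \<longleftrightarrow> c < \<nu> r \<and> (r, c) \<notin> H" for r c
    using assms(1) unfolding young_diagram_def by (auto simp: set_eq_iff)
  show "\<mu> r \<le> \<nu> r" using mem[of "\<nu> r" r] by (metis less_irrefl not_less)
  show "H = skew_diagram \<nu> \<mu>"
    using mem assms(2) by (auto simp: skew_diagram_def young_diagram_def not_less[symmetric])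
qed

lemma beta_set_strip:
  assumes \<nu>: "is_partition \<nu>" and strip: "strip_removed \<nu> \<mu> p q"
  shows "beta_set \<mu> = move (bead \<nu> p) (bead \<mu> q) (beta_set \<nu>)"
proof -
  have "p \<le> q" and outside: "\<And>r. r < p \<or> q < r \<Longrightarrow> bead \<mu> r = bead \<nu> r"
    and inside: "\<And>r. p \<le> r \<Longrightarrow> r < q \<Longrightarrow> bead \<mu> r = bead \<nu> (r + 1)"
    using strip by (auto simp: strip_removed_def bead_def)
  have "bead \<mu> ` (- {q}) = bead \<nu> ` (- {p})"
  proof (intro equalityI subsetI)
    fix x assume "x \<in> bead \<mu> ` (- {q})"
    then obtain r where r: "x = bead \<mu> r" "r \<noteq> q" by auto
    then consider "r < p \<or> q < r" | "p \<le> r" "r < q" by linarith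
    then show "x \<in> bead \<nu> ` (- {p})"
    proof cases
      case 1
      then show ?thesis using r(1) outside[OF 1] \<open>p \<le> q\<close> by (intro image_eqI[of _ _ r]) auto
    next
      case 2
      then show ?thesis using r(1) inside[OF 2] by (intro image_eqI[of _ _ "r + 1"]) auto
    qed
  next
    fix x assume "x \<in> bead \<nu> ` (- {p})"
    then obtain r where r: "x = bead \<nu> r" "r \<noteq> p" by auto
    then consider "r < p \<or> q < r" | "p \<le> r - 1" "r - 1 < q" "r > 0" by linarith
    then show "x \<in> bead \<mu> ` (- {q})"
    proof cases
      case 1
      then show ?thesis using r(1) outside[OF 1] \<open>p \<le> q\<close> by (intro image_eqI[of _ _ r]) auto
    next
      case 2
      then show ?thesis using r(1) inside[OF 2(1,2)] by (intro image_eqI[of _ _ "r - 1"]) auto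
    qed
  qed
  moreover have "beta_set \<mu> = insert (bead \<mu> q) (bead \<mu> ` (- {q}))"
    by (auto simp: beta_set_eq_range)
  moreover have "bead \<nu> ` (- {p}) = beta_set \<nu> - {bead \<nu> p}"
    by (auto simp: beta_set_eq_range bead_inject[OF \<nu>])
  ultimately show ?thesis by (simp add: move_def)
qed

lemma strip_end_notin_beta_set:
  assumes \<nu>: "is_partition \<nu>" and \<mu>: "is_partition \<mu>" and strip: "strip_removed \<nu> \<mu> p q"
  shows "bead \<mu> q \<notin> beta_set \<nu>"
proof
  assume "bead \<mu> q \<in> beta_set \<nu>"
  then obtain r where r: "bead \<mu> q = bead \<nu> r" by (rule beta_setE)
  have "bead \<mu> q < bead \<nu> q" using strip by (simp add: strip_removed_def bead_def)
  then have "q < r" using r bead_less_iff[OF \<nu>] by simp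
  moreover have "bead \<nu> (q + 1) < bead \<mu> q"
    using bead_less[OF \<mu>, of q "q + 1"] strip by (simp add: strip_removed_def bead_def)
  then have "r < q + 1" using r bead_less_iff[OF \<nu>] by simp
  ultimately show False by simp
qed

lemma strip_length:
  assumes "is_partition \<nu>" "is_partition \<mu>" "strip_removed \<nu> \<mu> p q"
  shows "bead \<mu> q = bead \<nu> p - (int (psize \<nu>) - int (psize \<mu>))"
  using energy_move[OF maya_beta_set[OF assms(1)] bead_mem strip_end_notin_beta_set[OF assms], of p]
  by (simp add: beta_set_strip[OF assms(1,3), symmetric] energy_beta_set assms)

lemma path_crosses_row:
  assumes "(x, y) \<in> (adjacent_nodes \<inter> H \<times> H)\<^sup>*" "fst x \<le> r" "r < fst y"
  shows "\<exists>c. (r, c) \<in> H \<and> (r + 1, c) \<in> H"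
  using assms
proof (induction rule: rtrancl_induct)
  case (step y z)
  show ?case
  proof (cases "r < fst y")
    case True
    then show ?thesis using step by blast
  next
    case False
    obtain a b a' b' where yz: "y = (a, b)" "z = (a', b')" by (metis surj_pair)
    have nodes: "((a, b), (a', b')) \<in> adjacent_nodes" "(a, b) \<in> H" "(a', b') \<in> H" using step yz by auto
    moreover have "a \<le> r" "r < a'" using False step yz by auto
    ultimately have "a = r" "a' = r + 1" "b' = b" by (auto simp: adjacent_nodes_def)
    then show ?thesis using nodes by blast
  qed
qed simp

lemma connected_skew_next_row:
  assumes H: "H = skew_diagram \<nu> \<mu>" and "H \<subseteq> rim \<nu>" "connected_nodes H"
    and r: "\<mu> r < \<nu> r" "\<mu> q < \<nu> q" "r < q"
  shows "\<mu> (r + 1) < \<nu> (r + 1) \<and> \<mu> r + 1 = \<nu> (r + 1)"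
proof -
  have ends: "(r, \<mu> r) \<in> H" "(q, \<mu> q) \<in> H" using r(1,2) by (simp_all add: H skew_diagram_def)
  then have "((r, \<mu> r), (q, \<mu> q)) \<in> (adjacent_nodes \<inter> H \<times> H)\<^sup>*"
    using assms(3) by (simp add: connected_nodes_def)
  then obtain c where c: "(r, c) \<in> H" "(r + 1, c) \<in> H"
    using path_crosses_row[of "(r, \<mu> r)" "(q, \<mu> q)" H r] r(3) by auto
  then have "\<mu> r \<le> c" "\<mu> (r + 1) \<le> c" "c < \<nu> (r + 1)" by (auto simp: H skew_diagram_def)
  moreover have "\<nu> (r + 1) \<le> \<mu> r + 1"
    using ends(1) assms(2) by (auto simp: rim_def young_diagram_def not_less)
  ultimately show ?thesis by simp
qed

lemma strip_if_connected:
  assumes \<nu>: "is_partition \<nu>" and le: "\<And>r. \<mu> r \<le> \<nu> r" and H: "H = skew_diagram \<nu> \<mu>"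
    and "H \<noteq> {}" "H \<subseteq> rim \<nu>" "connected_nodes H"
  obtains p q where "strip_removed \<nu> \<mu> p q"
proof -
  define R where "R = {r. \<mu> r < \<nu> r}"
  have "finite {r. \<nu> r \<noteq> 0}" using \<nu> by (simp add: is_partition_def)
  then have fin: "finite R" by (rule finite_subset[rotated]) (auto simp: R_def)
  obtain r c where "(r, c) \<in> H" using assms(4) by auto
  then have "r \<in> R" by (simp add: R_def H skew_diagram_def)
  then have "R \<noteq> {}" by blast
  define p q where "p = Min R" and "q = Max R"
  have pq: "p \<in> R" "q \<in> R" "p \<le> q" using fin \<open>R \<noteq> {}\<close> by (auto simp: p_def q_def)
  have step: "r + 1 \<in> R \<and> \<mu> r + 1 = \<nu> (r + 1)" if "r \<in> R" "r < q" for r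
    using connected_skew_next_row[OF H assms(5,6), of r q] that pq(2) by (simp add: R_def)
  have rows: "r \<in> R" if "p \<le> r" "r \<le> q" for r
    using that
  proof (induction r rule: dec_induct)
    case base
    show ?case by (rule pq(1))
  next
    case (step r)
    then show ?case using \<open>\<And>r. r \<in> R \<Longrightarrow> r < q \<Longrightarrow> r + 1 \<in> R \<and> \<mu> r + 1 = \<nu> (r + 1)\<close>[of r] by simp
  qed
  have "\<mu> r = \<nu> r" if "r < p \<or> q < r" for r
  proof -
    have "r \<notin> R" using that Min_le[OF fin, of r] Max_ge[OF fin, of r] by (auto simp: p_def q_def)
    then show ?thesis using le[of r] by (simp add: R_def)
  qed
  then have "strip_removed \<nu> \<mu> p q"
    using pq step rows by (simp add: strip_removed_def R_def)
  then show thesis by (rule that)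
qed

lemma remove_rim_hook_beta_set:
  assumes \<nu>: "is_partition \<nu>" and "remove_rim_hook s \<nu> \<mu>" and "s > 0"
  obtains z where "z \<in> beta_set \<nu>" "z - int s \<notin> beta_set \<nu>" "beta_set \<mu> = move z (z - int s) (beta_set \<nu>)"
proof -
  obtain H where \<mu>: "is_partition \<mu>" and H: "H \<subseteq> rim \<nu>" "card H = s" "connected_nodes H"
      "young_diagram \<mu> = young_diagram \<nu> - H"
    using assms(2) by (auto simp: remove_rim_hook_def is_rim_hook_def)
  have "H \<subseteq> young_diagram \<nu>" using H(1) by (auto simp: rim_def)
  note skew = skew_diagram_of_removal[OF H(4) this]
  have "H \<noteq> {}" using H(2) assms(3) by auto
  then obtain p q where strip: "strip_removed \<nu> \<mu> p q"
    using strip_if_connected[OF \<nu> skew _ H(1,3)] by blast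
  have "psize \<nu> = psize \<mu> + s" using psize_skew_diagram(2)[OF \<nu> skew(1)] H(2) skew(2) by simp
  then have "bead \<mu> q = bead \<nu> p - int s" using strip_length[OF \<nu> \<mu> strip] by simp
  then show thesis
    using that[OF bead_mem] beta_set_strip[OF \<nu> strip] strip_end_notin_beta_set[OF \<nu> \<mu> strip] by simp
qed

lemma skew_row_connected:
  assumes "(r, c) \<in> skew_diagram \<nu> \<mu>"
  shows "((r, c), (r, \<mu> r)) \<in> (adjacent_nodes \<inter> skew_diagram \<nu> \<mu> \<times> skew_diagram \<nu> \<mu>)\<^sup>*"
  using assms
proof (induction "c - \<mu> r" arbitrary: c)
  case 0
  then show ?case by (simp add: skew_diagram_def)
next
  case (Suc k)
  let ?H = "skew_diagram \<nu> \<mu>"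
  have "(r, c - 1) \<in> ?H" "((r, c), (r, c - 1)) \<in> adjacent_nodes \<inter> ?H \<times> ?H" "k = c - 1 - \<mu> r"
    using Suc.hyps(2) Suc.prems by (auto simp: skew_diagram_def adjacent_nodes_def)
  then show ?case using Suc.hyps(1)[of "c - 1"] by (meson converse_rtrancl_into_rtrancl)
qed

lemma connected_strip:
  assumes \<nu>: "is_partition \<nu>" and \<mu>: "is_partition \<mu>" and strip: "strip_removed \<nu> \<mu> p q"
  shows "connected_nodes (skew_diagram \<nu> \<mu>)"
proof -
  let ?H = "skew_diagram \<nu> \<mu>" and ?E = "adjacent_nodes \<inter> skew_diagram \<nu> \<mu> \<times> skew_diagram \<nu> \<mu>"
  have outside: "\<And>r. r < p \<or> q < r \<Longrightarrow> \<mu> r = \<nu> r" and inside: "\<And>r. p \<le> r \<Longrightarrow> r < q \<Longrightarrow> \<mu> r + 1 = \<nu> (r + 1)"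
    using strip by (auto simp: strip_removed_def)
  have sym: "sym ?E" by (auto simp: sym_def adjacent_nodes_def)
  note row = skew_row_connected[of _ _ \<nu> \<mu>]
  have column: "((r, \<mu> r), (r + 1, \<mu> r)) \<in> ?E" if "p \<le> r" "r < q" for r
    using inside[OF that] partition_antimono[OF \<nu>, of r "r + 1"] partition_antimono[OF \<mu>, of r "r + 1"]
    by (auto simp: skew_diagram_def adjacent_nodes_def)
  have to_end: "((r, c), (q, \<mu> q)) \<in> ?E\<^sup>*" if "(r, c) \<in> ?H" for r c
    using that
  proof (induction "q - r" arbitrary: r c)
    case 0
    then have "r = q" using outside[of r] by (fastforce simp: skew_diagram_def)
    then show ?case using row 0 by simp
  next
    case (Suc k)
    then have r: "p \<le> r" "r < q" using outside[of r] by (fastforce simp: skew_diagram_def)+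
    then have "(r + 1, \<mu> r) \<in> ?H" using column by blast
    then have "((r + 1, \<mu> r), (q, \<mu> q)) \<in> ?E\<^sup>*" using Suc.hyps by simp
    with column[OF r] have "((r, \<mu> r), (q, \<mu> q)) \<in> ?E\<^sup>*" by (rule converse_rtrancl_into_rtrancl)
    with row[OF Suc.prems] show ?case by (rule rtrancl_trans)
  qed
  show ?thesis
    unfolding connected_nodes_def
  proof (intro ballI)
    fix x y assume "x \<in> ?H" "y \<in> ?H"
    then have "(x, (q, \<mu> q)) \<in> ?E\<^sup>*" "(y, (q, \<mu> q)) \<in> ?E\<^sup>*" using to_end by (metis surj_pair)+
    then show "(x, y) \<in> ?E\<^sup>*" using sym_rtrancl[OF sym] by (meson rtrancl_trans symD)
  qed
qed

lemma strip_is_rim_hook: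
  assumes \<nu>: "is_partition \<nu>" and \<mu>: "is_partition \<mu>" and strip: "strip_removed \<nu> \<mu> p q"
  shows "is_rim_hook (psize \<nu> - psize \<mu>) \<nu> (skew_diagram \<nu> \<mu>)"
proof -
  have outside: "\<And>r. r < p \<or> q < r \<Longrightarrow> \<mu> r = \<nu> r" and inside: "\<And>r. p \<le> r \<Longrightarrow> r < q \<Longrightarrow> \<mu> r + 1 = \<nu> (r + 1)"
    and last: "\<mu> q < \<nu> q"
    using strip by (auto simp: strip_removed_def)
  have le: "\<mu> r \<le> \<nu> r" for r
  proof -
    consider "r < p \<or> q < r" | "p \<le> r" "r < q" | "r = q" by linarith
    then show ?thesis
      using outside[of r] inside[of r] last partition_antimono[OF \<nu>, of r "r + 1"] by cases auto
  qed
  have "\<nu> (r + 1) \<le> c + 1" if "\<mu> r \<le> c" "c < \<nu> r" for r c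
  proof (cases "r < q")
    case True
    then have "p \<le> r" using outside[of r] that by force
    then show ?thesis using inside[of r] True that(1) by simp
  next
    case False
    then have "\<nu> (r + 1) = \<mu> (r + 1)" using outside[of "r + 1"] by simp
    then show ?thesis using partition_antimono[OF \<mu>, of r "r + 1"] that(1) by simp
  qed
  then have "skew_diagram \<nu> \<mu> \<subseteq> rim \<nu>"
    by (auto simp: skew_diagram_def rim_def young_diagram_def not_less)
  moreover have "card (skew_diagram \<nu> \<mu>) = psize \<nu> - psize \<mu>"
    using psize_skew_diagram(2)[OF \<nu> le] by simp
  ultimately show ?thesis
    unfolding is_rim_hook_def
    using connected_strip[OF assms] young_diagram_skew[of \<mu> \<nu>] le \<mu> by blast
qed

lemma last_row_above:
  assumes "is_partition \<nu>" "b < bead \<nu> p" "b \<notin> beta_set \<nu>"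
  obtains q where "p \<le> q" "b < bead \<nu> q" "bead \<nu> (q + 1) < b"
proof -
  obtain N where N: "\<And>r. r \<ge> N \<Longrightarrow> \<nu> r = 0" using partition_eventually_zero[OF assms(1)] by metis
  let ?Q = "{r. b < bead \<nu> r}"
  have "?Q \<subseteq> {..N + nat \<bar>b\<bar>}"
  proof
    fix r assume "r \<in> ?Q"
    then show "r \<in> {..N + nat \<bar>b\<bar>}" using N[of r] by (cases "r \<ge> N") (auto simp: bead_def)
  qed
  then have fin: "finite ?Q" by (rule finite_subset) simp
  have "p \<in> ?Q" using assms(2) by simp
  then have "Max ?Q \<in> ?Q" "p \<le> Max ?Q" using Max_in[OF fin] Max_ge[OF fin] by blast+
  moreover have "Max ?Q + 1 \<notin> ?Q" using Max_ge[OF fin, of "Max ?Q + 1"] by auto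
  then have "bead \<nu> (Max ?Q + 1) < b"
    using assms(3) bead_mem[of \<nu> "Max ?Q + 1"] by (metis linorder_neqE_linordered_idom mem_Collect_eq)
  ultimately show thesis using that by blast
qed

lemma strip_exists:
  assumes \<nu>: "is_partition \<nu>" and b: "b < bead \<nu> p" "b \<notin> beta_set \<nu>"
  obtains \<mu> q where "is_partition \<mu>" "strip_removed \<nu> \<mu> p q" "bead \<mu> q = b"
proof -
  obtain q where q: "p \<le> q" "b < bead \<nu> q" "bead \<nu> (q + 1) < b" using last_row_above[OF assms] .
  define m where "m = nat (b + int q + 1)"
  have m: "int m = b + int q + 1" "\<nu> (q + 1) \<le> m" "m < \<nu> q"
    using q(2,3) by (simp_all add: m_def bead_def)
  define \<mu> where "\<mu> r = (if r < p \<or> q < r then \<nu> r else if r < q then \<nu> (r + 1) - 1 else m)" for r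
  note anti = partition_antimono[OF \<nu>]
  have le: "\<mu> r \<le> \<nu> r" for r using anti[of r "r + 1"] m(3) by (auto simp: \<mu>_def)
  have "\<mu> (Suc r) \<le> \<mu> r" for r
  proof -
    consider "Suc r < p \<or> q < r" | "Suc r = p" | "p \<le> r" "Suc r < q" | "p \<le> r" "Suc r = q" | "r = q" by linarith
    then show ?thesis
    proof cases
      case 1
      then show ?thesis using anti[of r "Suc r"] by (auto simp: \<mu>_def)
    next
      case 2
      then show ?thesis using le[of "Suc r"] anti[of r "Suc r"] by (simp add: \<mu>_def)
    next
      case 3
      then show ?thesis using anti[of "Suc r" "Suc (Suc r)"] by (auto simp: \<mu>_def)
    next
      case 4
      then show ?thesis using m(3) by (auto simp: \<mu>_def)
    next
      case 5
      then show ?thesis using m(2) q(1) by (auto simp: \<mu>_def)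
    qed
  qed
  then have "antimono \<mu>" by (simp add: antimono_iff_le_Suc)
  then have "is_partition \<mu>" by (rule partition_if_le[OF \<nu> _ le])
  moreover have "\<nu> (r + 1) > 0" if "r < q" for r using anti[of "r + 1" q] m(3) that by simp
  then have "strip_removed \<nu> \<mu> p q" using q(1) m(3) by (simp add: strip_removed_def \<mu>_def)
  moreover have "bead \<mu> q = b" using q(1) m(1) by (simp add: \<mu>_def bead_def)
  ultimately show thesis by (rule that)
qed

lemma rim_hook_exists:
  assumes \<nu>: "is_partition \<nu>" and z: "z \<in> beta_set \<nu>" "z - int s \<notin> beta_set \<nu>" and "s > 0"
  shows "\<exists>H. is_rim_hook s \<nu> H"
proof -
  obtain p where p: "z = bead \<nu> p" using z(1) by (rule beta_setE)
  obtain \<mu> q where \<mu>: "is_partition \<mu>" "strip_removed \<nu> \<mu> p q" "bead \<mu> q = z - int s"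
    using strip_exists[OF \<nu> _ z(2), of p] p assms(4) by auto
  have "psize \<nu> - psize \<mu> = s" using strip_length[OF \<nu> \<mu>(1,2)] \<mu>(3) p by simp
  then show ?thesis using strip_is_rim_hook[OF \<nu> \<mu>(1,2)] by blast
qed

lemma is_core_iff:
  assumes "s > 0"
  shows "is_core s \<nu> \<longleftrightarrow> is_partition \<nu> \<and> maya_core (int s) (beta_set \<nu>)"
proof (cases "is_partition \<nu>")
  case True
  have "down_closed (int s) (beta_set \<nu>)" if "\<not> (\<exists>H. is_rim_hook s \<nu> H)"
    using that rim_hook_exists[OF True _ _ assms] unfolding down_closed_def by blast
  moreover have "\<not> is_rim_hook s \<nu> H" if "down_closed (int s) (beta_set \<nu>)" for H
  proof
    assume "is_rim_hook s \<nu> H"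
    then obtain \<mu> where "remove_rim_hook s \<nu> \<mu>" unfolding remove_rim_hook_def is_rim_hook_def by blast
    then show False
      using remove_rim_hook_beta_set[OF True _ assms] that unfolding down_closed_def by metis
  qed
  ultimately show ?thesis
    using True assms maya_beta_set[OF True] unfolding is_core_def maya_core_def by auto
qed (simp add: is_core_def)

lemma remove_rim_hook_invariants:
  assumes "is_partition \<nu>" "remove_rim_hook s \<nu> \<mu>" "s > 0"
  shows "is_partition \<mu>" "same_charge (int s) (beta_set \<mu>) (beta_set \<nu>)" "psize \<nu> = psize \<mu> + s"
proof -
  show \<mu>: "is_partition \<mu>" using assms(2) by (simp add: remove_rim_hook_def)
  obtain z where z: "z \<in> beta_set \<nu>" "z - int s \<notin> beta_set \<nu>" "beta_set \<mu> = move z (z - int s) (beta_set \<nu>)"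
    using remove_rim_hook_beta_set[OF assms] by metis
  note maya = maya_beta_set[OF assms(1)]
  show "same_charge (int s) (beta_set \<mu>) (beta_set \<nu>)"
    unfolding z(3) using maya z(1,2) by (rule same_charge_move) (simp add: cong_iff_dvd_diff)
  have "energy (beta_set \<mu>) = energy (beta_set \<nu>) - int s"
    unfolding z(3) energy_move[OF maya z(1,2)] by simp
  then show "psize \<nu> = psize \<mu> + s" using energy_beta_set[OF assms(1)] energy_beta_set[OF \<mu>] by simp
qed

lemma remove_rim_hooks_invariants:
  assumes "(remove_rim_hook s ^^ w) \<nu> \<mu>" "is_partition \<nu>" "s > 0"
  shows "is_partition \<mu> \<and> same_charge (int s) (beta_set \<mu>) (beta_set \<nu>) \<and> psize \<nu> = psize \<mu> + s * w"
  using assms(1)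
proof (induction w arbitrary: \<mu>)
  case (Suc w)
  then obtain \<rho> where \<rho>: "(remove_rim_hook s ^^ w) \<nu> \<rho>" "remove_rim_hook s \<rho> \<mu>" by auto
  then show ?case
    using Suc.IH[OF \<rho>(1)] remove_rim_hook_invariants[OF _ \<rho>(2) assms(3)] same_charge_trans
    by (auto simp: algebra_simps)
qed (use assms(2) in simp)

lemma core_reachable:
  assumes "is_partition \<nu>" "s > 0"
  shows "\<exists>w \<mu>. (remove_rim_hook s ^^ w) \<nu> \<mu> \<and> is_core s \<mu>"
  using assms(1)
proof (induction "psize \<nu>" arbitrary: \<nu> rule: less_induct)
  case less
  show ?case
  proof (cases "is_core s \<nu>")
    case True
    then show ?thesis by (intro exI[of _ 0] exI[of _ \<nu>]) simp
  next
    case False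
    then obtain \<mu> where \<mu>: "remove_rim_hook s \<nu> \<mu>"
      using less.prems unfolding is_core_def remove_rim_hook_def is_rim_hook_def by blast
    note inv = remove_rim_hook_invariants[OF less.prems \<mu> assms(2)]
    have "psize \<mu> < psize \<nu>" using inv(3) assms(2) by simp
    from less.hyps[OF this inv(1)] obtain w \<kappa> where "(remove_rim_hook s ^^ w) \<mu> \<kappa>" "is_core s \<kappa>" by blast
    then show ?thesis using \<mu> by (metis relpowp_Suc_I2)
  qed
qed

lemma is_core_eqI:
  assumes "is_core s \<mu>" "is_core s \<rho>" "same_charge (int s) (beta_set \<mu>) (beta_set \<rho>)" "s > 0"
  shows "\<mu> = \<rho>"
  using assms maya_core_unique beta_set_inject by (auto simp: is_core_iff)

lemma cor_wei_unique:
  assumes "(remove_rim_hook s ^^ w) \<nu> \<mu>" "is_core s \<mu>" "is_partition \<nu>" "s > 0"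
  shows "cor s \<nu> = \<mu>" "wei s \<nu> = w"
proof -
  have unique: "\<mu>' = \<mu> \<and> w' = w" if other: "(remove_rim_hook s ^^ w') \<nu> \<mu>'" "is_core s \<mu>'" for w' \<mu>'
  proof -
    note inv = remove_rim_hooks_invariants[OF assms(1,3,4)] remove_rim_hooks_invariants[OF other(1) assms(3,4)]
    then have "same_charge (int s) (beta_set \<mu>') (beta_set \<mu>)"
      by (meson same_charge_sym same_charge_trans)
    then have "\<mu>' = \<mu>" by (rule is_core_eqI[OF other(2) assms(2) _ assms(4)])
    then show ?thesis using inv assms(4) by simp
  qed
  have "(remove_rim_hook s)\<^sup>*\<^sup>* \<nu> \<mu>' \<and> is_core s \<mu>' \<longleftrightarrow> \<mu>' = \<mu>" for \<mu>'
    unfolding rtranclp_power using assms(1,2) unique by blast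
  then show "cor s \<nu> = \<mu>" by (simp add: cor_def)
  have "(\<exists>\<mu>'. (remove_rim_hook s ^^ w') \<nu> \<mu>' \<and> is_core s \<mu>') \<longleftrightarrow> w' = w" for w'
    using assms(1,2) unique by blast
  then show "wei s \<nu> = w" by (simp add: wei_def)
qed

lemma cor_wei:
  assumes "is_partition \<nu>" "s > 0"
  shows "is_core s (cor s \<nu>)" "core_of (int s) (beta_set \<nu>) (beta_set (cor s \<nu>))"
    "psize \<nu> = psize (cor s \<nu>) + s * wei s \<nu>"
proof -
  obtain w \<mu> where w: "(remove_rim_hook s ^^ w) \<nu> \<mu>" "is_core s \<mu>" using core_reachable[OF assms] by blast
  note eq = cor_wei_unique[OF w assms] and inv = remove_rim_hooks_invariants[OF w(1) assms]
  show "is_core s (cor s \<nu>)" using w(2) eq by simp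
  then show "core_of (int s) (beta_set \<nu>) (beta_set (cor s \<nu>))"
    using conjunct1[OF conjunct2[OF inv], THEN same_charge_sym] assms(2) eq
    by (simp add: core_of_def is_core_iff)
  show "psize \<nu> = psize (cor s \<nu>) + s * wei s \<nu>" using inv eq by simp
qed

lemma cor_eq_iff:
  assumes "is_partition \<nu>" "is_core s \<sigma>" "s > 0"
  shows "cor s \<nu> = \<sigma> \<longleftrightarrow> same_charge (int s) (beta_set \<nu>) (beta_set \<sigma>)"
proof
  show "same_charge (int s) (beta_set \<nu>) (beta_set \<sigma>)" if "cor s \<nu> = \<sigma>"
    using cor_wei(2)[OF assms(1,3)] that by (simp add: core_of_def)
  show "cor s \<nu> = \<sigma>" if "same_charge (int s) (beta_set \<nu>) (beta_set \<sigma>)"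
  proof (rule is_core_eqI[OF cor_wei(1)[OF assms(1,3)] assms(2) _ assms(3)])
    show "same_charge (int s) (beta_set (cor s \<nu>)) (beta_set \<sigma>)"
      using cor_wei(2)[OF assms(1,3)] that unfolding core_of_def by (meson same_charge_sym same_charge_trans)
  qed
qed


section \<open>From beta-sets back to partitions\<close>

lemma kappa_eq_kappa_set:
  assumes "s > 1" "t > 1" "coprime s t"
  shows "is_partition (kappa s t)" "beta_set (kappa s t) = kappa_set (int s) (int t)"
proof -
  interpret coprime_pair "int s" "int t" using assms by unfold_locales simp_all
  note K = sym_coreD[OF sym_core_kappa_set]
  obtain \<kappa> where \<kappa>: "is_partition \<kappa>" "beta_set \<kappa> = kappa_set (int s) (int t)"
    using beta_set_surj[OF K(4) self_dual_charge[OF K(1)]] .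
  have cores: "is_partition \<mu>" "maya_core (int s) (beta_set \<mu>)" "maya_core (int t) (beta_set \<mu>)"
    if "is_core s \<mu> \<and> is_core t \<mu>" for \<mu>
    using that assms(1,2) by (simp_all add: is_core_iff)
  have \<kappa>_core: "is_core s \<kappa> \<and> is_core t \<kappa>" using \<kappa> K(2,3) assms(1,2) by (simp add: is_core_iff)
  have size_\<kappa>: "int (psize \<kappa>) = energy (kappa_set (int s) (int t))"
    using energy_beta_set[OF \<kappa>(1)] \<kappa>(2) by simp
  have largest: "psize \<mu> \<le> psize \<kappa>" if \<mu>: "is_core s \<mu> \<and> is_core t \<mu>" for \<mu>
    using energy_le_kappa_set[OF cores(2,3)[OF \<mu>] charge_one_beta_set[OF cores(1)[OF \<mu>]]]
      energy_beta_set[OF cores(1)[OF \<mu>]] size_\<kappa> by simp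
  have unique: "\<mu> = \<kappa>" if \<mu>: "is_core s \<mu> \<and> is_core t \<mu>" and "psize \<kappa> \<le> psize \<mu>" for \<mu>
  proof -
    have "energy (beta_set \<mu>) = energy (kappa_set (int s) (int t))"
      using largest[OF \<mu>] that(2) energy_beta_set[OF cores(1)[OF \<mu>]] size_\<kappa> by simp
    then have "beta_set \<mu> = beta_set \<kappa>"
      unfolding \<kappa>(2) by (rule kappa_set_unique_largest[OF cores(2,3)[OF \<mu>] charge_one_beta_set[OF cores(1)[OF \<mu>]]])
    then show ?thesis by (rule beta_set_inject[OF cores(1)[OF \<mu>] \<kappa>(1)])
  qed
  have "kappa s t = \<kappa>"
    unfolding kappa_def by (rule the_equality) (use \<kappa>_core largest unique in blast)+
  then show "is_partition (kappa s t)" "beta_set (kappa s t) = kappa_set (int s) (int t)"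
    using \<kappa> by simp_all
qed

lemma harpoon_iff: "harpoon p q \<alpha> \<beta> \<longleftrightarrow> set_harpoon (int p) (int q) (beta_set \<alpha>) (beta_set \<beta>)"
  by (simp add: harpoon_def set_harpoon_def move_def)

lemma harpoons_via_iff:
  "harpoons_via s t \<alpha> \<beta> b c \<longleftrightarrow> set_harpoons (int s) (int t) (beta_set \<alpha>) (beta_set \<beta>) b c"
proof -
  let ?A = "beta_set \<alpha>" and ?C = "beta_set \<beta>"
  have "?A = (?C - {b, c}) \<union> {bar b, bar c} \<longleftrightarrow> ?A = flip b (flip c ?C)"
    if "b \<notin> ?A" "c \<notin> ?A"
  proof (cases "bar c = b")
    case True
    then have "bar b = c" by auto
    then show ?thesis using True that by (auto simp: move_def)
  next
    case False
    then have "(?C - {b, c}) \<union> {bar b, bar c} = flip b (flip c ?C)" by (auto simp: move_def)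
    then show ?thesis by simp
  qed
  then show ?thesis by (auto simp: harpoons_via_def set_harpoons_def)
qed

lemma (in harpoons_pair) set_harpoons_unique:
  assumes "set_harpoons s t \<alpha> \<beta> b' c'"
  shows "c' = c"
proof (rule ccontr)
  assume "c' \<noteq> c"
  moreover have c': "c' \<in> \<beta>" "c' \<notin> \<alpha>" "[bar c' - c' = - s] (mod 2 * t)"
    using assms unfolding set_harpoons_def by blast+
  ultimately have "c' = b" by (auto simp: \<alpha>_eq middle_def mem_move)
  then have "[bar b - b = - s] (mod 2 * t)" "[bar b - b = t] (mod 2 * s)"
    using c'(3) harpoons unfolding set_harpoons_def by blast+
  then have "[bar b - b = - s] (mod t)" "[bar b - b = t] (mod s)" by algebra+
  moreover have "odd (bar b - b)" by (simp add: bar_def)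
  ultimately show False
    using odd_gap_in_semigroup[OF odd_s odd_t] bar_diff_notin_semigroup(1,2) by fastforce
qed

lemma psize_star:
  assumes "coprime_pair (int s) (int t)" "odd s" "odd t"
    and "sym_core (int s) (int t) (beta_set \<alpha>)" "sym_core (int s) (int t) (beta_set \<beta>)"
    and via: "harpoons_via s t \<alpha> \<beta> b c"
  shows "int (psize (star s t \<alpha> \<beta>)) = energy (flip c (beta_set \<beta>))"
proof -
  interpret coprime_pair "int s" "int t" by fact
  interpret harpoons_pair "int s" "int t" "beta_set \<alpha>" "beta_set \<beta>" b c
    using assms(2-5) via by unfold_locales (simp_all add: harpoons_via_iff)
  obtain \<gamma> where \<gamma>: "is_partition \<gamma>" "beta_set \<gamma> = flip c (beta_set \<beta>)"
    using beta_set_surj[OF maya_middle self_dual_charge[OF self_dual_middle]] unfolding middle_def .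
  have "star s t \<alpha> \<beta> = \<gamma>"
    unfolding star_def
  proof (rule the_equality)
    show "is_partition \<gamma> \<and> (\<exists>b c. harpoons_via s t \<alpha> \<beta> b c \<and> beta_set \<gamma> = beta_set \<beta> - {c} \<union> {bar c})"
      using \<gamma> via by (auto simp: move_def)
    fix \<delta> assume \<delta>: "is_partition \<delta> \<and> (\<exists>b c. harpoons_via s t \<alpha> \<beta> b c \<and> beta_set \<delta> = beta_set \<beta> - {c} \<union> {bar c})"
    then obtain b' c' where "set_harpoons (int s) (int t) (beta_set \<alpha>) (beta_set \<beta>) b' c'"
        "beta_set \<delta> = beta_set \<beta> - {c'} \<union> {bar c'}"
      unfolding harpoons_via_iff by blast
    then have "beta_set \<delta> = beta_set \<gamma>" using set_harpoons_unique by (simp add: \<gamma>(2) move_def)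
    then show "\<delta> = \<gamma>" using \<delta> \<gamma>(1) beta_set_inject by blast
  qed
  then show ?thesis using energy_beta_set[OF \<gamma>(1)] \<gamma>(2) by simp
qed

lemma harpoons_energy_iff:
  assumes "coprime_pair (int s) (int t)"
    and "sym_core (int s) (int t) (beta_set \<alpha>)" "sym_core (int s) (int t) (beta_set \<beta>)"
  shows "odd s \<and> odd t \<and>
      (\<exists>b c. set_harpoons (int s) (int t) (beta_set \<alpha>) (beta_set \<beta>) b c \<and> m = energy (flip c (beta_set \<beta>))) \<longleftrightarrow>
    odd s \<and> odd t \<and> harpoons s t \<alpha> \<beta> \<and> m = int (psize (star s t \<alpha> \<beta>))"
  using psize_star[OF assms(1) _ _ assms(2,3)] unfolding harpoons_def harpoons_via_iff by metis

lemma solution_beta_set_iff: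
  assumes "is_core s \<sigma>" "is_core t \<tau>" "s > 0" "t > 0" "is_partition \<nu>"
  shows "solution (int s) (int t) (beta_set \<sigma>) (beta_set \<tau>) (int n) (beta_set \<nu>) \<longleftrightarrow>
    psize \<nu> = n \<and> cor s \<nu> = \<sigma> \<and> cor t \<nu> = \<tau> \<and> conjugate_partition \<nu> = \<nu>"
  using assms(3,4) maya_beta_set[OF assms(5)]
  by (auto simp: solution_def energy_beta_set[OF assms(5)] self_conjugate_iff[OF assms(5)]
      cor_eq_iff[OF assms(5,1)] cor_eq_iff[OF assms(5,2)])

lemma ex1_self_conjugate_iff:
  assumes "is_core s \<sigma>" "is_core t \<tau>" "s > 0" "t > 0"
  shows "(\<exists>!\<nu>. \<nu> \<in> {\<nu>. is_partition \<nu> \<and> psize \<nu> = n \<and> cor s \<nu> = \<sigma> \<and> cor t \<nu> = \<tau>} \<and>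
      conjugate_partition \<nu> = \<nu>) \<longleftrightarrow>
    (\<exists>!B. solution (int s) (int t) (beta_set \<sigma>) (beta_set \<tau>) (int n) B)"
    (is "(\<exists>!\<nu>. ?P \<nu>) \<longleftrightarrow> (\<exists>!B. ?Q B)")
proof -
  have P_iff: "?P \<nu> \<longleftrightarrow> is_partition \<nu> \<and> ?Q (beta_set \<nu>)" for \<nu>
    using solution_beta_set_iff[OF assms, of \<nu> n] by auto
  have surj: "\<exists>\<nu>. ?P \<nu> \<and> beta_set \<nu> = B" if Q: "?Q B" for B
  proof -
    have "maya B" "charge (\<lambda>_. 1) B = 0" using Q self_dual_charge by (auto simp: solution_def)
    then obtain \<nu> where "is_partition \<nu>" "beta_set \<nu> = B" by (rule beta_set_surj)
    then show ?thesis using Q P_iff[of \<nu>] by auto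
  qed
  have inject: "\<nu> = \<mu>" if "?P \<nu>" "?P \<mu>" "beta_set \<nu> = beta_set \<mu>" for \<nu> \<mu>
    using that beta_set_inject by blast
  show ?thesis
  proof
    assume "\<exists>!\<nu>. ?P \<nu>"
    then obtain \<nu> where \<nu>: "?P \<nu>" "\<And>\<mu>. ?P \<mu> \<Longrightarrow> \<mu> = \<nu>" by (rule ex1E) iprover
    show "\<exists>!B. ?Q B"
    proof (rule ex1I)
      show "?Q (beta_set \<nu>)" using \<nu>(1) P_iff by blast
      show "B = beta_set \<nu>" if "?Q B" for B using surj[OF that] \<nu>(2) by blast
    qed
  next
    assume "\<exists>!B. ?Q B"
    then obtain B where B: "?Q B" "\<And>C. ?Q C \<Longrightarrow> C = B" by (rule ex1E) iprover
    obtain \<nu> where \<nu>: "?P \<nu>" "beta_set \<nu> = B" using surj[OF B(1)] by blast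
    show "\<exists>!\<nu>. ?P \<nu>"
    proof (rule ex1I)
      show "?P \<nu>" by (rule \<nu>(1))
      show "\<mu> = \<nu>" if "?P \<mu>" for \<mu> using inject[OF that \<nu>(1)] B(2)[of "beta_set \<mu>"] that P_iff \<nu>(2) by blast
    qed
  qed
qed

lemma five_cases_beta_set_iff:
  assumes st: "s > 1" "t > 1" "coprime s t" and \<alpha>: "is_partition \<alpha>" and \<beta>: "is_partition \<beta>"
    and cores: "sym_core (int s) (int t) (beta_set \<alpha>)" "sym_core (int s) (int t) (beta_set \<beta>)"
    and a: "a = psize \<alpha> + t * v" and b: "b = psize \<beta> + s * w"
  shows "five_cases (int s) (int t) (beta_set \<alpha>) (beta_set \<beta>) (int n - int t * int v - int s * int w) \<longleftrightarrow>
    (\<alpha> = \<beta> \<and> int n = int a + int b - int (psize \<alpha>)) \<or>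
    (odd t \<and> harpoon s t \<alpha> \<beta> \<and> n = b + t * (v + 1)) \<or>
    (odd s \<and> harpoon t s \<beta> \<alpha> \<and> n = a + s * (w + 1)) \<or>
    (odd s \<and> odd t \<and> harpoons s t \<alpha> \<beta> \<and> n = psize (star s t \<alpha> \<beta>) + s * (w + 1) + t * (v + 1)) \<or>
    (odd s \<and> odd t \<and> \<alpha> = kappa s t \<and> \<beta> = kappa s t \<and>
      int n = int a + int b - int (psize (kappa s t)) + int s * int t)"
proof -
  let ?A = "beta_set \<alpha>" and ?C = "beta_set \<beta>" and ?K = "kappa_set (int s) (int t)"
  let ?m = "int n - int t * int v - int s * int w"
  have pair: "coprime_pair (int s) (int t)" using st by unfold_locales simp_all
  note \<kappa> = kappa_eq_kappa_set[OF st]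
  note size = energy_beta_set[OF \<alpha>] energy_beta_set[OF \<beta>] energy_beta_set[OF \<kappa>(1), unfolded \<kappa>(2)]
  have eqs: "?A = ?C \<longleftrightarrow> \<alpha> = \<beta>" "?A = ?K \<longleftrightarrow> \<alpha> = kappa s t" "?C = ?K \<longleftrightarrow> \<beta> = kappa s t"
    using beta_set_inject \<alpha> \<beta> \<kappa> by metis+
  have equal: "\<alpha> = \<beta> \<and> ?m = energy ?A \<longleftrightarrow> \<alpha> = \<beta> \<and> int n = int a + int b - int (psize \<alpha>)"
    unfolding size a b by auto
  have t_hook: "?m = energy ?C + int t \<longleftrightarrow> n = b + t * (v + 1)"
    unfolding size b by (auto simp: algebra_simps simp flip: of_nat_mult of_nat_add)
  have s_hook: "?m = energy ?A + int s \<longleftrightarrow> n = a + s * (w + 1)"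
    unfolding size a by (auto simp: algebra_simps simp flip: of_nat_mult of_nat_add)
  have sum_iff: "?m = x + int s + int t \<longleftrightarrow> ?m - int s - int t = x" for x by auto
  have star_size: "?m - int s - int t = int (psize (star s t \<alpha> \<beta>)) \<longleftrightarrow>
      n = psize (star s t \<alpha> \<beta>) + s * (w + 1) + t * (v + 1)"
    by (auto simp: algebra_simps simp flip: of_nat_mult of_nat_add)
  have both: "odd s \<and> odd t \<and>
      (\<exists>b c. set_harpoons (int s) (int t) ?A ?C b c \<and> ?m = energy (flip c ?C) + int s + int t) \<longleftrightarrow>
    odd s \<and> odd t \<and> harpoons s t \<alpha> \<beta> \<and> n = psize (star s t \<alpha> \<beta>) + s * (w + 1) + t * (v + 1)"
    unfolding sum_iff harpoons_energy_iff[OF pair cores] star_size ..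
  have largest: "\<alpha> = kappa s t \<and> \<beta> = kappa s t \<and> ?m = energy ?K + int s * int t \<longleftrightarrow>
      \<alpha> = kappa s t \<and> \<beta> = kappa s t \<and> int n = int a + int b - int (psize (kappa s t)) + int s * int t"
    unfolding size a b by auto
  show ?thesis
    unfolding five_cases_def eqs harpoon_iff[symmetric] even_of_nat equal t_hook s_hook both largest ..
qed

theorem theorem5p15:
  fixes s t n :: nat and \<sigma> \<tau> :: "nat \<Rightarrow> nat"
  assumes "s > 1" and "t > 1" and "coprime s t"
    and "is_core s \<sigma>" and "is_core t \<tau>"
  shows "(\<exists>!\<nu>. \<nu> \<in> {\<nu>. is_partition \<nu> \<and> psize \<nu> = n \<and> cor s \<nu> = \<sigma> \<and> cor t \<nu> = \<tau>} \<and>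
              conjugate_partition \<nu> = \<nu>) \<longleftrightarrow>
    conjugate_partition \<sigma> = \<sigma> \<and> conjugate_partition \<tau> = \<tau> \<and>
    ((cor t \<sigma> = cor s \<tau> \<and>
        int n = int (psize \<sigma>) + int (psize \<tau>) - int (psize (cor t \<sigma>))) \<or>
     (odd t \<and> harpoon s t (cor t \<sigma>) (cor s \<tau>) \<and>
        n = psize \<tau> + t * (wei t \<sigma> + 1)) \<or>
     (odd s \<and> harpoon t s (cor s \<tau>) (cor t \<sigma>) \<and>
        n = psize \<sigma> + s * (wei s \<tau> + 1)) \<or>
     (odd s \<and> odd t \<and> harpoons s t (cor t \<sigma>) (cor s \<tau>) \<and>
        n = psize (star s t (cor t \<sigma>) (cor s \<tau>)) + s * (wei s \<tau> + 1) + t * (wei t \<sigma> + 1)) \<or>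
     (odd s \<and> odd t \<and> cor t \<sigma> = kappa s t \<and> cor s \<tau> = kappa s t \<and>
        int n = int (psize \<sigma>) + int (psize \<tau>) - int (psize (kappa s t)) + int s * int t))"
    (is "?unique \<longleftrightarrow> ?self_conjugate_\<sigma> \<and> ?self_conjugate_\<tau> \<and> ?cases")
proof -
  let ?\<alpha> = "cor t \<sigma>" and ?\<beta> = "cor s \<tau>"
  interpret coprime_pair "int s" "int t" using assms(1-3) by unfold_locales simp_all
  have pos: "s > 0" "t > 0" using assms(1,2) by simp_all
  have \<sigma>: "is_partition \<sigma>" "maya_core (int s) (beta_set \<sigma>)" and \<tau>: "is_partition \<tau>" "maya_core (int t) (beta_set \<tau>)"
    using assms(4,5) pos by (simp_all add: is_core_iff)
  note \<alpha> = cor_wei[OF \<sigma>(1) pos(2)] and \<beta> = cor_wei[OF \<tau>(1) pos(1)]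
  have \<alpha>\<beta>: "is_partition ?\<alpha>" "is_partition ?\<beta>" using \<alpha>(1) \<beta>(1) by (simp_all add: is_core_def)
  let ?m = "int n - int t * int (wei t \<sigma>) - int s * int (wei s \<tau>)"
  have "?unique \<longleftrightarrow> (\<exists>!B. solution (int s) (int t) (beta_set \<sigma>) (beta_set \<tau>) (int n) B)"
    by (rule ex1_self_conjugate_iff[OF assms(4,5) pos])
  also have "\<dots> \<longleftrightarrow> self_dual (beta_set \<sigma>) \<and> self_dual (beta_set \<tau>) \<and>
      five_cases (int s) (int t) (beta_set ?\<alpha>) (beta_set ?\<beta>) ?m"
    using unique_solution_iff[OF \<sigma>(2) \<alpha>(2) \<tau>(2) \<beta>(2), of "int n"] \<alpha>(3) \<beta>(3)
    by (simp add: energy_beta_set \<sigma> \<tau> \<alpha>\<beta>)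
  also have "\<dots> \<longleftrightarrow> ?self_conjugate_\<sigma> \<and> ?self_conjugate_\<tau> \<and> ?cases"
    unfolding self_conjugate_iff[OF \<sigma>(1)] self_conjugate_iff[OF \<tau>(1)]
    using five_cases_beta_set_iff[OF assms(1-3) \<alpha>\<beta>
        unique_solution_classification(1,2)[OF _ \<sigma>(2) \<alpha>(2) _ \<tau>(2) \<beta>(2)] \<alpha>(3) \<beta>(3)]
    by (intro conj_cong refl) blast
  finally show ?thesis .
qed

end
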